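(* Let $p$ be a prime and $\alpha>0$. Let $\mathcal{L}_\alpha$ be the isotropic Laplacian on $\mathbb{Q}_p$ associated with the triple $(d_p,\mu_p,\sigma_\alpha)$, where $d_p(x,y)=\|x-y\|_p$, $\mu_p$ is the Haar measure on $\mathbb{Q}_p$ with $\mu_p(\mathbb{Z}_p)=1$, and $$\sigma_\alpha(r)=\exp\left(-\left(\frac pr\right)^\alpha\right).$$ Let $\mathfrak{D}^\alpha$ be the operator of $p$-adic fractional derivative of order $\alpha$, and $\mathcal{V}_c$ the space of locally constant functions on $\mathbb{Q}_p$ with compact support. Then $$(\mathcal{L}_\alpha,\mathcal{V}_c)=(\mathfrak{D}^\alpha,\mathcal{V}_c),$$ that is, $\mathcal{V}_c\subset\operatorname{dom}_{\mathcal{L}_\alpha}$ and $\mathcal{L}_\alpha f=\mathfrak{D}^\alpha f$ for all $f\in\mathcal{V}_c$.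
   Context: $\|\cdot\|_p$ is the $p$-adic norm. The Fourier transform on $\mathbb{Q}_p$ is $\widehat f(\theta)=\int_{\mathbb{Q}_p}\langle x,\theta\rangle f(x)\,d\mu_p(x)$, where $\langle x,\theta\rangle=\exp(2\pi\sqrt{-1}\{x\theta\})$ and $\{x\theta\}$ is the fractional part of the $p$-adic number $x\theta$; it maps $\mathcal{V}_c$ bijectively onto itself. The operator $\mathfrak{D}^\alpha$ on $\mathcal{V}_c$ is defined by $\widehat{\mathfrak{D}^\alpha f}(\xi)=\|\xi\|_p^\alpha\,\widehat f(\xi)$, $\xi\in\mathbb{Q}_p$. It is known that, for $f\in\mathcal{V}_c$, $$\mathfrak{D}^\alpha f(x)=\frac{p^\alpha-1}{1-p^{-\alpha-1}}\int_{\mathbb{Q}_p}\frac{f(x)-f(y)}{\|x-y\|_p^{1+\alpha}}\,d\mu_p(y).$$ Isotropic Laplacian associated with $(d_p,\mu_p,\sigma)$: with $\mathrm{Q}_rf(x)=\frac1{\mu_p(B_r(x))}\int_{B_r(x)}f\,d\mu_p$, $B_r(x)=\{y:d_p(x,y)\le r\}$, put $P=\int_{[0,\infty)}\mathrm{Q}_r\,d\sigma(r)$, a self-adjoint operator in $L^2(\mathbb{Q}_p,\mu_p)$ with spectrum in $[0,1]$; then $\mathcal{L}=\log\frac1P$ in the sense of functional calculus, i.e. $P^t=\exp(-t\mathcal{L})$ for $t>0$. *)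

theory Defs
  imports "HOL-Analysis.Analysis" "HOL-Computational_Algebra.Primes"
begin

section \<open>The field of \<open>p\<close>-adic numbers\<close>

definition padic_abs :: "nat \<Rightarrow> rat \<Rightarrow> real" where
  "padic_abs p q = (if q = 0 then 0 else
     (let (a, b) = quotient_of q
      in real p powi (int (multiplicity (int p) b) - int (multiplicity (int p) a))))"

lemma padic_abs_0 [simp]: "padic_abs p 0 = 0"
  by (simp add: padic_abs_def)

lemma padic_abs_nonneg [simp]: "padic_abs p q \<ge> 0"
  by (simp add: padic_abs_def Let_def case_prod_unfold)

lemma rat_fraction_cases:
  obtains a b :: int where "q = (of_int a / of_int b :: rat)" "b \<noteq> 0"
  by (metis Fract_of_int_quotient quotient_of_denom_pos quotient_of_div surj_pair less_irrefl)

context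
  fixes p :: nat
  assumes p: "prime p"
begin

lemma padic_abs_of_int_divide:
  assumes "a \<noteq> 0" "b \<noteq> 0"
  shows "padic_abs p (of_int a / of_int b)
    = real p powi (int (multiplicity (int p) b) - int (multiplicity (int p) a))"
proof -
  let ?q = "of_int a / of_int b :: rat"
  obtain c d where cd: "quotient_of ?q = (c, d)"
    by fastforce
  have d: "d \<noteq> 0"
    using quotient_of_denom_pos[OF cd] by simp
  have eq: "?q = of_int c / of_int d"
    by (rule quotient_of_div[OF cd])
  then have c: "c \<noteq> 0"
    using assms by auto
  have "of_int (a * d) = (of_int (c * b) :: rat)"
    using eq assms d by (simp add: field_simps)
  then have "a * d = c * b"
    by (simp only: of_int_eq_iff)
  moreover have pr: "prime_elem (int p)"
    using p by simp
  ultimately have "multiplicity (int p) a + multiplicity (int p) d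
      = multiplicity (int p) c + multiplicity (int p) b"
    using assms c d by (metis prime_elem_multiplicity_mult_distrib)
  then have "int (multiplicity (int p) d) - int (multiplicity (int p) c)
      = int (multiplicity (int p) b) - int (multiplicity (int p) a)"
    by linarith
  then show ?thesis
    using assms by (simp add: padic_abs_def cd)
qed

lemma padic_abs_of_int:
  "a \<noteq> 0 \<Longrightarrow> padic_abs p (of_int a) = real p powi (- int (multiplicity (int p) a))"
  using padic_abs_of_int_divide[of a 1] by simp

lemma padic_abs_eq_0_iff [simp]: "padic_abs p q = 0 \<longleftrightarrow> q = 0"
  using prime_gt_0_nat[OF p] by (auto simp: padic_abs_def Let_def case_prod_unfold)

lemma padic_abs_mult: "padic_abs p (q * r) = padic_abs p q * padic_abs p r"
proof (cases "q = 0 \<or> r = 0")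
  case False
  obtain a b where q: "q = of_int a / of_int b" "b \<noteq> 0"
    by (rule rat_fraction_cases)
  obtain c d where r: "r = of_int c / of_int d" "d \<noteq> 0"
    by (rule rat_fraction_cases)
  have nz: "a \<noteq> 0" "c \<noteq> 0"
    using False q r by auto
  have eq: "q * r = of_int (a * c) / of_int (b * d)"
    using q r by simp
  have pr: "prime_elem (int p)" and p0: "real p \<noteq> 0"
    using p prime_gt_0_nat[OF p] by auto
  show ?thesis
    unfolding eq using q(2) r(2) nz p0
    by (subst padic_abs_of_int_divide)
      (simp_all add: q(1) r(1) padic_abs_of_int_divide prime_elem_multiplicity_mult_distrib[OF pr]
        power_int_add[symmetric] algebra_simps del: of_int_mult)
qed auto

lemma padic_abs_1 [simp]: "padic_abs p 1 = 1"
  by (simp add: padic_abs_def)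

lemma padic_abs_minus [simp]: "padic_abs p (- q) = padic_abs p q"
proof -
  have "padic_abs p (- 1) = 1"
    using padic_abs_of_int[of "-1"] by (simp add: multiplicity_unit_right)
  then show ?thesis
    using padic_abs_mult[of "-1" q] by simp
qed

lemma padic_abs_diff_commute: "padic_abs p (q - r) = padic_abs p (r - q)"
  using padic_abs_minus[of "q - r"] by simp

lemma padic_abs_inverse: "padic_abs p (inverse q) = inverse (padic_abs p q)"
proof (cases "q = 0")
  case False
  then have "padic_abs p q * padic_abs p (inverse q) = 1"
    by (simp flip: padic_abs_mult)
  then show ?thesis
    by (metis inverse_unique)
qed simp

lemma padic_abs_of_int_le_iff:
  assumes "a \<noteq> 0"
  shows "padic_abs p (of_int a) \<le> real p powi (- int n) \<longleftrightarrow> int p ^ n dvd a"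
proof -
  have "padic_abs p (of_int a) \<le> real p powi (- int n) \<longleftrightarrow> n \<le> multiplicity (int p) a"
    using padic_abs_of_int[OF assms] prime_gt_1_nat[OF p]
      power_int_increasing[of "- int (multiplicity (int p) a)" "- int n" "real p"]
      power_int_strict_increasing[of "- int n" "- int (multiplicity (int p) a)" "real p"]
    by (cases "n \<le> multiplicity (int p) a") auto
  also have "\<dots> \<longleftrightarrow> int p ^ n dvd a"
    using p assms by (subst power_dvd_iff_le_multiplicity) auto
  finally show ?thesis .
qed

lemma padic_abs_add: "padic_abs p (q + r) \<le> max (padic_abs p q) (padic_abs p r)"
proof -
  have int: "padic_abs p (of_int (a + b)) \<le> padic_abs p (of_int b)"
    if "b \<noteq> 0" and le: "padic_abs p (of_int a) \<le> padic_abs p (of_int b)" for a b :: int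
  proof (cases "a = 0 \<or> a + b = 0")
    case True
    then show ?thesis
    proof
      assume "a + b = 0"
      then show ?thesis by (metis of_int_0 padic_abs_0 padic_abs_nonneg)
    qed auto
  next
    case False
    let ?n = "multiplicity (int p) b"
    have b: "padic_abs p (of_int b) = real p powi (- int ?n)"
      using padic_abs_of_int that by blast
    then have "int p ^ ?n dvd a"
      using le False padic_abs_of_int_le_iff[of a ?n] by simp
    then have "int p ^ ?n dvd a + b"
      by (simp add: multiplicity_dvd)
    then show ?thesis
      using b False padic_abs_of_int_le_iff[of "a + b" ?n] by simp
  qed
  have int': "padic_abs p (of_int (a + b)) \<le> max (padic_abs p (of_int a)) (padic_abs p (of_int b))"
    for a b :: int
  proof (cases "padic_abs p (of_int a) \<le> padic_abs p (of_int b)")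
    case True
    then show ?thesis
      using int[of b a] padic_abs_nonneg[of p "of_int a"]
      by (cases "b = 0") auto
  next
    case False
    then have "a \<noteq> 0"
      by (metis of_int_0 padic_abs_0 padic_abs_nonneg)
    with False show ?thesis
      using int[of a b] by (simp add: add.commute)
  qed
  obtain a b where q: "q = of_int a / of_int b" "b \<noteq> 0"
    by (rule rat_fraction_cases)
  obtain c d where r: "r = of_int c / of_int d" "d \<noteq> 0"
    by (rule rat_fraction_cases)
  let ?e = "of_int (b * d) :: rat"
  have e: "?e \<noteq> 0"
    using q r by simp
  have "q = of_int (a * d) / ?e" "r = of_int (c * b) / ?e" "q + r = of_int (a * d + c * b) / ?e"
    using q r by (simp_all add: field_simps)
  then have *: "padic_abs p q = padic_abs p (of_int (a * d)) * padic_abs p (inverse ?e)"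
      "padic_abs p r = padic_abs p (of_int (c * b)) * padic_abs p (inverse ?e)"
      "padic_abs p (q + r) = padic_abs p (of_int (a * d + c * b)) * padic_abs p (inverse ?e)"
    by (simp_all only: divide_inverse padic_abs_mult)
  show ?thesis
    unfolding * using int'[of "a * d" "c * b"] padic_abs_nonneg[of p "inverse ?e"]
    by (metis max_mult_distrib_right mult_right_mono)
qed

lemma padic_abs_triangle: "padic_abs p (q + r) \<le> padic_abs p q + padic_abs p r"
  using padic_abs_add[of q r] padic_abs_nonneg[of p q] padic_abs_nonneg[of p r] by linarith

lemma padic_abs_diff_abs: "\<bar>padic_abs p q - padic_abs p r\<bar> \<le> padic_abs p (q - r)"
  using padic_abs_triangle[of "q - r" r] padic_abs_triangle[of "r - q" q]
    padic_abs_diff_commute[of q r] by simp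

end

definition padic_Cauchy :: "nat \<Rightarrow> (nat \<Rightarrow> rat) \<Rightarrow> bool" where
  "padic_Cauchy p X \<longleftrightarrow> (\<forall>e>0. \<exists>N. \<forall>m\<ge>N. \<forall>n\<ge>N. padic_abs p (X m - X n) < e)"

definition padic_null :: "nat \<Rightarrow> (nat \<Rightarrow> rat) \<Rightarrow> bool" where
  "padic_null p X \<longleftrightarrow> (\<lambda>n. padic_abs p (X n)) \<longlonglongrightarrow> 0"

definition padic_rel :: "nat \<Rightarrow> (nat \<Rightarrow> rat) \<Rightarrow> (nat \<Rightarrow> rat) \<Rightarrow> bool" where
  "padic_rel p X Y \<longleftrightarrow> padic_Cauchy p X \<and> padic_Cauchy p Y \<and> padic_null p (\<lambda>n. X n - Y n)"

context
  fixes p :: nat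
  assumes p: "prime p"
begin

lemma padic_Cauchy_const [simp]: "padic_Cauchy p (\<lambda>_. q)"
  by (simp add: padic_Cauchy_def)

lemma padic_null_0 [simp]: "padic_null p (\<lambda>_. 0)"
  by (simp add: padic_null_def)

lemma padic_Cauchy_add:
  assumes "padic_Cauchy p X" "padic_Cauchy p Y"
  shows "padic_Cauchy p (\<lambda>n. X n + Y n)"
  unfolding padic_Cauchy_def
proof (intro allI impI)
  fix e :: real
  assume "e > 0"
  then obtain M N where "\<forall>m\<ge>M. \<forall>n\<ge>M. padic_abs p (X m - X n) < e"
      "\<forall>m\<ge>N. \<forall>n\<ge>N. padic_abs p (Y m - Y n) < e"
    using assms unfolding padic_Cauchy_def by meson
  moreover have "padic_abs p ((X m + Y m) - (X n + Y n))
      \<le> max (padic_abs p (X m - X n)) (padic_abs p (Y m - Y n))" for m n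
    using padic_abs_add[OF p, of "X m - X n" "Y m - Y n"] by (simp add: algebra_simps)
  ultimately have "\<forall>m\<ge>max M N. \<forall>n\<ge>max M N. padic_abs p ((X m + Y m) - (X n + Y n)) < e"
    by (smt (verit, ccfv_threshold) max.bounded_iff)
  then show "\<exists>K. \<forall>m\<ge>K. \<forall>n\<ge>K. padic_abs p ((X m + Y m) - (X n + Y n)) < e"
    by blast
qed

lemma padic_Cauchy_minus: "padic_Cauchy p X \<Longrightarrow> padic_Cauchy p (\<lambda>n. - X n)"
  unfolding padic_Cauchy_def
  by (metis padic_abs_minus[OF p] minus_diff_minus)

lemma padic_Cauchy_abs_convergent:
  assumes "padic_Cauchy p X"
  shows "convergent (\<lambda>n. padic_abs p (X n))"
proof -
  have "Cauchy (\<lambda>n. padic_abs p (X n))"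
    unfolding Cauchy_def dist_real_def
    using assms[unfolded padic_Cauchy_def] padic_abs_diff_abs[OF p]
    by (meson le_less_trans)
  then show ?thesis
    by (simp add: Cauchy_convergent_iff)
qed

lemma padic_Cauchy_bounded:
  assumes "padic_Cauchy p X"
  obtains B where "B > 0" "\<And>n. padic_abs p (X n) \<le> B"
  using convergent_imp_Bseq[OF padic_Cauchy_abs_convergent[OF assms]]
  by (auto simp: Bseq_def)

lemma padic_null_add:
  "padic_null p X \<Longrightarrow> padic_null p Y \<Longrightarrow> padic_null p (\<lambda>n. X n + Y n)"
  unfolding padic_null_def
  by (rule tendsto_sandwich[OF _ always_eventually tendsto_const
        tendsto_add_zero[of "\<lambda>n. padic_abs p (X n)" _ "\<lambda>n. padic_abs p (Y n)"]])
    (auto intro: padic_abs_triangle[OF p])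

lemma padic_null_minus: "padic_null p X \<Longrightarrow> padic_null p (\<lambda>n. - X n)"
  by (simp add: padic_null_def padic_abs_minus[OF p])

lemma padic_null_mult:
  assumes "padic_null p X" "padic_Cauchy p Y"
  shows "padic_null p (\<lambda>n. X n * Y n)"
proof -
  obtain L where "(\<lambda>n. padic_abs p (Y n)) \<longlonglongrightarrow> L"
    using padic_Cauchy_abs_convergent[OF assms(2)] by (auto simp: convergent_def)
  then show ?thesis
    using tendsto_mult[of _ 0 sequentially _ L] assms(1)
    by (fastforce simp: padic_null_def padic_abs_mult[OF p])
qed

lemma padic_Cauchy_mult:
  assumes "padic_Cauchy p X" "padic_Cauchy p Y"
  shows "padic_Cauchy p (\<lambda>n. X n * Y n)"
  unfolding padic_Cauchy_def
proof (intro allI impI)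
  fix e :: real
  assume e: "e > 0"
  obtain B where B: "B > 0" "\<And>n. padic_abs p (X n) \<le> B"
    using padic_Cauchy_bounded[OF assms(1)] by blast
  obtain C where C: "C > 0" "\<And>n. padic_abs p (Y n) \<le> C"
    using padic_Cauchy_bounded[OF assms(2)] by blast
  have "e / C > 0" "e / B > 0"
    using e B C by simp_all
  then obtain M N where M: "\<And>m n. m \<ge> M \<Longrightarrow> n \<ge> M \<Longrightarrow> padic_abs p (X m - X n) < e / C"
      and N: "\<And>m n. m \<ge> N \<Longrightarrow> n \<ge> N \<Longrightarrow> padic_abs p (Y m - Y n) < e / B"
    using assms unfolding padic_Cauchy_def by meson
  have "padic_abs p (X m * Y m - X n * Y n) < e" if "m \<ge> max M N" "n \<ge> max M N" for m n
  proof -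
    have "X m * Y m - X n * Y n = X m * (Y m - Y n) + (X m - X n) * Y n"
      by (simp add: algebra_simps)
    then have *: "padic_abs p (X m * Y m - X n * Y n)
        \<le> max (padic_abs p (X m) * padic_abs p (Y m - Y n))
              (padic_abs p (X m - X n) * padic_abs p (Y n))"
      by (metis padic_abs_add[OF p] padic_abs_mult[OF p])
    have "padic_abs p (X m) * padic_abs p (Y m - Y n) \<le> B * padic_abs p (Y m - Y n)"
      using B by (intro mult_right_mono) auto
    also have "\<dots> < e"
      using N[of m n] that B by (simp add: field_simps)
    finally have 1: "padic_abs p (X m) * padic_abs p (Y m - Y n) < e" .
    have "padic_abs p (X m - X n) * padic_abs p (Y n) \<le> padic_abs p (X m - X n) * C"
      using C by (intro mult_left_mono) auto
    also have "\<dots> < e"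
      using M[of m n] that C by (simp add: field_simps)
    finally show ?thesis
      using * 1 by linarith
  qed
  then show "\<exists>K. \<forall>m\<ge>K. \<forall>n\<ge>K. padic_abs p (X m * Y m - X n * Y n) < e"
    by blast
qed

lemma padic_not_null_bound:
  assumes "padic_Cauchy p X" "\<not> padic_null p X"
  obtains c N where "c > 0" "\<And>n. n \<ge> N \<Longrightarrow> padic_abs p (X n) > c"
proof -
  obtain L where L: "(\<lambda>n. padic_abs p (X n)) \<longlonglongrightarrow> L"
    using padic_Cauchy_abs_convergent[OF assms(1)] by (auto simp: convergent_def)
  then have "L \<noteq> 0" "L \<ge> 0"
    using assms(2) by (auto simp: padic_null_def intro: LIMSEQ_le_const)
  then have "L / 2 > 0" "L / 2 < L"
    by simp_all
  moreover have "\<forall>\<^sub>F n in sequentially. padic_abs p (X n) > L / 2"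
    using L \<open>L / 2 < L\<close> by (rule order_tendstoD)
  ultimately show thesis
    using that[of "L / 2"] unfolding eventually_sequentially by blast
qed

lemma padic_Cauchy_inverse:
  assumes "padic_Cauchy p X" "\<not> padic_null p X"
  shows "padic_Cauchy p (\<lambda>n. inverse (X n))"
  unfolding padic_Cauchy_def
proof (intro allI impI)
  fix e :: real
  assume e: "e > 0"
  obtain c N where c: "c > 0" "\<And>n. n \<ge> N \<Longrightarrow> padic_abs p (X n) > c"
    using padic_not_null_bound[OF assms] by blast
  have "e * (c * c) > 0"
    using e c by simp
  then obtain M where M: "\<And>m n. m \<ge> M \<Longrightarrow> n \<ge> M \<Longrightarrow> padic_abs p (X m - X n) < e * (c * c)"
    using assms(1) unfolding padic_Cauchy_def by meson
  have "padic_abs p (inverse (X m) - inverse (X n)) < e" if "m \<ge> max M N" "n \<ge> max M N" for m n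
  proof -
    have cm: "padic_abs p (X m) > c" and cn: "padic_abs p (X n) > c"
      using c that by auto
    then have "X m \<noteq> 0" "X n \<noteq> 0"
      using c by auto
    then have "inverse (X m) - inverse (X n) = (X n - X m) * (inverse (X m) * inverse (X n))"
      by (simp add: field_simps)
    then have eq: "padic_abs p (inverse (X m) - inverse (X n))
        = padic_abs p (X m - X n) / (padic_abs p (X m) * padic_abs p (X n))"
      by (simp add: padic_abs_mult[OF p] padic_abs_inverse[OF p] divide_inverse
          padic_abs_diff_commute[OF p, of "X n"])
    have pos: "c * c < padic_abs p (X m) * padic_abs p (X n)"
      using cm cn c by (intro mult_strict_mono) auto
    have "padic_abs p (X m - X n) < e * (c * c)"
      using M that by simp
    also have "\<dots> < e * (padic_abs p (X m) * padic_abs p (X n))"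
      using pos e by simp
    finally show ?thesis
      unfolding eq using pos c by (subst pos_divide_less_eq) (auto intro: less_trans[of 0 "c * c"])
  qed
  then show "\<exists>K. \<forall>m\<ge>K. \<forall>n\<ge>K. padic_abs p (inverse (X m) - inverse (X n)) < e"
    by blast
qed

lemma padic_rel_equivp: "part_equivp (padic_rel p)"
proof (rule part_equivpI)
  have "padic_rel p (\<lambda>_. 0) (\<lambda>_. 0)"
    by (simp add: padic_rel_def)
  then show "\<exists>X. padic_rel p X X"
    by blast
  show "symp (padic_rel p)"
    by (auto simp: symp_def padic_rel_def dest: padic_null_minus)
  show "transp (padic_rel p)"
    by (auto simp: transp_def padic_rel_def dest: padic_null_add)
qed

end

text \<open>The prime is carried by a type parameter \<open>'p\<close>, via its cardinality, in the same way as the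
  dimension in \<open>real ^ 'n\<close>.\<close>

class prime_card =
  assumes prime_card: "prime CARD('a)"

typedef (overloaded) ('p :: prime_card) padic =
    "{{Y. padic_rel CARD('p) X Y} | X. padic_Cauchy CARD('p) X}"
proof -
  have "padic_Cauchy CARD('p) (\<lambda>_. 0)"
    by (simp add: padic_Cauchy_const[OF prime_card])
  then show ?thesis
    by blast
qed

definition padic_lim :: "(nat \<Rightarrow> rat) \<Rightarrow> 'p :: prime_card padic" where
  "padic_lim X = Abs_padic {Y. padic_rel CARD('p) X Y}"

definition padic_seq :: "'p :: prime_card padic \<Rightarrow> nat \<Rightarrow> rat" where
  "padic_seq x = (SOME X. X \<in> Rep_padic x)"

lemma padic_lim_eq_iff:
  assumes "padic_Cauchy CARD('p) X" "padic_Cauchy CARD('p) Y"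
  shows "(padic_lim X :: 'p :: prime_card padic) = padic_lim Y
    \<longleftrightarrow> padic_null CARD('p) (\<lambda>n. X n - Y n)"
proof -
  note eq = padic_rel_equivp[OF prime_card[where 'a='p]]
  have refl: "padic_rel CARD('p) X X" "padic_rel CARD('p) Y Y"
    using assms by (simp_all add: padic_rel_def padic_null_0[OF prime_card])
  have "(padic_lim X :: 'p padic) = padic_lim Y
      \<longleftrightarrow> {Z. padic_rel CARD('p) X Z} = {Z. padic_rel CARD('p) Y Z}"
    unfolding padic_lim_def using assms by (subst Abs_padic_inject) auto
  also have "\<dots> \<longleftrightarrow> padic_rel CARD('p) X Y"
    using refl eq by (metis (mono_tags, lifting) Collect_cong mem_Collect_eq part_equivp_symp
        part_equivp_transp)
  finally show ?thesis
    using assms by (simp add: padic_rel_def)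
qed

lemma padic_seq_Cauchy [simp]: "padic_Cauchy CARD('p) (padic_seq (x :: 'p :: prime_card padic))"
  and padic_lim_padic_seq [simp]: "padic_lim (padic_seq x) = x"
proof -
  obtain X where X: "padic_Cauchy CARD('p) X" "Rep_padic x = {Y. padic_rel CARD('p) X Y}"
    using Rep_padic[of x] by blast
  then have "X \<in> Rep_padic x"
    by (simp add: padic_rel_def padic_null_0[OF prime_card])
  then have "padic_seq x \<in> Rep_padic x"
    unfolding padic_seq_def by (rule someI[of "\<lambda>X. X \<in> Rep_padic x"])
  then have rel: "padic_rel CARD('p) X (padic_seq x)"
    using X by simp
  then show C: "padic_Cauchy CARD('p) (padic_seq x)"
    by (simp add: padic_rel_def)
  have "padic_lim X = x"
    using X(2) by (simp add: padic_lim_def flip: X(2)) (simp add: Rep_padic_inverse)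
  moreover have "padic_lim X = (padic_lim (padic_seq x) :: 'p padic)"
    using padic_lim_eq_iff[OF X(1) C] rel by (simp add: padic_rel_def)
  ultimately show "padic_lim (padic_seq x) = x"
    by simp
qed

lemma padic_cases:
  obtains X where "padic_Cauchy CARD('p) X" "x = (padic_lim X :: 'p :: prime_card padic)"
  using padic_seq_Cauchy padic_lim_padic_seq by metis

lemma padic_lim_seq_null:
  assumes "padic_Cauchy CARD('p) X"
  shows "padic_null CARD('p) (\<lambda>n. X n - padic_seq (padic_lim X :: 'p :: prime_card padic) n)"
  using assms by (subst padic_lim_eq_iff[symmetric]) auto

instantiation padic :: (prime_card) field
begin

definition "0 = padic_lim (\<lambda>_. 0)"
definition "1 = padic_lim (\<lambda>_. 1)"
definition "x + y = padic_lim (\<lambda>n. padic_seq x n + padic_seq y n)"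
definition "- x = padic_lim (\<lambda>n. - padic_seq x n)"
definition "x - y = x + - y" for x y :: "'a padic"
definition "x * y = padic_lim (\<lambda>n. padic_seq x n * padic_seq y n)"
definition "inverse x = (if x = 0 then 0 else padic_lim (\<lambda>n. inverse (padic_seq x n)))"
definition "x div y = x * inverse y" for x y :: "'a padic"

lemma padic_lim_eq_0_iff:
  assumes "padic_Cauchy CARD('a) X"
  shows "(padic_lim X :: 'a padic) = 0 \<longleftrightarrow> padic_null CARD('a) X"
  unfolding zero_padic_def using padic_lim_eq_iff[OF assms padic_Cauchy_const[OF prime_card], of 0]
  by simp

lemma padic_lim_add:
  assumes "padic_Cauchy CARD('a) X" "padic_Cauchy CARD('a) Y"
  shows "padic_lim X + padic_lim Y = (padic_lim (\<lambda>n. X n + Y n) :: 'a padic)"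
proof -
  let ?X = "padic_seq (padic_lim X :: 'a padic)" and ?Y = "padic_seq (padic_lim Y :: 'a padic)"
  have "padic_null CARD('a) (\<lambda>n. (X n - ?X n) + (Y n - ?Y n))"
    using assms by (intro padic_null_add[OF prime_card] padic_lim_seq_null)
  also have "(\<lambda>n. (X n - ?X n) + (Y n - ?Y n)) = (\<lambda>n. (X n + Y n) - (?X n + ?Y n))"
    by (simp add: algebra_simps)
  finally show ?thesis
    unfolding plus_padic_def using assms
    by (subst eq_commute, subst padic_lim_eq_iff) (auto intro!: padic_Cauchy_add[OF prime_card])
qed

lemma padic_lim_minus:
  assumes "padic_Cauchy CARD('a) X"
  shows "- padic_lim X = (padic_lim (\<lambda>n. - X n) :: 'a padic)"
proof -
  let ?X = "padic_seq (padic_lim X :: 'a padic)"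
  have "padic_null CARD('a) (\<lambda>n. - (X n - ?X n))"
    using assms by (intro padic_null_minus[OF prime_card] padic_lim_seq_null)
  also have "(\<lambda>n. - (X n - ?X n)) = (\<lambda>n. - X n - - ?X n)"
    by simp
  finally show ?thesis
    unfolding uminus_padic_def using assms
    by (subst eq_commute, subst padic_lim_eq_iff) (auto intro!: padic_Cauchy_minus[OF prime_card])
qed

lemma padic_lim_diff:
  assumes "padic_Cauchy CARD('a) X" "padic_Cauchy CARD('a) Y"
  shows "padic_lim X - padic_lim Y = (padic_lim (\<lambda>n. X n - Y n) :: 'a padic)"
  using assms
  by (simp add: minus_padic_def padic_lim_minus padic_lim_add padic_Cauchy_minus[OF prime_card])

lemma padic_lim_mult:
  assumes "padic_Cauchy CARD('a) X" "padic_Cauchy CARD('a) Y"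
  shows "padic_lim X * padic_lim Y = (padic_lim (\<lambda>n. X n * Y n) :: 'a padic)"
proof -
  let ?X = "padic_seq (padic_lim X :: 'a padic)" and ?Y = "padic_seq (padic_lim Y :: 'a padic)"
  have "padic_null CARD('a) (\<lambda>n. (X n - ?X n) * Y n + (Y n - ?Y n) * ?X n)"
    using assms by (intro padic_null_add[OF prime_card] padic_null_mult[OF prime_card]
        padic_lim_seq_null padic_seq_Cauchy)
  also have "(\<lambda>n. (X n - ?X n) * Y n + (Y n - ?Y n) * ?X n) = (\<lambda>n. X n * Y n - ?X n * ?Y n)"
    by (simp add: algebra_simps)
  finally show ?thesis
    unfolding times_padic_def using assms
    by (subst eq_commute, subst padic_lim_eq_iff) (auto intro!: padic_Cauchy_mult[OF prime_card])
qed

instance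
proof
  fix a b c :: "'a padic"
  obtain A where A: "padic_Cauchy CARD('a) A" "a = padic_lim A"
    by (rule padic_cases)
  obtain B where B: "padic_Cauchy CARD('a) B" "b = padic_lim B"
    by (rule padic_cases)
  obtain C where C: "padic_Cauchy CARD('a) C" "c = padic_lim C"
    by (rule padic_cases)
  note [simp] = A B C padic_lim_add padic_lim_minus padic_lim_mult padic_Cauchy_add[OF prime_card]
    padic_Cauchy_minus[OF prime_card] padic_Cauchy_mult[OF prime_card]
    padic_Cauchy_const[OF prime_card]
  show "a + b + c = a + (b + c)" "a + b = b + a" "a * b * c = a * (b * c)" "a * b = b * a"
      "(a + b) * c = a * c + b * c"
    by (simp_all add: algebra_simps)
  show "0 + a = a" "- a + a = 0" "1 * a = a"
    by (simp_all add: zero_padic_def one_padic_def)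
  show "a - b = a + - b" "a div b = a * inverse b" "inverse (0 :: 'a padic) = 0"
    by (simp_all add: minus_padic_def divide_padic_def inverse_padic_def)
  show "(0 :: 'a padic) \<noteq> 1"
    by (subst eq_commute) (simp add: one_padic_def padic_lim_eq_0_iff padic_null_def
        padic_abs_1[OF prime_card] LIMSEQ_const_iff)
  show "inverse a * a = 1" if "a \<noteq> 0"
  proof -
    let ?A = "padic_seq a"
    have nn: "\<not> padic_null CARD('a) ?A"
      using that padic_lim_eq_0_iff[OF padic_seq_Cauchy, of a] by (simp del: A)
    have CI: "padic_Cauchy CARD('a) (\<lambda>n. inverse (?A n))"
      using nn by (intro padic_Cauchy_inverse[OF prime_card]) (simp_all del: A)
    obtain d N where d: "d > 0" "\<And>n. n \<ge> N \<Longrightarrow> padic_abs CARD('a) (?A n) > d"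
      using padic_not_null_bound[OF prime_card padic_seq_Cauchy nn] by blast
    have "\<forall>\<^sub>F n in sequentially. padic_abs CARD('a) (inverse (?A n) * ?A n - 1) = 0"
      using eventually_ge_at_top[of N]
    proof eventually_elim
      case (elim n)
      then have "?A n \<noteq> 0"
        using d(1) d(2)[of n] by auto
      then show ?case
        by simp
    qed
    then have "padic_null CARD('a) (\<lambda>n. inverse (?A n) * ?A n - 1)"
      unfolding padic_null_def by (rule tendsto_eventually)
    moreover have "inverse a * a = padic_lim (\<lambda>n. inverse (?A n) * ?A n)"
      using that CI padic_lim_mult[OF CI padic_seq_Cauchy[of a]]
      by (simp add: inverse_padic_def del: A)
    ultimately show ?thesis
      using CI by (simp add: one_padic_def padic_lim_eq_iff del: A)
  qed
qed

end

definition padic_norm :: "'p :: prime_card padic \<Rightarrow> real" where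
  "padic_norm x = lim (\<lambda>n. padic_abs CARD('p) (padic_seq x n))"

lemma padic_norm_LIMSEQ:
  assumes "padic_Cauchy CARD('p) X"
  shows "(\<lambda>n. padic_abs CARD('p) (X n)) \<longlonglongrightarrow> padic_norm (padic_lim X :: 'p :: prime_card padic)"
proof -
  let ?X = "padic_seq (padic_lim X :: 'p padic)"
  have "(\<lambda>n. padic_abs CARD('p) (?X n)) \<longlonglongrightarrow> padic_norm (padic_lim X :: 'p padic)"
    using padic_Cauchy_abs_convergent[OF prime_card padic_seq_Cauchy]
    unfolding padic_norm_def by (simp add: convergent_LIMSEQ_iff)
  moreover have "(\<lambda>n. padic_abs CARD('p) (X n) - padic_abs CARD('p) (?X n)) \<longlonglongrightarrow> 0"
    using padic_lim_seq_null[OF assms] unfolding padic_null_def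
    by (rule Lim_null_comparison[rotated])
      (auto intro!: always_eventually padic_abs_diff_abs[OF prime_card])
  ultimately show ?thesis
    using tendsto_add by fastforce
qed

lemma padic_norm_nonneg: "padic_norm (x :: 'p :: prime_card padic) \<ge> 0"
  using padic_norm_LIMSEQ[OF padic_seq_Cauchy, of x] by (auto intro: LIMSEQ_le_const)

lemma padic_norm_eq_0_iff: "padic_norm (x :: 'p :: prime_card padic) = 0 \<longleftrightarrow> x = 0"
  using padic_norm_LIMSEQ[OF padic_seq_Cauchy, of x] padic_lim_eq_0_iff[OF padic_seq_Cauchy, of x]
  by (auto simp: padic_null_def dest: LIMSEQ_unique)

lemma padic_norm_mult: "padic_norm (x * y) = padic_norm x * padic_norm (y :: 'p :: prime_card padic)"
proof -
  let ?XY = "\<lambda>n. padic_seq x n * padic_seq y n"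
  have "padic_Cauchy CARD('p) ?XY"
    by (intro padic_Cauchy_mult[OF prime_card] padic_seq_Cauchy)
  from padic_norm_LIMSEQ[OF this]
  have "(\<lambda>n. padic_abs CARD('p) (?XY n)) \<longlonglongrightarrow> padic_norm (x * y)"
    by (simp add: times_padic_def)
  moreover have "(\<lambda>n. padic_abs CARD('p) (?XY n)) \<longlonglongrightarrow> padic_norm x * padic_norm y"
    using tendsto_mult[OF padic_norm_LIMSEQ[OF padic_seq_Cauchy, of x]
        padic_norm_LIMSEQ[OF padic_seq_Cauchy, of y]]
    by (simp add: padic_abs_mult[OF prime_card])
  ultimately show ?thesis
    by (rule LIMSEQ_unique)
qed

lemma padic_norm_add: "padic_norm (x + y) \<le> max (padic_norm x) (padic_norm (y :: 'p :: prime_card padic))"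
proof -
  let ?XY = "\<lambda>n. padic_seq x n + padic_seq y n"
  have "padic_Cauchy CARD('p) ?XY"
    by (intro padic_Cauchy_add[OF prime_card] padic_seq_Cauchy)
  from padic_norm_LIMSEQ[OF this]
  have "(\<lambda>n. padic_abs CARD('p) (?XY n)) \<longlonglongrightarrow> padic_norm (x + y)"
    by (simp add: plus_padic_def)
  moreover have "(\<lambda>n. max (padic_abs CARD('p) (padic_seq x n)) (padic_abs CARD('p) (padic_seq y n)))
      \<longlonglongrightarrow> max (padic_norm x) (padic_norm y)"
    using tendsto_max[OF padic_norm_LIMSEQ[OF padic_seq_Cauchy, of x]
        padic_norm_LIMSEQ[OF padic_seq_Cauchy, of y]] by simp
  ultimately show ?thesis
    by (rule LIMSEQ_le) (auto intro: padic_abs_add[OF prime_card])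
qed

lemma padic_norm_minus: "padic_norm (- x) = padic_norm (x :: 'p :: prime_card padic)"
proof -
  have "padic_Cauchy CARD('p) (\<lambda>n. - padic_seq x n)"
    by (intro padic_Cauchy_minus[OF prime_card] padic_seq_Cauchy)
  from padic_norm_LIMSEQ[OF this] padic_norm_LIMSEQ[OF padic_seq_Cauchy, of x]
  show ?thesis
    by (auto simp: uminus_padic_def padic_abs_minus[OF prime_card] intro: LIMSEQ_unique)
qed

lemma padic_norm_const: "padic_norm (padic_lim (\<lambda>_. q) :: 'p :: prime_card padic) = padic_abs CARD('p) q"
  using padic_norm_LIMSEQ[OF padic_Cauchy_const[OF prime_card[where 'a='p]], of q]
  by (simp add: LIMSEQ_const_iff)

lemma padic_of_nat: "of_nat n = (padic_lim (\<lambda>_. of_nat n) :: 'p :: prime_card padic)"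
  by (induction n)
    (simp_all add: zero_padic_def one_padic_def padic_lim_add padic_Cauchy_const[OF prime_card])

instance padic :: (prime_card) field_char_0
proof
  show "inj (of_nat :: nat \<Rightarrow> 'a padic)"
  proof (rule injI)
    fix m n :: nat
    assume "of_nat m = (of_nat n :: 'a padic)"
    then have "padic_null CARD('a) (\<lambda>_. of_nat m - of_nat n)"
      using padic_lim_eq_iff[where 'p='a, OF padic_Cauchy_const padic_Cauchy_const,
          OF prime_card prime_card]
      by (simp only: padic_of_nat)
    then show "m = n"
      unfolding padic_null_def LIMSEQ_const_iff padic_abs_eq_0_iff[OF prime_card] by simp
  qed
qed

lemma padic_of_int: "of_int k = (padic_lim (\<lambda>_. of_int k) :: 'p :: prime_card padic)"
  by (cases k rule: int_cases2)
    (simp_all add: padic_of_nat padic_lim_minus padic_Cauchy_const[OF prime_card])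

lemma padic_of_rat: "of_rat q = (padic_lim (\<lambda>_. q) :: 'p :: prime_card padic)"
proof -
  obtain a b where q: "q = of_int a / of_int b" "b \<noteq> 0"
    by (rule rat_fraction_cases)
  have "padic_lim (\<lambda>_. q) * of_int b = (of_int a :: 'p padic)"
    using q by (simp add: padic_of_int padic_lim_mult padic_Cauchy_const[OF prime_card])
  moreover have "of_int b \<noteq> (0 :: 'p padic)"
    using q by simp
  ultimately have "padic_lim (\<lambda>_. q) = (of_int a / of_int b :: 'p padic)"
    by (metis nonzero_mult_div_cancel_right)
  then show ?thesis
    using q by (simp add: of_rat_divide)
qed

lemma padic_norm_of_rat: "padic_norm (of_rat q :: 'p :: prime_card padic) = padic_abs CARD('p) q"
  by (simp add: padic_of_rat padic_norm_const)

instantiation padic :: (prime_card) metric_space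
begin

definition dist_padic :: "'a padic \<Rightarrow> 'a padic \<Rightarrow> real" where
  "dist_padic x y = padic_norm (x - y)"

definition uniformity_padic :: "('a padic \<times> 'a padic) filter" where
  "uniformity_padic = (INF e\<in>{0 <..}. principal {(x, y). dist x y < e})"

definition open_padic :: "'a padic set \<Rightarrow> bool" where
  "open_padic S = (\<forall>x\<in>S. \<forall>\<^sub>F (x', y) in uniformity. x' = x \<longrightarrow> y \<in> S)"

instance
proof
  fix x y z :: "'a padic" and S :: "'a padic set"
  show "uniformity = (INF e\<in>{0 <..}. principal {(x :: 'a padic, y). dist x y < e})"
    by (simp add: uniformity_padic_def)
  show "open S = (\<forall>x\<in>S. \<forall>\<^sub>F (x', y) in uniformity. x' = x \<longrightarrow> y \<in> S)"
    by (simp add: open_padic_def)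
  show "dist x y = 0 \<longleftrightarrow> x = y"
    by (simp add: dist_padic_def padic_norm_eq_0_iff)
  have "padic_norm (x - y) \<le> max (padic_norm (x - z)) (padic_norm (z - y))"
    using padic_norm_add[of "x - z" "z - y"] by simp
  also have "padic_norm (z - y) = padic_norm (y - z)"
    using padic_norm_minus[of "y - z"] by simp
  finally show "dist x y \<le> dist x z + dist y z"
    using padic_norm_nonneg[of "x - z"] padic_norm_nonneg[of "y - z"]
    by (simp add: dist_padic_def)
qed

end

lemma padic_of_rat_LIMSEQ:
  assumes "padic_Cauchy CARD('p) X"
  shows "(\<lambda>n. of_rat (X n)) \<longlonglongrightarrow> (padic_lim X :: 'p :: prime_card padic)"
  unfolding lim_sequentially
proof (intro allI impI)
  fix e :: real
  assume e: "e > 0"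
  then obtain N where N: "\<And>m n. m \<ge> N \<Longrightarrow> n \<ge> N \<Longrightarrow> padic_abs CARD('p) (X m - X n) < e / 2"
    using assms unfolding padic_Cauchy_def by (meson half_gt_zero)
  have "dist (of_rat (X n)) (padic_lim X :: 'p padic) < e" if "n \<ge> N" for n
  proof -
    have C: "padic_Cauchy CARD('p) (\<lambda>m. X n - X m)"
      using padic_Cauchy_add[OF prime_card padic_Cauchy_const[OF prime_card]
          padic_Cauchy_minus[OF prime_card assms], of "X n"] by simp
    have "of_rat (X n) - padic_lim X = (padic_lim (\<lambda>m. X n - X m) :: 'p padic)"
      using assms by (simp add: padic_of_rat padic_lim_diff padic_Cauchy_const[OF prime_card])
    then have "(\<lambda>m. padic_abs CARD('p) (X n - X m)) \<longlonglongrightarrow> dist (of_rat (X n)) (padic_lim X :: 'p padic)"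
      using padic_norm_LIMSEQ[OF C] by (simp add: dist_padic_def)
    then have "dist (of_rat (X n)) (padic_lim X :: 'p padic) \<le> e / 2"
      by (rule LIMSEQ_le_const2) (use N that in \<open>force intro: less_imp_le\<close>)
    then show ?thesis
      using e by simp
  qed
  then show "\<exists>N. \<forall>n\<ge>N. dist (of_rat (X n)) (padic_lim X :: 'p padic) < e"
    by blast
qed

lemma padic_rat_dense:
  assumes "e > 0"
  obtains q where "dist (x :: 'p :: prime_card padic) (of_rat q) < e"
proof -
  have "\<forall>\<^sub>F n in sequentially. dist (of_rat (padic_seq x n)) x < e"
    using padic_of_rat_LIMSEQ[OF padic_seq_Cauchy, of x] assms by (simp add: tendsto_iff)
  then show thesis
    using that by (auto simp: eventually_sequentially dist_commute)
qed

instance padic :: (prime_card) complete_space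
proof
  fix X :: "nat \<Rightarrow> 'a padic"
  assume X: "Cauchy X"
  have "\<exists>q. dist (X n) (of_rat q) < inverse (real (Suc n))" for n
    by (metis padic_rat_dense inverse_positive_iff_positive of_nat_0_less_iff zero_less_Suc)
  then obtain q where q: "\<And>n. dist (X n) (of_rat (q n)) < inverse (real (Suc n))"
    by metis
  have Xq: "(\<lambda>n. dist (X n) (of_rat (q n))) \<longlonglongrightarrow> 0"
    by (rule tendsto_sandwich[OF _ _ tendsto_const LIMSEQ_inverse_real_of_nat])
      (use q in \<open>auto intro!: always_eventually less_imp_le\<close>)
  have "padic_Cauchy CARD('a) q"
    unfolding padic_Cauchy_def
  proof (intro allI impI)
    fix e :: real
    assume "e > 0"
    then have e: "e / 3 > 0"
      by simp
    obtain M where M: "\<And>m n. m \<ge> M \<Longrightarrow> n \<ge> M \<Longrightarrow> dist (X m) (X n) < e / 3"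
      using X e unfolding Cauchy_def by metis
    obtain N where N: "\<And>n. n \<ge> N \<Longrightarrow> dist (X n) (of_rat (q n)) < e / 3"
      using order_tendstoD(2)[OF Xq e] by (auto simp: eventually_sequentially)
    have "padic_abs CARD('a) (q m - q n) < e" if "m \<ge> max M N" "n \<ge> max M N" for m n
    proof -
      have "padic_abs CARD('a) (q m - q n) = dist (of_rat (q m)) (of_rat (q n) :: 'a padic)"
        by (simp add: dist_padic_def padic_norm_of_rat flip: of_rat_diff)
      also have "\<dots> \<le> dist (X m) (of_rat (q m)) + dist (X m) (X n) + dist (X n) (of_rat (q n))"
        by (metis add.commute add_mono dist_commute dist_triangle dist_triangle_le order_refl)
      finally show ?thesis
        using M[of m n] N[of m] N[of n] that by simp
    qed
    then show "\<exists>N. \<forall>m\<ge>N. \<forall>n\<ge>N. padic_abs CARD('a) (q m - q n) < e"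
      by blast
  qed
  then have "(\<lambda>n. of_rat (q n)) \<longlonglongrightarrow> (padic_lim q :: 'a padic)"
    by (rule padic_of_rat_LIMSEQ)
  then have "(\<lambda>n. dist (of_rat (q n)) (padic_lim q :: 'a padic)) \<longlonglongrightarrow> 0"
    by (subst (asm) tendsto_dist_iff)
  with Xq have "(\<lambda>n. dist (X n) (of_rat (q n)) + dist (of_rat (q n)) (padic_lim q :: 'a padic))
      \<longlonglongrightarrow> 0"
    by (rule tendsto_add_zero)
  then have "(\<lambda>n. dist (X n) (padic_lim q :: 'a padic)) \<longlonglongrightarrow> 0"
    by (rule tendsto_sandwich[OF _ _ tendsto_const, rotated 2])
      (intro always_eventually allI dist_triangle zero_le_dist)+
  then show "convergent X"
    unfolding convergent_def by (subst (asm) tendsto_dist_iff[symmetric]) blast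
qed

section \<open>Haar measure, test functions and the Fourier transform\<close>

definition padic_haar :: "'p :: prime_card padic measure \<Rightarrow> bool" where
  "padic_haar \<mu> \<longleftrightarrow> sets \<mu> = sets borel
     \<and> (\<forall>a. \<forall>A\<in>sets borel. emeasure \<mu> ((+) a ` A) = emeasure \<mu> A)
     \<and> emeasure \<mu> {x. padic_norm x \<le> 1} = 1"

definition locally_constant :: "('a :: topological_space \<Rightarrow> 'b) \<Rightarrow> bool" where
  "locally_constant f \<longleftrightarrow> (\<forall>x. \<exists>U. open U \<and> x \<in> U \<and> (\<forall>y\<in>U. f y = f x))"

definition test_functions :: "('a :: topological_space \<Rightarrow> complex) set" where
  "test_functions = {f. locally_constant f \<and> compact (closure {x. f x \<noteq> 0})}"

text \<open>For \<open>x = (\<Sum>i\<ge>-N. a\<^sub>i p\<^sup>i)\<close> with digits \<open>a\<^sub>i\<close>, the fractional part \<open>(\<Sum>i<0. a\<^sub>i p\<^sup>i)\<close> is the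
  only element of \<open>\<int>[1/p] \<inter> [0, 1)\<close> that differs from \<open>x\<close> by a \<open>p\<close>-adic integer.\<close>

definition padic_frac :: "'p :: prime_card padic \<Rightarrow> rat" where
  "padic_frac x = (THE q. 0 \<le> q \<and> q < 1 \<and> (\<exists>n. q * of_nat CARD('p) ^ n \<in> \<int>)
     \<and> padic_norm (x - of_rat q) \<le> 1)"

definition padic_pairing :: "'p :: prime_card padic \<Rightarrow> 'p padic \<Rightarrow> complex" where
  "padic_pairing x \<theta> = exp (2 * of_real pi * \<i> * of_rat (padic_frac (x * \<theta>)))"

definition padic_fourier ::
    "'p :: prime_card padic measure \<Rightarrow> ('p padic \<Rightarrow> complex) \<Rightarrow> 'p padic \<Rightarrow> complex" where
  "padic_fourier \<mu> f \<theta> = (LINT x|\<mu>. padic_pairing x \<theta> * f x)"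

text \<open>The equation for the Fourier transforms determines \<open>\<DD>\<^sup>\<alpha> f\<close> only up to a null set. For
  \<open>f \<in> \<V>\<^sub>c\<close> the class has exactly one continuous representative, and it is integrable; it need
  not have compact support.\<close>

definition padic_frac_deriv ::
    "'p :: prime_card padic measure \<Rightarrow> real \<Rightarrow> ('p padic \<Rightarrow> complex) \<Rightarrow> 'p padic \<Rightarrow> complex" where
  "padic_frac_deriv \<mu> \<alpha> f = (THE g. continuous_on UNIV g \<and> integrable \<mu> g
     \<and> (\<forall>\<xi>. padic_fourier \<mu> g \<xi> = of_real (padic_norm \<xi> powr \<alpha>) * padic_fourier \<mu> f \<xi>))"

section \<open>Functional calculus on \<open>L\<^sup>2\<close>\<close>

text \<open>Elements of \<open>L\<^sup>2\<close> are represented by functions, so operators are determined, and identities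
  between them hold, up to almost everywhere equality.\<close>

definition L2 :: "'a measure \<Rightarrow> ('a \<Rightarrow> complex) set" where
  "L2 M = {f \<in> borel_measurable M. integrable M (\<lambda>x. (cmod (f x))\<^sup>2)}"

definition inner_L2 :: "'a measure \<Rightarrow> ('a \<Rightarrow> complex) \<Rightarrow> ('a \<Rightarrow> complex) \<Rightarrow> complex" where
  "inner_L2 M f g = (LINT x|M. f x * cnj (g x))"

definition L2_orthogonal_projection ::
    "'a measure \<Rightarrow> (('a \<Rightarrow> complex) \<Rightarrow> 'a \<Rightarrow> complex) \<Rightarrow> bool" where
  "L2_orthogonal_projection M T \<longleftrightarrow>
     (\<forall>f\<in>L2 M. T f \<in> L2 M) \<and>
     (\<forall>f\<in>L2 M. \<forall>g\<in>L2 M. \<forall>c. AE x in M. T (\<lambda>x. f x + c * g x) x = T f x + c * T g x) \<and>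
     (\<forall>f\<in>L2 M. AE x in M. T (T f) x = T f x) \<and>
     (\<forall>f\<in>L2 M. \<forall>g\<in>L2 M. inner_L2 M (T f) g = inner_L2 M f (T g))"

definition projection_valued_measure ::
    "'a measure \<Rightarrow> (real set \<Rightarrow> ('a \<Rightarrow> complex) \<Rightarrow> 'a \<Rightarrow> complex) \<Rightarrow> bool" where
  "projection_valued_measure M E \<longleftrightarrow>
     (\<forall>A\<in>sets borel. L2_orthogonal_projection M (E A)) \<and>
     (\<forall>f\<in>L2 M. AE x in M. E UNIV f x = f x) \<and>
     (\<forall>A\<in>sets borel. \<forall>B\<in>sets borel. \<forall>f\<in>L2 M. AE x in M. E A (E B f) x = E (A \<inter> B) f x) \<and>
     (\<forall>A. range A \<subseteq> sets borel \<longrightarrow> disjoint_family A \<longrightarrow>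
        (\<forall>f\<in>L2 M. \<forall>g\<in>L2 M.
          (\<lambda>n. inner_L2 M (E (A n) f) g) sums inner_L2 M (E (\<Union>n. A n) f) g))"

definition spectral_measure_of ::
    "'a measure \<Rightarrow> (real set \<Rightarrow> ('a \<Rightarrow> complex) \<Rightarrow> 'a \<Rightarrow> complex) \<Rightarrow> ('a \<Rightarrow> complex) \<Rightarrow> real measure"
  where "spectral_measure_of M E f =
    measure_of UNIV (sets borel) (\<lambda>A. ennreal (Re (inner_L2 M (E A f) f)))"

text \<open>The integral of \<open>\<phi>\<close> against the complex measure \<open>A \<mapsto> \<langle>E A f, g\<rangle>\<close>, obtained by polarization
  from the positive measures \<open>A \<mapsto> \<langle>E A h, h\<rangle>\<close>.\<close>

definition spectral_integral ::
    "'a measure \<Rightarrow> (real set \<Rightarrow> ('a \<Rightarrow> complex) \<Rightarrow> 'a \<Rightarrow> complex) \<Rightarrow> (real \<Rightarrow> real)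
      \<Rightarrow> ('a \<Rightarrow> complex) \<Rightarrow> ('a \<Rightarrow> complex) \<Rightarrow> complex" where
  "spectral_integral M E \<phi> f g =
     (\<Sum>k<4. \<i> ^ k * of_real (LINT l|spectral_measure_of M E (\<lambda>x. f x + \<i> ^ k * g x). \<phi> l)) / 4"

definition spectral_domain ::
    "'a measure \<Rightarrow> (real set \<Rightarrow> ('a \<Rightarrow> complex) \<Rightarrow> 'a \<Rightarrow> complex) \<Rightarrow> (real \<Rightarrow> real)
      \<Rightarrow> ('a \<Rightarrow> complex) set" where
  "spectral_domain M E \<phi> =
     {f \<in> L2 M. integrable (spectral_measure_of M E f) (\<lambda>l. (\<phi> l)\<^sup>2)}"

text \<open>Graph of the (possibly unbounded) self-adjoint operator \<open>\<integral> \<phi> dE\<close>; its domain is dense, so the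
  weak equation determines \<open>h\<close>.\<close>

definition spectral_operator ::
    "'a measure \<Rightarrow> (real set \<Rightarrow> ('a \<Rightarrow> complex) \<Rightarrow> 'a \<Rightarrow> complex) \<Rightarrow> (real \<Rightarrow> real)
      \<Rightarrow> (('a \<Rightarrow> complex) \<times> ('a \<Rightarrow> complex)) set" where
  "spectral_operator M E \<phi> = {(f, h). f \<in> spectral_domain M E \<phi> \<and> h \<in> L2 M \<and>
     (\<forall>g\<in>spectral_domain M E \<phi>. inner_L2 M h g = spectral_integral M E \<phi> f g)}"

definition spectral_resolution ::
    "'a measure \<Rightarrow> (('a \<Rightarrow> complex) \<Rightarrow> 'a \<Rightarrow> complex)
      \<Rightarrow> (real set \<Rightarrow> ('a \<Rightarrow> complex) \<Rightarrow> 'a \<Rightarrow> complex) \<Rightarrow> bool" where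
  "spectral_resolution M P E \<longleftrightarrow> projection_valued_measure M E \<and>
     (\<forall>f\<in>L2 M. (f, P f) \<in> spectral_operator M E (\<lambda>l. l))"

text \<open>Graph of \<open>log (1/P)\<close> for a bounded self-adjoint operator \<open>P \<ge> 0\<close>, whose spectral resolution
  exists and is unique by the spectral theorem. The value of \<open>log (1/\<lambda>)\<close> at \<open>\<lambda> = 0\<close> is
  \<open>\<infinity>\<close>, whereas \<open>ln (1/0) = 0\<close> in HOL, so membership in the domain needs an explicit condition at
  \<open>0\<close>.\<close>

definition log_inverse_operator ::
    "'a measure \<Rightarrow> (('a \<Rightarrow> complex) \<Rightarrow> 'a \<Rightarrow> complex)
      \<Rightarrow> (('a \<Rightarrow> complex) \<times> ('a \<Rightarrow> complex)) set" where
  "log_inverse_operator M P = {(f, h). \<exists>E. spectral_resolution M P E \<and>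
     (AE x in M. E {0} f x = 0) \<and> (f, h) \<in> spectral_operator M E (\<lambda>l. ln (1 / l))}"

section \<open>Isotropic Laplacians\<close>

definition ball_average ::
    "'a :: metric_space measure \<Rightarrow> real \<Rightarrow> ('a \<Rightarrow> complex) \<Rightarrow> 'a \<Rightarrow> complex" where
  "ball_average M r f x = (LINT y:cball x r|M. f y) / of_real (measure M (cball x r))"

text \<open>Here \<open>\<sigma>\<close> is a distribution function on \<open>[0, \<infinity>)\<close>, extended by \<open>0\<close> to the negative reals.\<close>

definition isotropic_markov ::
    "'a :: metric_space measure \<Rightarrow> (real \<Rightarrow> real) \<Rightarrow> ('a \<Rightarrow> complex) \<Rightarrow> 'a \<Rightarrow> complex" where
  "isotropic_markov M \<sigma> f x = (LINT r:{0..}|interval_measure \<sigma>. ball_average M r f x)"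

definition isotropic_laplacian ::
    "'a :: metric_space measure \<Rightarrow> (real \<Rightarrow> real) \<Rightarrow> (('a \<Rightarrow> complex) \<times> ('a \<Rightarrow> complex)) set" where
  "isotropic_laplacian M \<sigma> = log_inverse_operator M (isotropic_markov M \<sigma>)"

definition sigma_alpha :: "nat \<Rightarrow> real \<Rightarrow> real \<Rightarrow> real" where
  "sigma_alpha p \<alpha> r = (if r > 0 then exp (- ((real p / r) powr \<alpha>)) else 0)"

end

(* The averages Q k f of f over the balls of radius p^k form a decreasing family of orthogonal
   projections of L^2, so the differences D k = Q k - Q (k + 1) are pairwise orthogonal projections.
   They exhaust L^2: if all D k w vanish, the averages of w over concentric balls do not depend on
   the radius and tend to 0 by Cauchy-Schwarz, so w has zero integral over every ball. The Markov
   operator multiplies the range of D k by sigma(p^(k+1)) = exp(-p^(-k alpha)), hence the isotropic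
   Laplacian multiplies it by p^(-k alpha). On the other side, Q k multiplies the Fourier transform
   by the indicator of the ball of radius p^(-k), so D k restricts it to the sphere of that radius,
   and multiplication by |xi|^alpha is the same operator. For a test function f only k bounded below
   contribute, so the series of the p^(-k alpha) D k f converges geometrically. *)

theory Submission
  imports Defs
begin

section \<open>Square-integrable functions\<close>

text \<open>The graph of log(1/P) asks for a spectral resolution, that is for a whole
  projection-valued measure and not only for eigenvectors. A countable total family of orthogonal
  projections supplies one explicitly: E(A) collects the projections whose eigenvalue lies in A.
  This is why completeness of L^2 and totality of the D k carry so much weight. The eigenvalues
  exp(-p^(-k alpha)) accumulate at 0 as k tends to minus infinity without reaching it, so the
  operator is unbounded while the condition on E {0} still holds. The second obstacle is that the
  fractional derivative of f is singled out by its Fourier transform among continuous integrable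
  functions, and its support need not be compact. The series for it is therefore controlled in L^1,
  for the Fourier integrals, and in the supremum norm; the two together give L^2, which the graph
  requires. The averages contract all three norms.\<close>

lemma L2_I:
  assumes "f \<in> borel_measurable M" "integrable M g" "\<And>x. x \<in> space M \<Longrightarrow> (cmod (f x))\<^sup>2 \<le> g x"
  shows "f \<in> L2 M"
  unfolding L2_def
  using assms by (auto intro!: Bochner_Integration.integrable_bound[OF assms(2)] AE_I2)
    (meson abs_ge_self order_trans)

lemma L2_measurable: "f \<in> L2 M \<Longrightarrow> f \<in> borel_measurable M"
  by (simp add: L2_def)

lemma L2_integrable: "f \<in> L2 M \<Longrightarrow> integrable M (\<lambda>x. (cmod (f x))\<^sup>2)"
  by (simp add: L2_def)

text \<open>A crude AM-GM bound. With \<open>b = 1\<close> it dominates a first power by a square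
  plus 1, which turns square summability or square integrability into bounds for first
  powers.\<close>

lemma mult_le_sum_squares: "a * b \<le> a\<^sup>2 + b\<^sup>2" for a b :: real
  using sum_squares_bound[of a b] sum_power2_ge_zero[of a b] unfolding mult.assoc by linarith

lemma power2_add_le: "(a + b)\<^sup>2 \<le> 2 * a\<^sup>2 + 2 * b\<^sup>2" for a b :: real
  using sum_squares_bound[of a b] by (simp add: power2_sum)

lemma cmod_add_power2_le: "(cmod (a + b))\<^sup>2 \<le> 2 * (cmod a)\<^sup>2 + 2 * (cmod b)\<^sup>2"
  by (meson norm_ge_zero norm_triangle_ineq order_trans power2_add_le power_mono)

lemma L2_integrable_mult:
  assumes "f \<in> L2 M" "g \<in> L2 M"
  shows "integrable M (\<lambda>x. f x * g x)"
proof (rule Bochner_Integration.integrable_bound)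
  show "integrable M (\<lambda>x. (cmod (f x))\<^sup>2 + (cmod (g x))\<^sup>2)"
    using assms by (intro Bochner_Integration.integrable_add L2_integrable)
  show "(\<lambda>x. f x * g x) \<in> borel_measurable M"
    using assms[THEN L2_measurable] by measurable
  show "AE x in M. norm (f x * g x) \<le> norm ((cmod (f x))\<^sup>2 + (cmod (g x))\<^sup>2)"
    using mult_le_sum_squares by (intro AE_I2) (simp add: norm_mult)
qed

lemma L2_cnj: "f \<in> L2 M \<Longrightarrow> (\<lambda>x. cnj (f x)) \<in> L2 M"
  using measurable_compose[of f M borel cnj borel, OF _ borel_measurable_continuous_onI[OF continuous_on_cnj[OF continuous_on_id]]]
  by (simp add: L2_def)

lemma L2_integrable_inner:
  "f \<in> L2 M \<Longrightarrow> g \<in> L2 M \<Longrightarrow> integrable M (\<lambda>x. f x * cnj (g x))"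
  by (intro L2_integrable_mult L2_cnj)

lemma L2_zero: "(\<lambda>x. 0) \<in> L2 M"
  by (simp add: L2_def)

lemma L2_add:
  assumes "f \<in> L2 M" "g \<in> L2 M"
  shows "(\<lambda>x. f x + g x) \<in> L2 M"
proof (rule L2_I)
  show "(\<lambda>x. f x + g x) \<in> borel_measurable M"
    using assms[THEN L2_measurable] by measurable
  show "integrable M (\<lambda>x. 2 * (cmod (f x))\<^sup>2 + 2 * (cmod (g x))\<^sup>2)"
    using assms by (intro Bochner_Integration.integrable_add integrable_mult_right L2_integrable)
qed (rule cmod_add_power2_le)

lemma L2_scale: "f \<in> L2 M \<Longrightarrow> (\<lambda>x. c * f x) \<in> L2 M"
  by (auto simp: L2_def norm_mult power_mult_distrib)

lemma L2_uminus: "f \<in> L2 M \<Longrightarrow> (\<lambda>x. - f x) \<in> L2 M"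
  by (auto simp: L2_def)

lemma L2_diff: "f \<in> L2 M \<Longrightarrow> g \<in> L2 M \<Longrightarrow> (\<lambda>x. f x - g x) \<in> L2 M"
  using L2_add[of f M "\<lambda>x. - g x"] by (simp add: L2_uminus)

lemma L2_sum: "(\<And>i. i \<in> I \<Longrightarrow> f i \<in> L2 M) \<Longrightarrow> (\<lambda>x. \<Sum>i\<in>I. f i x) \<in> L2 M"
  by (induction I rule: infinite_finite_induct) (auto intro: L2_zero L2_add)

lemma inner_L2_add_left:
  assumes "f \<in> L2 M" "g \<in> L2 M" "h \<in> L2 M"
  shows "inner_L2 M (\<lambda>x. f x + g x) h = inner_L2 M f h + inner_L2 M g h"
  using assms unfolding inner_L2_def
  by (subst Bochner_Integration.integral_add[symmetric])
    (auto intro!: L2_integrable_inner simp: algebra_simps)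

lemma inner_L2_scale_left: "inner_L2 M (\<lambda>x. c * f x) h = c * inner_L2 M f h"
  unfolding inner_L2_def by (simp add: mult.assoc)

lemma inner_L2_diff_left:
  assumes "f \<in> L2 M" "g \<in> L2 M" "h \<in> L2 M"
  shows "inner_L2 M (\<lambda>x. f x - g x) h = inner_L2 M f h - inner_L2 M g h"
  using assms unfolding inner_L2_def
  by (subst Bochner_Integration.integral_diff[symmetric])
    (auto intro!: L2_integrable_inner simp: algebra_simps)

lemma inner_L2_commute: "inner_L2 M g f = cnj (inner_L2 M f g)"
  unfolding inner_L2_def Bochner_Integration.integral_cnj[symmetric] by (intro Bochner_Integration.integral_cong) (simp_all add: mult.commute)

lemma inner_L2_add_right:
  assumes "f \<in> L2 M" "g \<in> L2 M" "h \<in> L2 M"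
  shows "inner_L2 M h (\<lambda>x. f x + g x) = inner_L2 M h f + inner_L2 M h g"
  using inner_L2_add_left[OF assms] inner_L2_commute by (metis complex_cnj_add)

lemma inner_L2_diff_right:
  assumes "f \<in> L2 M" "g \<in> L2 M" "h \<in> L2 M"
  shows "inner_L2 M h (\<lambda>x. f x - g x) = inner_L2 M h f - inner_L2 M h g"
  using inner_L2_diff_left[OF assms] inner_L2_commute by (metis complex_cnj_diff)

lemma inner_L2_scale_right: "inner_L2 M h (\<lambda>x. c * f x) = cnj c * inner_L2 M h f"
  using inner_L2_scale_left inner_L2_commute by (metis complex_cnj_mult)

lemma inner_L2_zero_left: "inner_L2 M (\<lambda>x. 0) h = 0"
  by (simp add: inner_L2_def)

lemma inner_L2_sum_left:
  assumes "\<And>i. i \<in> I \<Longrightarrow> f i \<in> L2 M" "h \<in> L2 M"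
  shows "inner_L2 M (\<lambda>x. \<Sum>i\<in>I. f i x) h = (\<Sum>i\<in>I. inner_L2 M (f i) h)"
  using assms
  by (induction I rule: infinite_finite_induct)
    (auto simp: inner_L2_zero_left inner_L2_add_left L2_sum)

lemma inner_L2_cong_AE:
  assumes "f \<in> L2 M" "f' \<in> L2 M" "g \<in> L2 M" "g' \<in> L2 M"
    "AE x in M. f x = f' x" "AE x in M. g x = g' x"
  shows "inner_L2 M f g = inner_L2 M f' g'"
  unfolding inner_L2_def using assms
  by (intro integral_cong_AE) (auto intro!: borel_measurable_integrable L2_integrable_inner)

text \<open>Kept squared because it then adds over orthogonal families. Convergence in L^2 is always
  expressed by this quantity tending to 0.\<close>

definition norm_sq_L2 :: "'a measure \<Rightarrow> ('a \<Rightarrow> complex) \<Rightarrow> real" where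
  "norm_sq_L2 M f = (LINT x|M. (cmod (f x))\<^sup>2)"

lemma inner_L2_self: "inner_L2 M f f = of_real (norm_sq_L2 M f)"
  unfolding inner_L2_def norm_sq_L2_def integral_complex_of_real[symmetric]
  by (intro Bochner_Integration.integral_cong) (simp_all only: complex_norm_square)

lemma norm_sq_L2_nonneg: "norm_sq_L2 M f \<ge> 0"
  by (simp add: norm_sq_L2_def)

lemma norm_sq_L2_zero: "norm_sq_L2 M (\<lambda>x. 0) = 0"
  by (simp add: norm_sq_L2_def)

lemma norm_sq_L2_scale: "norm_sq_L2 M (\<lambda>x. c * f x) = (cmod c)\<^sup>2 * norm_sq_L2 M f"
  by (simp add: norm_sq_L2_def norm_mult power_mult_distrib)

lemma norm_sq_L2_minus_commute: "norm_sq_L2 M (\<lambda>x. f x - g x) = norm_sq_L2 M (\<lambda>x. g x - f x)"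
  by (simp add: norm_sq_L2_def norm_minus_commute)

lemma norm_sq_L2_cong_AE:
  assumes "f \<in> L2 M" "f' \<in> L2 M" "AE x in M. f x = f' x"
  shows "norm_sq_L2 M f = norm_sq_L2 M f'"
  using inner_L2_cong_AE[OF assms(1,2,1,2,3,3)] by (simp add: inner_L2_self)

lemma norm_sq_L2_add:
  assumes "f \<in> L2 M" "g \<in> L2 M"
  shows "norm_sq_L2 M (\<lambda>x. f x + g x) = norm_sq_L2 M f + 2 * Re (inner_L2 M f g) + norm_sq_L2 M g"
proof -
  have "inner_L2 M (\<lambda>x. f x + g x) (\<lambda>x. f x + g x)
      = inner_L2 M f f + inner_L2 M f g + cnj (inner_L2 M f g) + inner_L2 M g g"
    using assms by (simp add: inner_L2_add_left inner_L2_add_right L2_add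
        inner_L2_commute[of M g f])
  from arg_cong[OF this, of Re] show ?thesis
    by (simp add: inner_L2_self)
qed

lemma norm_sq_L2_diff:
  assumes "f \<in> L2 M" "g \<in> L2 M"
  shows "norm_sq_L2 M (\<lambda>x. f x - g x) = norm_sq_L2 M f - 2 * Re (inner_L2 M f g) + norm_sq_L2 M g"
  using norm_sq_L2_add[OF assms(1) L2_scale[OF assms(2), of "-1"]]
  by (simp only: inner_L2_scale_right norm_sq_L2_scale) simp

lemma norm_sq_L2_add_le:
  assumes "f \<in> L2 M" "g \<in> L2 M"
  shows "norm_sq_L2 M (\<lambda>x. f x + g x) \<le> 2 * norm_sq_L2 M f + 2 * norm_sq_L2 M g"
  using norm_sq_L2_nonneg[of M "\<lambda>x. f x - g x"]
  by (simp add: norm_sq_L2_diff[OF assms] norm_sq_L2_add[OF assms])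

lemma norm_sq_L2_eq_0:
  assumes "f \<in> L2 M" "norm_sq_L2 M f = 0"
  shows "AE x in M. f x = 0"
proof -
  have "AE x in M. (cmod (f x))\<^sup>2 = 0"
    using assms by (subst integral_nonneg_eq_0_iff_AE[symmetric])
      (auto simp: norm_sq_L2_def L2_integrable)
  then show ?thesis
    by simp
qed

text \<open>The difference is orthogonal to every function in L^2, in particular to itself.\<close>

lemma L2_eq_AE_I:
  assumes "f \<in> L2 M" "g \<in> L2 M"
    and "\<And>v. v \<in> L2 M \<Longrightarrow> inner_L2 M f v = inner_L2 M g v"
  shows "AE x in M. f x = g x"
proof -
  let ?d = "\<lambda>x. f x - g x"
  have d: "?d \<in> L2 M"
    using assms by (intro L2_diff)
  then have "inner_L2 M ?d ?d = 0"
    using assms by (subst inner_L2_diff_left) auto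
  then have "AE x in M. ?d x = 0"
    using d by (intro norm_sq_L2_eq_0) (auto simp: inner_L2_self)
  then show ?thesis
    by simp
qed

lemma Cauchy_Schwarz_L2:
  assumes "f \<in> L2 M" "g \<in> L2 M"
  shows "(cmod (inner_L2 M f g))\<^sup>2 \<le> norm_sq_L2 M f * norm_sq_L2 M g"
proof (cases "norm_sq_L2 M g = 0")
  case True
  then have "inner_L2 M f g = inner_L2 M f (\<lambda>x. 0)"
    using norm_sq_L2_eq_0[OF assms(2)] assms by (intro inner_L2_cong_AE) (auto simp: L2_zero)
  then show ?thesis
    by (simp add: inner_L2_def norm_sq_L2_nonneg)
next
  case False
  then have g: "norm_sq_L2 M g > 0"
    using norm_sq_L2_nonneg[of M g] by linarith
  \<comment> \<open>The coefficient of the orthogonal projection of \<open>f\<close> onto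
    \<open>g\<close>; the inequality expresses that \<open>f - c g\<close> has nonnegative squared
    norm.\<close>
  define c where "c = inner_L2 M f g / of_real (norm_sq_L2 M g)"
  have "inner_L2 M f (\<lambda>x. c * g x)
      = inner_L2 M f g * cnj (inner_L2 M f g) / of_real (norm_sq_L2 M g)"
    unfolding c_def inner_L2_scale_right by simp
  also have "\<dots> = of_real ((cmod (inner_L2 M f g))\<^sup>2 / norm_sq_L2 M g)"
    by (simp only: complex_norm_square of_real_divide)
  finally have "inner_L2 M f (\<lambda>x. c * g x) = of_real ((cmod (inner_L2 M f g))\<^sup>2 / norm_sq_L2 M g)" .
  moreover have "norm_sq_L2 M (\<lambda>x. c * g x) = (cmod (inner_L2 M f g))\<^sup>2 / norm_sq_L2 M g"
    unfolding norm_sq_L2_scale c_def using g by (simp add: norm_divide power2_eq_square)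
  ultimately have "norm_sq_L2 M f - (cmod (inner_L2 M f g))\<^sup>2 / norm_sq_L2 M g \<ge> 0"
    using norm_sq_L2_nonneg[of M "\<lambda>x. f x - c * g x"]
      norm_sq_L2_diff[OF assms(1) L2_scale[OF assms(2), of c]] by simp
  then show ?thesis
    using g by (simp add: field_simps)
qed

lemma tendsto_inner_L2:
  assumes "\<And>n. s n \<in> L2 M" "g \<in> L2 M" "v \<in> L2 M"
    and "(\<lambda>n. norm_sq_L2 M (\<lambda>x. s n x - g x)) \<longlonglongrightarrow> 0"
  shows "(\<lambda>n. inner_L2 M (s n) v) \<longlonglongrightarrow> inner_L2 M g v"
proof -
  have "(\<lambda>n. (cmod (inner_L2 M (s n) v - inner_L2 M g v))\<^sup>2) \<longlonglongrightarrow> 0"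
  proof (rule tendsto_sandwich[OF _ _ tendsto_const tendsto_mult_left_zero[OF assms(4)]])
    show "\<forall>\<^sub>F n in sequentially. (cmod (inner_L2 M (s n) v - inner_L2 M g v))\<^sup>2
        \<le> norm_sq_L2 M (\<lambda>x. s n x - g x) * norm_sq_L2 M v"
      using Cauchy_Schwarz_L2[OF L2_diff[OF assms(1,2)] assms(3)]
      by (intro always_eventually allI) (simp only: inner_L2_diff_left[OF assms(1-3)])
  qed auto
  then have "(\<lambda>n. cmod (inner_L2 M (s n) v - inner_L2 M g v)) \<longlonglongrightarrow> 0"
    using tendsto_real_sqrt[of "\<lambda>n. (cmod (inner_L2 M (s n) v - inner_L2 M g v))\<^sup>2" 0 sequentially]
    by (simp only: real_sqrt_abs abs_norm_cancel real_sqrt_zero)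
  then show ?thesis
    by (rule LIM_zero_cancel[OF tendsto_norm_zero_cancel])
qed

text \<open>With c = i^k, the terms carrying c or c^2 cancel over the four fourth roots of unity,
  while c times its conjugate is 1 and leaves four copies of the inner product. The form is that of
  the polarization in \<open>spectral_integral\<close>.\<close>

lemma norm_sq_L2_polarization:
  assumes "f \<in> L2 M" "g \<in> L2 M"
  shows "(\<Sum>k<4. \<i> ^ k * of_real (norm_sq_L2 M (\<lambda>x. f x + \<i> ^ k * g x))) / 4 = inner_L2 M f g"
proof -
  have *: "complex_of_real (norm_sq_L2 M (\<lambda>x. f x + c * g x)) = inner_L2 M f f + cnj c * inner_L2 M f g
      + c * cnj (inner_L2 M f g) + c * cnj c * inner_L2 M g g" for c
    unfolding inner_L2_self[symmetric] using assms
    by (simp add: inner_L2_add_left inner_L2_add_right L2_add L2_scale inner_L2_scale_left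
        inner_L2_scale_right inner_L2_commute[of M g f] distrib_left)
  have "{..<4 :: nat} = {0, 1, 2, 3}" "\<i> ^ 3 = - \<i>"
    by (auto simp: power3_eq_cube)
  then show ?thesis
    unfolding * by (simp add: algebra_simps)
qed

lemma nn_integral_L2:
  assumes "f \<in> L2 M"
  shows "(\<integral>\<^sup>+ x. ennreal ((cmod (f x))\<^sup>2) \<partial>M) = ennreal (norm_sq_L2 M f)"
  unfolding norm_sq_L2_def using assms by (intro nn_integral_eq_integral) (auto simp: L2_integrable)

lemma L2_I_nn_integral:
  assumes "f \<in> borel_measurable M" "(\<integral>\<^sup>+ x. ennreal ((cmod (f x))\<^sup>2) \<partial>M) < \<infinity>"
  shows "f \<in> L2 M"
  using assms by (auto simp: L2_def intro!: integrableI_bounded)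

lemma norm_sq_L2_le:
  assumes "f \<in> L2 M" "(\<integral>\<^sup>+ x. ennreal ((cmod (f x))\<^sup>2) \<partial>M) \<le> ennreal c" "c \<ge> 0"
  shows "norm_sq_L2 M f \<le> c"
  using assms nn_integral_L2 by (metis ennreal_le_iff)

text \<open>By \<open>t \<le> 2\<^sup>k t\<^sup>2 + 2\<^sup>-\<^sup>k\<close>, almost everywhere summability of weighted squares of the increments
  replaces Minkowski's inequality for infinite sums.\<close>

lemma L2_fast_Cauchy_AE_convergent:
  assumes s: "\<And>k::nat. s k \<in> L2 M"
    and fast: "\<And>k. norm_sq_L2 M (\<lambda>x. s (Suc k) x - s k x) \<le> (1 / 4) ^ k"
  shows "AE x in M. convergent (\<lambda>k. s k x)"
proof -
  define d where "d k x = s (Suc k) x - s k x" for k x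
  have d: "d k \<in> L2 M" for k
    unfolding d_def by (intro L2_diff s)
  have [measurable]: "d k \<in> borel_measurable M" for k
    using d by (rule L2_measurable)
  \<comment> \<open>Against increments of size 4^-k the weight 2^k still leaves the summable bound
    2^-k.\<close>
  let ?u = "\<lambda>k x. 2 ^ k * (cmod (d k x))\<^sup>2"
  have "(\<integral>\<^sup>+ x. (\<Sum>k. ennreal (?u k x)) \<partial>M) = (\<Sum>k. \<integral>\<^sup>+ x. ennreal (?u k x) \<partial>M)"
    by (intro nn_integral_suminf) auto
  also have "\<dots> = (\<Sum>k. ennreal (2 ^ k * norm_sq_L2 M (d k)))"
  proof (intro suminf_cong)
    fix k
    have "(\<integral>\<^sup>+ x. ennreal (?u k x) \<partial>M) = (\<integral>\<^sup>+ x. ennreal (2 ^ k) * ennreal ((cmod (d k x))\<^sup>2) \<partial>M)"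
      by (intro nn_integral_cong ennreal_mult) auto
    also have "\<dots> = ennreal (2 ^ k) * ennreal (norm_sq_L2 M (d k))"
      by (subst nn_integral_cmult) (auto simp only: nn_integral_L2[OF d], measurable)
    finally show "(\<integral>\<^sup>+ x. ennreal (?u k x) \<partial>M) = ennreal (2 ^ k * norm_sq_L2 M (d k))"
      by (subst ennreal_mult) (auto simp: norm_sq_L2_nonneg)
  qed
  also have "\<dots> \<le> (\<Sum>k. ennreal ((1 / 2) ^ k))"
  proof (intro suminf_le summableI ennreal_leI)
    fix k
    have "2 ^ k * norm_sq_L2 M (d k) \<le> 2 ^ k * (1 / 4) ^ k"
      using fast unfolding d_def by (intro mult_left_mono) auto
    also have "\<dots> = (1 / 2 :: real) ^ k"
      by (simp flip: power_mult_distrib)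
    finally show "2 ^ k * norm_sq_L2 M (d k) \<le> (1 / 2) ^ k" .
  qed
  also have "\<dots> < \<infinity>"
    by (simp add: suminf_ennreal2 summable_geometric)
  finally have "AE x in M. (\<Sum>k. ennreal (?u k x)) \<noteq> \<infinity>"
    by (intro nn_integral_noteq_infinite) auto
  then show ?thesis
  proof eventually_elim
    case (elim x)
    then have "summable (\<lambda>k. ?u k x)"
      by (intro summable_suminf_not_top) auto
    moreover have "summable (\<lambda>k. (1 / 2 :: real) ^ k)"
      by (simp add: summable_geometric)
    ultimately have "summable (\<lambda>k. ?u k x + (1 / 2) ^ k)"
      by (rule summable_add)
    then have "summable (\<lambda>k. d k x)"
    proof (rule summable_comparison_test'[where N = 0])
      fix k
      have "2 ^ k * cmod (d k x) * 1 \<le> (2 ^ k * cmod (d k x))\<^sup>2 + 1\<^sup>2"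
        by (rule mult_le_sum_squares)
      then have "2 ^ k * cmod (d k x) \<le> 2 ^ k * (?u k x + (1 / 2) ^ k)"
        by (simp add: power2_eq_square algebra_simps flip: power_mult_distrib)
      then show "norm (d k x) \<le> ?u k x + (1 / 2) ^ k"
        by simp
    qed
    then have "(\<lambda>n. \<Sum>k<n. d k x) \<longlonglongrightarrow> (\<Sum>k. d k x)"
      by (rule summable_LIMSEQ)
    moreover have "(\<Sum>k<n. d k x) = s n x - s 0 x" for n
      using sum_lessThan_telescope[of "\<lambda>k. s k x" n] by (simp add: d_def)
    ultimately have "(\<lambda>n. s n x - s 0 x + s 0 x) \<longlonglongrightarrow> (\<Sum>k. d k x) + s 0 x"
      by (intro tendsto_add) auto
    then show ?case
      by (auto simp: convergent_def)
  qed
qed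

text \<open>A subsequence with geometrically small increments converges almost everywhere, and
  Fatou's lemma carries the Cauchy estimate over to the pointwise limit.\<close>

lemma L2_complete:
  assumes s: "\<And>n::nat. s n \<in> L2 M"
    and Cauchy: "\<And>e. e > 0 \<Longrightarrow> \<exists>N. \<forall>m\<ge>N. \<forall>n\<ge>N. norm_sq_L2 M (\<lambda>x. s m x - s n x) < e"
  obtains g where "g \<in> L2 M" "(\<lambda>n. norm_sq_L2 M (\<lambda>x. s n x - g x)) \<longlonglongrightarrow> 0"
proof -
  have "\<forall>k. \<exists>N. \<forall>m\<ge>N. \<forall>n\<ge>N. norm_sq_L2 M (\<lambda>x. s m x - s n x) < (1 / 4) ^ k"
    using Cauchy by simp
  then obtain N where N: "\<And>k m n. m \<ge> N k \<Longrightarrow> n \<ge> N k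
      \<Longrightarrow> norm_sq_L2 M (\<lambda>x. s m x - s n x) < (1 / 4) ^ k"
    by metis
  \<comment> \<open>Summing the thresholds makes the chosen indices increasing while keeping
    \<open>r k\<close> above \<open>N k\<close>.\<close>
  define r where "r k = (\<Sum>i\<le>k. N i)" for k
  have r: "r k \<ge> N k" "r (Suc k) \<ge> r k" for k
    by (auto simp: r_def member_le_sum)
  define g where "g x = lim (\<lambda>k. s (r k) x)" for x
  have [measurable]: "s n \<in> borel_measurable M" for n
    using s by (rule L2_measurable)
  have [measurable]: "g \<in> borel_measurable M"
    unfolding g_def by (intro borel_measurable_lim_metric) auto
  have "AE x in M. convergent (\<lambda>k. s (r k) x)"
    using r by (intro L2_fast_Cauchy_AE_convergent s less_imp_le[OF N]) (meson order_trans)+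
  then have lim: "AE x in M. (\<lambda>k. s (r k) x) \<longlonglongrightarrow> g x"
    by eventually_elim (simp add: g_def convergent_LIMSEQ_iff)
  \<comment> \<open>One estimate serves twice: its finiteness puts \<open>s n - g\<close>, hence
    \<open>g\<close>, into L^2, and its size gives the convergence.\<close>
  have Fatou: "(\<integral>\<^sup>+ x. ennreal ((cmod (s n x - g x))\<^sup>2) \<partial>M) \<le> ennreal ((1 / 4) ^ k)"
    if n: "n \<ge> N k" for n k
  proof -
    have "AE x in M. ennreal ((cmod (s n x - g x))\<^sup>2)
        = liminf (\<lambda>j. ennreal ((cmod (s n x - s (r j) x))\<^sup>2))"
      using lim
    proof eventually_elim
      case (elim x)
      then have "(\<lambda>j. ennreal ((cmod (s n x - s (r j) x))\<^sup>2)) \<longlonglongrightarrow> ennreal ((cmod (s n x - g x))\<^sup>2)"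
        by (intro tendsto_intros)
      then show ?case
        by (intro lim_imp_Liminf[symmetric]) auto
    qed
    then have "(\<integral>\<^sup>+ x. ennreal ((cmod (s n x - g x))\<^sup>2) \<partial>M)
        = (\<integral>\<^sup>+ x. liminf (\<lambda>j. ennreal ((cmod (s n x - s (r j) x))\<^sup>2)) \<partial>M)"
      by (rule nn_integral_cong_AE)
    also have "\<dots> \<le> liminf (\<lambda>j. \<integral>\<^sup>+ x. ennreal ((cmod (s n x - s (r j) x))\<^sup>2) \<partial>M)"
      by (intro nn_integral_liminf) auto
    also have "\<dots> = liminf (\<lambda>j. ennreal (norm_sq_L2 M (\<lambda>x. s n x - s (r j) x)))"
      using s by (simp add: nn_integral_L2 L2_diff)
    also have "\<dots> \<le> ennreal ((1 / 4) ^ k)"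
    proof -
      have "r j \<ge> N k" if "j \<ge> k" for j
        using lift_Suc_mono_le[of r k j] r that by (meson order_trans)
      then have "\<forall>\<^sub>F j in sequentially. ennreal (norm_sq_L2 M (\<lambda>x. s n x - s (r j) x)) \<le> ennreal ((1 / 4) ^ k)"
        using n by (intro eventually_sequentiallyI[of k] ennreal_leI less_imp_le[OF N])
      then show ?thesis
        by (rule Liminf_mono[THEN order_trans]) (simp add: Liminf_const)
    qed
    finally show ?thesis .
  qed
  have diff: "(\<lambda>x. s n x - g x) \<in> L2 M" if "n \<ge> N k" for n k
    using Fatou[OF that] by (intro L2_I_nn_integral) (auto intro: order_le_less_trans)
  show thesis
  proof
    show g: "g \<in> L2 M"
      using L2_diff[OF s diff[of 0 "N 0"], of "N 0"] by simp
    have le: "norm_sq_L2 M (\<lambda>x. s n x - g x) \<le> (1 / 4) ^ k" if "n \<ge> N k" for n k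
      using Fatou[OF that] diff[OF that] by (intro norm_sq_L2_le) auto
    show "(\<lambda>n. norm_sq_L2 M (\<lambda>x. s n x - g x)) \<longlonglongrightarrow> 0"
    proof (rule LIMSEQ_I)
      fix e :: real
      assume "e > 0"
      then obtain k where "(1 / 4 :: real) ^ k < e"
        using real_arch_pow_inv[of e "1 / 4"] by auto
      then show "\<exists>n0. \<forall>n\<ge>n0. norm (norm_sq_L2 M (\<lambda>x. s n x - g x) - 0) < e"
        using le by (auto simp: norm_sq_L2_nonneg intro!: exI[of _ "N k"] intro: order_le_less_trans)
    qed
  qed
qed

section \<open>Spectral calculus for a sequence of orthogonal projections\<close>

text \<open>Identities hold almost everywhere because elements of L^2 are represented by functions.
  \<open>D_total\<close> only says that no nonzero element is killed by all projections; that the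
  components of \<open>f\<close> sum to \<open>f\<close> is deduced from it and from
  completeness.\<close>

locale L2_projections =
  fixes M :: "'a measure" and D :: "nat \<Rightarrow> ('a \<Rightarrow> complex) \<Rightarrow> 'a \<Rightarrow> complex"
  assumes D_L2: "f \<in> L2 M \<Longrightarrow> D k f \<in> L2 M"
    and D_linear: "f \<in> L2 M \<Longrightarrow> g \<in> L2 M
      \<Longrightarrow> AE x in M. D k (\<lambda>x. f x + c * g x) x = D k f x + c * D k g x"
    and D_sym: "f \<in> L2 M \<Longrightarrow> g \<in> L2 M \<Longrightarrow> inner_L2 M (D k f) g = inner_L2 M f (D k g)"
    and D_idem: "f \<in> L2 M \<Longrightarrow> AE x in M. D k (D k f) x = D k f x"
    and D_orth: "f \<in> L2 M \<Longrightarrow> j \<noteq> k \<Longrightarrow> AE x in M. D j (D k f) x = 0"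
    and D_total: "f \<in> L2 M \<Longrightarrow> (\<And>k. AE x in M. D k f x = 0) \<Longrightarrow> AE x in M. f x = 0"
begin

section \<open>Orthogonal expansions: Bessel, Riesz-Fischer and Parseval\<close>

lemma inner_D_D:
  assumes "f \<in> L2 M" "g \<in> L2 M"
  shows "inner_L2 M (D j f) (D k g) = (if j = k then inner_L2 M (D k f) g else 0)"
proof (cases "j = k")
  case True
  have "inner_L2 M (D k f) (D k g) = inner_L2 M (D k (D k f)) g"
    using assms by (simp add: D_sym D_L2)
  also have "\<dots> = inner_L2 M (D k f) g"
    using assms by (intro inner_L2_cong_AE D_idem D_L2) auto
  finally show ?thesis
    using True by simp
next
  case False
  have "inner_L2 M (D j f) (D k g) = inner_L2 M (D k (D j f)) g"
    using assms by (simp add: D_sym D_L2)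
  also have "\<dots> = inner_L2 M (\<lambda>x. 0) g"
    using assms False by (intro inner_L2_cong_AE D_orth D_L2) (auto simp: L2_zero)
  finally show ?thesis
    using False by (simp add: inner_L2_zero_left)
qed

text \<open>Pythagoras: the cross terms vanish by orthogonality of the ranges.\<close>

lemma norm_sq_sum_D:
  assumes "f \<in> L2 M" "finite I"
  shows "norm_sq_L2 M (\<lambda>x. \<Sum>k\<in>I. c k * D k f x) = (\<Sum>k\<in>I. (cmod (c k))\<^sup>2 * norm_sq_L2 M (D k f))"
  using assms(2)
proof (induction I rule: finite_induct)
  case empty
  then show ?case
    by (simp add: norm_sq_L2_zero)
next
  case (insert j I)
  have "inner_L2 M (\<lambda>x. \<Sum>k\<in>I. c k * D k f x) (\<lambda>x. c j * D j f x)
      = (\<Sum>k\<in>I. inner_L2 M (\<lambda>x. c k * D k f x) (\<lambda>x. c j * D j f x))"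
    using assms(1) by (intro inner_L2_sum_left L2_scale D_L2)
  also have "\<dots> = 0"
    using insert assms(1)
    by (intro sum.neutral) (auto simp: inner_L2_scale_left inner_L2_scale_right inner_D_D)
  finally show ?case
    using insert assms(1)
    by (subst sum.insert, simp, simp, subst add.commute, subst norm_sq_L2_add)
      (auto intro!: L2_sum L2_scale D_L2 simp: norm_sq_L2_scale)
qed

text \<open>The partial sum s satisfies Re <s, f> = |s|^2, so |s - f|^2 = |f|^2 - |s|^2, which is
  nonnegative.\<close>

lemma Bessel:
  assumes "f \<in> L2 M"
  shows "(\<Sum>k<n. norm_sq_L2 M (D k f)) \<le> norm_sq_L2 M f"
proof -
  let ?s = "\<lambda>x. \<Sum>k<n. D k f x"
  have "inner_L2 M ?s f = (\<Sum>k<n. inner_L2 M (D k f) (D k f))"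
    using assms by (subst inner_L2_sum_left) (auto simp: inner_D_D D_L2)
  then have *: "Re (inner_L2 M ?s f) = (\<Sum>k<n. norm_sq_L2 M (D k f))"
    by (simp add: inner_L2_self)
  have s: "?s \<in> L2 M"
    using assms by (intro L2_sum D_L2)
  have "0 \<le> norm_sq_L2 M (\<lambda>x. ?s x - f x)"
    by (rule norm_sq_L2_nonneg)
  also have "\<dots> = norm_sq_L2 M ?s - 2 * Re (inner_L2 M ?s f) + norm_sq_L2 M f"
    using s assms by (rule norm_sq_L2_diff)
  also have "norm_sq_L2 M ?s = (\<Sum>k<n. norm_sq_L2 M (D k f))"
    using norm_sq_sum_D[OF assms, of "{..<n}" "\<lambda>_. 1"] by simp
  finally show ?thesis
    using * by simp
qed

lemma summable_norm_sq_D: "f \<in> L2 M \<Longrightarrow> summable (\<lambda>k. norm_sq_L2 M (D k f))"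
  using Bessel[of f "Suc n" for n] unfolding lessThan_Suc_atMost
  by (intro bounded_imp_summable norm_sq_L2_nonneg)

text \<open>Constructs an element with prescribed components. By Pythagoras the squared distance of
  two partial sums is a block of the given series, so completeness provides the limit. Coefficients
  1 lead to Parseval, indicators to spectral projections.\<close>

lemma Riesz_Fischer:
  assumes f: "f \<in> L2 M" and summable: "summable (\<lambda>k. (cmod (c k))\<^sup>2 * norm_sq_L2 M (D k f))"
  shows "\<exists>g\<in>L2 M. (\<forall>k. AE x in M. D k g x = c k * D k f x)
    \<and> (\<lambda>n. norm_sq_L2 M (\<lambda>x. (\<Sum>k<n. c k * D k f x) - g x)) \<longlonglongrightarrow> 0"
proof -
  let ?a = "\<lambda>k. (cmod (c k))\<^sup>2 * norm_sq_L2 M (D k f)"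
  define s where "s n x = (\<Sum>k<n. c k * D k f x)" for n x
  have s: "s n \<in> L2 M" for n
    unfolding s_def using f by (intro L2_sum L2_scale D_L2)
  have diff: "norm_sq_L2 M (\<lambda>x. s n x - s m x) = sum ?a {m..<n}" if "m \<le> n" for m n
  proof -
    have "s n x - s m x = (\<Sum>k\<in>{m..<n}. c k * D k f x)" for x
      unfolding s_def using that sum_diff_nat_ivl[of 0 m n "\<lambda>k. c k * D k f x"]
      by (simp add: atLeast0LessThan)
    then show ?thesis
      using norm_sq_sum_D[OF f, of "{m..<n}" c] by simp
  qed
  have "\<exists>N. \<forall>m\<ge>N. \<forall>n\<ge>N. norm_sq_L2 M (\<lambda>x. s m x - s n x) < e" if e: "e > 0" for e
  proof -
    obtain N where N: "\<And>m n. m \<ge> N \<Longrightarrow> norm (sum ?a {m..<n}) < e"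
      using summable e unfolding summable_Cauchy by meson
    have "norm_sq_L2 M (\<lambda>x. s m x - s n x) < e" if "m \<ge> N" "n \<ge> N" for m n
    proof (cases "m \<le> n")
      case True
      then show ?thesis
        using N[OF that(1), of n] diff[of m n] by (subst norm_sq_L2_minus_commute) simp
    next
      case False
      then show ?thesis
        using N[OF that(2), of m] diff[of n m] by simp
    qed
    then show ?thesis
      by blast
  qed
  then obtain g where g: "g \<in> L2 M" "(\<lambda>n. norm_sq_L2 M (\<lambda>x. s n x - g x)) \<longlonglongrightarrow> 0"
    using L2_complete[of s M, OF s] by blast
  have "AE x in M. D k g x = c k * D k f x" for k
  proof (rule L2_eq_AE_I)
    fix v
    assume v: "v \<in> L2 M"
    have "(\<lambda>n. inner_L2 M (s n) (D k v)) \<longlonglongrightarrow> inner_L2 M g (D k v)"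
      using s g v D_L2 by (intro tendsto_inner_L2)
    \<comment> \<open>Paired with something in the range of \<open>D k\<close>, the partial sums are
      constant as soon as they contain the index \<open>k\<close>.\<close>
    moreover have "inner_L2 M (s n) (D k v) = c k * inner_L2 M (D k f) v" if "n > k" for n
    proof -
      have "inner_L2 M (s n) (D k v) = (\<Sum>j<n. c j * inner_L2 M (D j f) (D k v))"
        unfolding s_def using f v
        by (subst inner_L2_sum_left) (auto intro!: L2_scale D_L2 simp: inner_L2_scale_left)
      also have "\<dots> = (\<Sum>j<n. if j = k then c k * inner_L2 M (D k f) v else 0)"
        using f v by (intro sum.cong) (auto simp: inner_D_D)
      finally show ?thesis
        using that by simp
    qed
    then have "(\<lambda>n. inner_L2 M (s n) (D k v)) \<longlonglongrightarrow> c k * inner_L2 M (D k f) v"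
      by (intro tendsto_eventually eventually_sequentiallyI[of "Suc k"]) auto
    ultimately have "inner_L2 M g (D k v) = c k * inner_L2 M (D k f) v"
      by (rule LIMSEQ_unique)
    then show "inner_L2 M (D k g) v = inner_L2 M (\<lambda>x. c k * D k f x) v"
      using g v by (simp add: D_sym inner_L2_scale_left)
  qed (use f g in \<open>auto intro!: D_L2 L2_scale\<close>)
  with g show ?thesis
    unfolding s_def by (intro bexI[of _ g] conjI allI)
qed

text \<open>Totality applied to the difference. Identities between spectral projections are all
  checked this way, component by component.\<close>

lemma L2_eq_AE_D:
  assumes "f \<in> L2 M" "g \<in> L2 M" "\<And>k. AE x in M. D k f x = D k g x"
  shows "AE x in M. f x = g x"
proof -
  have "AE x in M. f x + -1 * g x = 0"
  proof (rule D_total)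
    fix k
    show "AE x in M. D k (\<lambda>x. f x + -1 * g x) x = 0"
      using D_linear[OF assms(1,2), of k "-1"] assms(3)[of k] by eventually_elim simp
  qed (use assms in \<open>auto intro: L2_diff\<close>)
  then show ?thesis
    by eventually_elim simp
qed

text \<open>The Riesz-Fischer sum with all coefficients 1 has the same components as
  \<open>f\<close> and hence equals \<open>f\<close>, so the partial sums converge to
  \<open>f\<close> in L^2 and may be paired with \<open>g\<close>.\<close>

lemma Parseval:
  assumes f: "f \<in> L2 M" and g: "g \<in> L2 M"
  shows "(\<lambda>k. inner_L2 M (D k f) (D k g)) sums inner_L2 M f g"
proof -
  have "summable (\<lambda>k. (cmod 1)\<^sup>2 * norm_sq_L2 M (D k f))"
    using summable_norm_sq_D[OF f] by simp
  from Riesz_Fischer[OF f, of "\<lambda>_. 1", OF this] obtain u where u: "u \<in> L2 M"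
      and Du: "\<forall>k. AE x in M. D k u x = 1 * D k f x"
      and lim: "(\<lambda>n. norm_sq_L2 M (\<lambda>x. (\<Sum>k<n. 1 * D k f x) - u x)) \<longlonglongrightarrow> 0"
    by (elim bexE conjE)
  have "AE x in M. u x = f x"
    using Du by (intro L2_eq_AE_D[OF u f]) simp
  then have eq: "inner_L2 M u g = inner_L2 M f g"
    by (intro inner_L2_cong_AE[OF u f g g]) simp_all
  have lim': "(\<lambda>n. inner_L2 M (\<lambda>x. \<Sum>k<n. 1 * D k f x) g) \<longlonglongrightarrow> inner_L2 M u g"
    by (rule tendsto_inner_L2[OF _ u g lim]) (intro L2_sum L2_scale D_L2 f)
  have sum: "inner_L2 M (\<lambda>x. \<Sum>k<n. 1 * D k f x) g = (\<Sum>k<n. inner_L2 M (D k f) (D k g))" for n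
    using f g by (subst inner_L2_sum_left) (simp_all add: inner_D_D D_L2)
  from lim' show ?thesis
    unfolding sums_def sum eq .
qed

text \<open>Absolute convergence of the Parseval series permits the interchange of sums in the proof
  of countable additivity.\<close>

lemma summable_inner_D:
  assumes "f \<in> L2 M" "g \<in> L2 M"
  shows "summable (\<lambda>k. cmod (inner_L2 M (D k f) (D k g)))"
proof (rule summable_comparison_test'[where N = 0])
  show "summable (\<lambda>k. norm_sq_L2 M (D k f) + norm_sq_L2 M (D k g))"
    using assms by (intro summable_add summable_norm_sq_D)
  fix k
  let ?a = "norm_sq_L2 M (D k f)" and ?b = "norm_sq_L2 M (D k g)"
  have "(cmod (inner_L2 M (D k f) (D k g)))\<^sup>2 \<le> ?a * ?b"
    using assms by (intro Cauchy_Schwarz_L2 D_L2)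
  also have "\<dots> \<le> (?a + ?b)\<^sup>2"
    using mult_le_sum_squares[of ?a ?b] by (simp add: power2_sum norm_sq_L2_nonneg)
  finally show "norm (cmod (inner_L2 M (D k f) (D k g))) \<le> ?a + ?b"
    using power2_le_imp_le[OF _ add_nonneg_nonneg[OF norm_sq_L2_nonneg norm_sq_L2_nonneg]] by simp
qed

section \<open>Spectral projections and the projection-valued measure\<close>

definition spectral_projection :: "nat set \<Rightarrow> ('a \<Rightarrow> complex) \<Rightarrow> 'a \<Rightarrow> complex" where
  "spectral_projection S f = (SOME g. g \<in> L2 M \<and> (\<forall>k. AE x in M. D k g x = indicator S k * D k f x))"

text \<open>Deleting components keeps the series of squared norms summable, so Riesz-Fischer applies
  with the indicator of \<open>S\<close> as coefficients. The result is fixed only up to a null set,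
  which is why it is a choice.\<close>

lemma spectral_projection:
  assumes f: "f \<in> L2 M"
  shows spectral_projection_L2: "spectral_projection S f \<in> L2 M"
    and D_spectral_projection: "AE x in M. D k (spectral_projection S f) x = indicator S k * D k f x"
proof -
  have "summable (\<lambda>k. (cmod (indicator S k))\<^sup>2 * norm_sq_L2 M (D k f))"
    by (rule summable_comparison_test'[OF summable_norm_sq_D[OF f], where N = 0])
      (simp add: indicator_def norm_sq_L2_nonneg)
  then have "\<exists>g. g \<in> L2 M \<and> (\<forall>k. AE x in M. D k g x = indicator S k * D k f x)"
    by (elim bexE[OF Riesz_Fischer[OF f, of "indicator S"]] conjE, intro exI conjI)
  then have "spectral_projection S f \<in> L2 M \<and>
      (\<forall>k. AE x in M. D k (spectral_projection S f) x = indicator S k * D k f x)"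
    unfolding spectral_projection_def by (rule someI_ex)
  then show "spectral_projection S f \<in> L2 M"
    "AE x in M. D k (spectral_projection S f) x = indicator S k * D k f x"
    by blast+
qed

lemma inner_D_spectral_projection:
  assumes "f \<in> L2 M" "g \<in> L2 M"
  shows "inner_L2 M (D k (spectral_projection S f)) (D k g)
    = indicator S k * inner_L2 M (D k f) (D k g)"
proof -
  have "inner_L2 M (D k (spectral_projection S f)) (D k g)
      = inner_L2 M (\<lambda>x. indicator S k * D k f x) (D k g)"
    using assms by (intro inner_L2_cong_AE D_spectral_projection D_L2 L2_scale spectral_projection_L2; simp)
  then show ?thesis
    by (simp add: inner_L2_scale_left)
qed

lemma inner_spectral_projection_sums:
  assumes "f \<in> L2 M" "g \<in> L2 M"
  shows "(\<lambda>k. indicator S k * inner_L2 M (D k f) (D k g)) sums inner_L2 M (spectral_projection S f) g"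
  using Parseval[OF spectral_projection_L2[OF assms(1), of S] assms(2)]
  unfolding inner_D_spectral_projection[OF assms] .

text \<open>Idempotence and linearity are visible on components. For symmetry, both inner products
  are sums of the same Parseval series restricted to \<open>S\<close>.\<close>

lemma spectral_projection_orthogonal: "L2_orthogonal_projection M (spectral_projection S)"
  unfolding L2_orthogonal_projection_def
proof (intro conjI ballI allI)
  fix f
  assume f: "f \<in> L2 M"
  note E = spectral_projection_L2 D_spectral_projection
  show "spectral_projection S f \<in> L2 M"
    using f by (rule E)
  show "AE x in M. spectral_projection S (spectral_projection S f) x = spectral_projection S f x"
  proof (rule L2_eq_AE_D)
    fix k
    show "AE x in M. D k (spectral_projection S (spectral_projection S f)) x = D k (spectral_projection S f) x"
      using E(2)[OF f, of k S] E(2)[OF E(1)[OF f, of S], of k S]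
      by eventually_elim (simp add: indicator_def)
  qed (use f in \<open>simp_all add: E(1)\<close>)
  fix g
  assume g: "g \<in> L2 M"
  have "(\<lambda>k. indicator S k * inner_L2 M (D k f) (D k g)) sums inner_L2 M f (spectral_projection S g)"
  proof -
    have "(\<lambda>k. cnj (indicator S k * inner_L2 M (D k g) (D k f)))
        sums cnj (inner_L2 M (spectral_projection S g) f)"
      using inner_spectral_projection_sums[OF g f] by (simp only: sums_cnj)
    moreover have "cnj (indicator S k * inner_L2 M (D k g) (D k f)) = indicator S k * inner_L2 M (D k f) (D k g)" for k
      unfolding inner_L2_commute[of M "D k f"] by (simp add: indicator_def)
    ultimately show ?thesis
      unfolding inner_L2_commute[of M f] by simp
  qed
  with inner_spectral_projection_sums[OF f g]
  show "inner_L2 M (spectral_projection S f) g = inner_L2 M f (spectral_projection S g)"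
    by (rule sums_unique2)
  fix c
  show "AE x in M. spectral_projection S (\<lambda>x. f x + c * g x) x
      = spectral_projection S f x + c * spectral_projection S g x"
  proof (rule L2_eq_AE_D)
    fix k
    have fg: "(\<lambda>x. f x + c * g x) \<in> L2 M"
      using f g by (intro L2_add L2_scale)
    show "AE x in M. D k (spectral_projection S (\<lambda>x. f x + c * g x)) x
        = D k (\<lambda>x. spectral_projection S f x + c * spectral_projection S g x) x"
      using E(2)[OF fg, of k S] E(2)[OF f, of k S] E(2)[OF g, of k S] D_linear[OF f g, of k c]
        D_linear[OF E(1)[OF f, of S] E(1)[OF g, of S], of k c]
      by eventually_elim (simp add: algebra_simps)
  qed (use f g in \<open>auto intro!: E(1) L2_add L2_scale\<close>)
qed

lemma spectral_projection_UNIV: "f \<in> L2 M \<Longrightarrow> AE x in M. spectral_projection UNIV f x = f x"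
  by (rule L2_eq_AE_D) (use D_spectral_projection[of f _ UNIV] in \<open>simp_all add: spectral_projection_L2\<close>)

lemma spectral_projection_Int:
  assumes f: "f \<in> L2 M"
  shows "AE x in M. spectral_projection S (spectral_projection T f) x = spectral_projection (S \<inter> T) f x"
proof (rule L2_eq_AE_D)
  fix k
  show "AE x in M. D k (spectral_projection S (spectral_projection T f)) x = D k (spectral_projection (S \<inter> T) f) x"
    using D_spectral_projection[OF f, of k T] D_spectral_projection[OF f, of k "S \<inter> T"]
      D_spectral_projection[OF spectral_projection_L2[OF f, of T], of k S]
    by eventually_elim (simp add: indicator_def)
qed (use f in \<open>simp_all add: spectral_projection_L2\<close>)

lemma spectral_projection_empty:
  assumes f: "f \<in> L2 M"
  shows "AE x in M. spectral_projection {} f x = 0"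
proof (rule D_total)
  fix k
  show "AE x in M. D k (spectral_projection {} f) x = 0"
    using D_spectral_projection[OF f, of k "{}"] by simp
qed (use f in \<open>simp add: spectral_projection_L2\<close>)

text \<open>The measure puts the range of \<open>D k\<close> at the point
  \<open>\<Lambda> k\<close>. Only countable additivity needs work: it exchanges a sum over the sets
  \<open>A n\<close> with the Parseval series over \<open>k\<close>.\<close>

lemma projection_valued_measure_vimage:
  fixes \<Lambda> :: "nat \<Rightarrow> real"
  shows "projection_valued_measure M (\<lambda>A. spectral_projection (\<Lambda> -` A))"
  unfolding projection_valued_measure_def
proof (intro conjI ballI allI impI)
  fix f A B
  assume f: "f \<in> L2 M"
  show "AE x in M. spectral_projection (\<Lambda> -` UNIV) f x = f x"
    using f by (simp add: spectral_projection_UNIV)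
  show "AE x in M. spectral_projection (\<Lambda> -` A) (spectral_projection (\<Lambda> -` B) f) x
      = spectral_projection (\<Lambda> -` (A \<inter> B)) f x"
    using f by (simp add: spectral_projection_Int vimage_Int)
next
  fix A :: "nat \<Rightarrow> real set" and f g
  assume disj: "disjoint_family A" and f: "f \<in> L2 M" and g: "g \<in> L2 M"
  define a where "a k = inner_L2 M (D k f) (D k g)" for k
  \<comment> \<open>Reading the Parseval series as an integral for counting measure makes the
    exchange an instance of term-by-term integration.\<close>
  have int: "integrable (count_space UNIV) (\<lambda>k. indicator S k *\<^sub>R a k)" for S
    using summable_inner_D[OF f g]
    by (intro integrable_mult_indicator) (simp_all add: integrable_count_space_nat_iff a_def)
  have eq: "inner_L2 M (spectral_projection S f) g = (LINT k|count_space UNIV. indicator S k *\<^sub>R a k)" for S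
  proof -
    have "(\<lambda>k. indicator S k *\<^sub>R a k) = (\<lambda>k. indicator S k * a k)"
      by (auto simp: indicator_def)
    then have "(\<lambda>k. indicator S k *\<^sub>R a k) sums inner_L2 M (spectral_projection S f) g"
      using inner_spectral_projection_sums[OF f g, of S] by (simp add: a_def)
    with sums_integral_count_space_nat[OF int[of S]] show ?thesis
      by (rule sums_unique2[symmetric])
  qed
  have single: "(\<lambda>n. indicator (\<Lambda> -` A n) k *\<^sub>R a k) sums (indicator (\<Lambda> -` (\<Union>n. A n)) k *\<^sub>R a k)"
      and abs: "summable (\<lambda>n. norm (indicator (\<Lambda> -` A n) k *\<^sub>R a k))" for k
  proof -
    have *: "(\<lambda>n. indicator (A n) (\<Lambda> k) :: real) sums indicator (\<Union>n. A n) (\<Lambda> k)"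
    proof (cases "\<Lambda> k \<in> (\<Union>n. A n)")
      case True
      then obtain m where m: "\<Lambda> k \<in> A m"
        by blast
      then have "indicator (A n) (\<Lambda> k) = (if n = m then 1 else 0 :: real)" for n
        using disjoint_family_onD[OF disj, of n m] by (auto simp: indicator_def)
      then show ?thesis
        using sums_single[of m "\<lambda>_. 1 :: real"] True by simp
    qed (auto simp: indicator_def)
    then show "(\<lambda>n. indicator (\<Lambda> -` A n) k *\<^sub>R a k) sums (indicator (\<Lambda> -` (\<Union>n. A n)) k *\<^sub>R a k)"
      unfolding indicator_vimage[symmetric] o_def by (intro sums_scaleR_left) (simp add: indicator_def)
    have "summable (\<lambda>n. indicator (A n) (\<Lambda> k) * norm (a k))"
      using * by (intro summable_mult2) (rule sums_summable)
    then show "summable (\<lambda>n. norm (indicator (\<Lambda> -` A n) k *\<^sub>R a k))"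
      by (simp add: indicator_def)
  qed
  have "(\<lambda>n. LINT k|count_space UNIV. indicator (\<Lambda> -` A n) k *\<^sub>R a k)
      sums (LINT k|count_space UNIV. (\<Sum>n. indicator (\<Lambda> -` A n) k *\<^sub>R a k))"
  proof (rule sums_integral[OF int])
    show "AE k in count_space UNIV. summable (\<lambda>n. norm (indicator (\<Lambda> -` A n) k *\<^sub>R a k))"
      using abs by simp
    show "summable (\<lambda>n. LINT k|count_space UNIV. norm (indicator (\<Lambda> -` A n) k *\<^sub>R a k))"
    \<comment> \<open>By disjointness each \<open>\<Lambda> k\<close> lies in at most one of the
      sets, so the indicators of finitely many of them add up to at most 1 and every partial sum
      stays below the sum of all \<open>norm (a k)\<close>.\<close>
    proof (rule bounded_imp_summable)
      fix n
      have "(\<Sum>i\<le>n. (LINT k|count_space UNIV. norm (indicator (\<Lambda> -` A i) k *\<^sub>R a k)))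
          = (LINT k|count_space UNIV. (\<Sum>i\<le>n. norm (indicator (\<Lambda> -` A i) k *\<^sub>R a k)))"
        using int by (intro Bochner_Integration.integral_sum[symmetric] integrable_norm)
      also have "\<dots> \<le> (LINT k|count_space UNIV. norm (a k))"
      proof (rule integral_mono)
        show "integrable (count_space UNIV) (\<lambda>k. \<Sum>i\<le>n. norm (indicator (\<Lambda> -` A i) k *\<^sub>R a k))"
          using int by (intro Bochner_Integration.integrable_sum integrable_norm)
        show "integrable (count_space UNIV) (\<lambda>k. norm (a k))"
          using int[of UNIV] by (intro integrable_norm) simp
        fix k
        have "(\<Sum>i\<le>n. indicator (A i) (\<Lambda> k) :: real) = indicator (\<Union>i\<le>n. A i) (\<Lambda> k)"
          using disj by (intro indicator_UN_disjoint[symmetric]) (auto simp: disjoint_family_on_def)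
        then have "(\<Sum>i\<le>n. norm (indicator (\<Lambda> -` A i) k *\<^sub>R a k)) = indicator (\<Union>i\<le>n. A i) (\<Lambda> k) * norm (a k)"
          by (simp add: indicator_def sum_distrib_right[symmetric])
        also have "\<dots> \<le> norm (a k)"
          by (simp add: indicator_def)
        finally show "(\<Sum>i\<le>n. norm (indicator (\<Lambda> -` A i) k *\<^sub>R a k)) \<le> norm (a k)" .
      qed
      finally show "(\<Sum>i\<le>n. (LINT k|count_space UNIV. norm (indicator (\<Lambda> -` A i) k *\<^sub>R a k)))
          \<le> (LINT k|count_space UNIV. norm (a k))" .
    qed simp
  qed
  then show "(\<lambda>n. inner_L2 M (spectral_projection (\<Lambda> -` A n) f) g)
      sums inner_L2 M (spectral_projection (\<Lambda> -` (\<Union>n. A n)) f) g"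
    using single by (simp add: eq sums_iff)
qed (rule spectral_projection_orthogonal)

section \<open>Operators that multiply each component by a function of its eigenvalue\<close>

context
  fixes \<Lambda> :: "nat \<Rightarrow> real"
begin

definition E where "E A = spectral_projection (\<Lambda> -` A)"

text \<open>A discrete measure: mass \<open>norm_sq_L2 M (D k f)\<close> at
  \<open>\<Lambda> k\<close>, written as an image of a weighted counting measure so that masses of
  equal eigenvalues add and integrals become series over \<open>k\<close>.\<close>

lemma spectral_measure_of_E:
  assumes f: "f \<in> L2 M"
  shows "spectral_measure_of M E f
    = distr (density (count_space UNIV) (\<lambda>k. ennreal (norm_sq_L2 M (D k f)))) borel \<Lambda>" (is "_ = ?N")
proof -
  have "ennreal (Re (inner_L2 M (E A f) f)) = emeasure ?N A" if "A \<in> sets borel" for A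
  proof -
    have "(\<lambda>k. indicator (\<Lambda> -` A) k * inner_L2 M (D k f) (D k f)) sums inner_L2 M (E A f) f"
      unfolding E_def using f f by (rule inner_spectral_projection_sums)
    then have "(\<lambda>k. Re (indicator (\<Lambda> -` A) k * inner_L2 M (D k f) (D k f))) sums Re (inner_L2 M (E A f) f)"
      by (rule sums_Re)
    moreover have "Re (indicator (\<Lambda> -` A) k * inner_L2 M (D k f) (D k f))
        = indicator (\<Lambda> -` A) k * norm_sq_L2 M (D k f)" for k
      by (simp add: inner_L2_self indicator_def)
    ultimately have sums: "(\<lambda>k. indicator (\<Lambda> -` A) k * norm_sq_L2 M (D k f)) sums Re (inner_L2 M (E A f) f)"
      by simp
    have "emeasure ?N A = (\<Sum>k. ennreal (norm_sq_L2 M (D k f)) * indicator (\<Lambda> -` A) k)"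
      using that by (simp add: emeasure_distr emeasure_density nn_integral_count_space_nat)
    also have "\<dots> = (\<Sum>k. ennreal (indicator (\<Lambda> -` A) k * norm_sq_L2 M (D k f)))"
      by (intro suminf_cong) (simp add: indicator_def)
    also have "\<dots> = ennreal (Re (inner_L2 M (E A f) f))"
      using sums by (intro suminf_ennreal_eq) (simp_all add: norm_sq_L2_nonneg)
    finally show ?thesis
      by simp
  qed
  then have "spectral_measure_of M E f = measure_of UNIV (sets borel) (emeasure ?N)"
    unfolding spectral_measure_of_def
    by (intro measure_of_eq) (auto simp: sets.sigma_sets_eq[of borel, simplified])
  also have "\<dots> = ?N"
    using measure_of_of_measure[of ?N] by simp
  finally show ?thesis .
qed

lemma integrable_spectral_measure_of_E:
  fixes \<phi> :: "real \<Rightarrow> real"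
  assumes "f \<in> L2 M" "\<phi> \<in> borel_measurable borel"
  shows "integrable (spectral_measure_of M E f) \<phi>
    \<longleftrightarrow> summable (\<lambda>k. \<bar>\<phi> (\<Lambda> k)\<bar> * norm_sq_L2 M (D k f))"
  using assms
  by (simp add: spectral_measure_of_E integrable_distr_eq integrable_density norm_sq_L2_nonneg
      integrable_count_space_nat_iff abs_mult mult.commute)

lemma integral_spectral_measure_of_E_sums:
  fixes \<phi> :: "real \<Rightarrow> real"
  assumes "f \<in> L2 M" "\<phi> \<in> borel_measurable borel"
    "summable (\<lambda>k. \<bar>\<phi> (\<Lambda> k)\<bar> * norm_sq_L2 M (D k f))"
  shows "(\<lambda>k. \<phi> (\<Lambda> k) * norm_sq_L2 M (D k f)) sums (LINT l|spectral_measure_of M E f. \<phi> l)"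
proof -
  have "(LINT l|spectral_measure_of M E f. \<phi> l)
      = (LINT k|count_space UNIV. \<phi> (\<Lambda> k) * norm_sq_L2 M (D k f))"
    using assms
    by (simp add: spectral_measure_of_E integral_distr integral_density norm_sq_L2_nonneg mult.commute)
  moreover have "integrable (count_space UNIV) (\<lambda>k. \<phi> (\<Lambda> k) * norm_sq_L2 M (D k f))"
    using assms by (simp add: integrable_count_space_nat_iff abs_mult norm_sq_L2_nonneg)
  ultimately show ?thesis
    using sums_integral_count_space_nat by metis
qed

text \<open>The four integrals in \<open>spectral_integral\<close> become series over
  \<open>k\<close>; polarization inside each term turns their combination into the Parseval series
  of \<open>h\<close> and \<open>g\<close>.\<close>

lemma spectral_operator_E:
  fixes \<phi> :: "real \<Rightarrow> real"
  assumes \<phi>: "\<phi> \<in> borel_measurable borel" and f: "f \<in> L2 M" and h: "h \<in> L2 M"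
    and D_h: "\<And>k. AE x in M. D k h x = of_real (\<phi> (\<Lambda> k)) * D k f x"
  shows "(f, h) \<in> spectral_operator M E \<phi>"
proof -
  let ?S = "\<lambda>u. summable (\<lambda>k. (\<phi> (\<Lambda> k))\<^sup>2 * norm_sq_L2 M (D k u))"
  have \<phi>2: "(\<lambda>l. (\<phi> l)\<^sup>2) \<in> borel_measurable borel"
    using \<phi> by measurable
  have dom: "u \<in> spectral_domain M E \<phi> \<longleftrightarrow> u \<in> L2 M \<and> ?S u" for u
    using integrable_spectral_measure_of_E[OF _ \<phi>2, of u] by (auto simp: spectral_domain_def)
  have "norm_sq_L2 M (D k h) = (\<phi> (\<Lambda> k))\<^sup>2 * norm_sq_L2 M (D k f)" for k
    using norm_sq_L2_cong_AE[OF D_L2[OF h] L2_scale[OF D_L2[OF f]] D_h[of k]]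
    by (simp add: norm_sq_L2_scale)
  \<comment> \<open>Membership of \<open>f\<close> in the domain comes from \<open>h\<close> being
    in L^2, since its components already carry the factor
    \<open>\<phi> (\<Lambda> k)\<close>.\<close>
  then have f_dom: "?S f"
    using summable_norm_sq_D[OF h] by simp
  have "inner_L2 M h g = spectral_integral M E \<phi> f g" if "g \<in> spectral_domain M E \<phi>" for g
  proof -
    have g: "g \<in> L2 M" and g_dom: "?S g"
      using that by (simp_all add: dom)
    define u where "u j x = f x + \<i> ^ j * g x" for j :: nat and x
    have u: "u j \<in> L2 M" for j
      unfolding u_def using f g by (intro L2_add L2_scale)
    have Du: "norm_sq_L2 M (D k (u j)) = norm_sq_L2 M (\<lambda>x. D k f x + \<i> ^ j * D k g x)" for j k
      unfolding u_def using f g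
      by (intro norm_sq_L2_cong_AE D_linear D_L2 L2_add L2_scale)
    \<comment> \<open>The domain controls the square of \<open>\<phi>\<close>, the integrals involve
      its first power; the bound |t| \<le> t^2 + 1 bridges the two.\<close>
    have "summable (\<lambda>k. \<bar>\<phi> (\<Lambda> k)\<bar> * norm_sq_L2 M (D k (u j)))" for j
    proof (rule summable_comparison_test'[where N = 0])
      show "summable (\<lambda>k. 2 * ((\<phi> (\<Lambda> k))\<^sup>2 * norm_sq_L2 M (D k f) + norm_sq_L2 M (D k f))
          + 2 * ((\<phi> (\<Lambda> k))\<^sup>2 * norm_sq_L2 M (D k g) + norm_sq_L2 M (D k g)))"
        using f g f_dom g_dom by (intro summable_add summable_mult summable_norm_sq_D)
      fix k
      have "\<bar>\<phi> (\<Lambda> k)\<bar> * norm_sq_L2 M (D k (u j))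
          \<le> ((\<phi> (\<Lambda> k))\<^sup>2 + 1) * (2 * norm_sq_L2 M (D k f) + 2 * norm_sq_L2 M (D k g))"
      proof (rule mult_mono)
        show "\<bar>\<phi> (\<Lambda> k)\<bar> \<le> (\<phi> (\<Lambda> k))\<^sup>2 + 1"
          using mult_le_sum_squares[of "\<bar>\<phi> (\<Lambda> k)\<bar>" 1] by simp
        show "norm_sq_L2 M (D k (u j)) \<le> 2 * norm_sq_L2 M (D k f) + 2 * norm_sq_L2 M (D k g)"
          unfolding Du
          using norm_sq_L2_add_le[OF D_L2[OF f, of k] L2_scale[OF D_L2[OF g, of k], of "\<i> ^ j"]]
          by (simp add: norm_sq_L2_scale norm_power)
      qed (simp_all add: norm_sq_L2_nonneg)
      then show "norm (\<bar>\<phi> (\<Lambda> k)\<bar> * norm_sq_L2 M (D k (u j)))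
          \<le> 2 * ((\<phi> (\<Lambda> k))\<^sup>2 * norm_sq_L2 M (D k f) + norm_sq_L2 M (D k f))
            + 2 * ((\<phi> (\<Lambda> k))\<^sup>2 * norm_sq_L2 M (D k g) + norm_sq_L2 M (D k g))"
        by (simp add: norm_sq_L2_nonneg abs_mult algebra_simps)
    qed
    then have sums: "(\<lambda>k. \<phi> (\<Lambda> k) * norm_sq_L2 M (D k (u j))) sums (LINT l|spectral_measure_of M E (u j). \<phi> l)" for j
      using u \<phi> by (intro integral_spectral_measure_of_E_sums)
    have "(\<lambda>k. (\<Sum>j<4. \<i> ^ j * of_real (\<phi> (\<Lambda> k) * norm_sq_L2 M (D k (u j)))) / 4)
        sums ((\<Sum>j<4. \<i> ^ j * of_real (LINT l|spectral_measure_of M E (u j). \<phi> l)) / 4)"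
      using sums by (intro sums_divide sums_sum sums_mult) (simp only: sums_of_real_iff)
    moreover have "(\<Sum>j<4. \<i> ^ j * of_real (\<phi> (\<Lambda> k) * norm_sq_L2 M (D k (u j)))) / 4
        = inner_L2 M (D k h) (D k g)" for k
    proof -
      have "(\<Sum>j<4. \<i> ^ j * of_real (\<phi> (\<Lambda> k) * norm_sq_L2 M (D k (u j)))) / 4
          = of_real (\<phi> (\<Lambda> k)) * ((\<Sum>j<4. \<i> ^ j * of_real (norm_sq_L2 M (D k (u j)))) / 4)"
        by (simp add: sum_distrib_left mult_ac)
      also have "\<dots> = of_real (\<phi> (\<Lambda> k)) * inner_L2 M (D k f) (D k g)"
        unfolding Du using f g by (subst norm_sq_L2_polarization) (auto intro: D_L2)
      also have "\<dots> = inner_L2 M (D k h) (D k g)"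
        unfolding inner_L2_scale_left[symmetric] using D_h[of k] f g h
        by (intro inner_L2_cong_AE L2_scale D_L2) (auto elim: eventually_mono)
      finally show ?thesis .
    qed
    ultimately have "(\<lambda>k. inner_L2 M (D k h) (D k g)) sums spectral_integral M E \<phi> f g"
      by (simp add: spectral_integral_def u_def[abs_def])
    with Parseval[OF h g] show ?thesis
      by (rule sums_unique2)
  qed
  then show ?thesis
    using f h f_dom by (simp add: spectral_operator_def dom)
qed

end

text \<open>One projection-valued measure serves for both operators: the multiplier l makes it a
  spectral resolution of \<open>P\<close>, the multiplier ln(1/l) gives the pair. Since no
  eigenvalue is 0, the projection at 0 belongs to the empty index set and vanishes.\<close>

theorem log_inverse_operatorI:
  fixes \<Lambda> :: "nat \<Rightarrow> real"
  assumes P: "\<And>f. f \<in> L2 M \<Longrightarrow> P f \<in> L2 M"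
    and D_P: "\<And>f k. f \<in> L2 M \<Longrightarrow> AE x in M. D k (P f) x = of_real (\<Lambda> k) * D k f x"
    and nz: "\<And>k. \<Lambda> k \<noteq> 0"
    and f: "f \<in> L2 M" and h: "h \<in> L2 M"
    and D_h: "\<And>k. AE x in M. D k h x = of_real (ln (1 / \<Lambda> k)) * D k f x"
  shows "(f, h) \<in> log_inverse_operator M P"
  unfolding log_inverse_operator_def mem_Collect_eq case_prod_conv
proof (intro exI conjI)
  show "spectral_resolution M P (E \<Lambda>)"
    unfolding spectral_resolution_def
    using projection_valued_measure_vimage[of \<Lambda>] P D_P
    by (auto simp: E_def[abs_def] intro!: spectral_operator_E[unfolded E_def[abs_def]])
  have "\<Lambda> -` {0} = {}"
    using nz by auto
  then show "AE x in M. E \<Lambda> {0} f x = 0"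
    using spectral_projection_empty[OF f] by (simp add: E_def)
  show "(f, h) \<in> spectral_operator M (E \<Lambda>) (\<lambda>l. ln (1 / l))"
    using f h D_h by (intro spectral_operator_E) auto
qed

end

section \<open>The \<open>p\<close>-adic metric\<close>

lemma card_gt_1: "real CARD('p :: prime_card) > 1"
  using prime_gt_1_nat[OF prime_card[where 'a = 'p]] by simp

lemma card_pos: "CARD('p :: prime_card) > 0"
  using prime_gt_0_nat[OF prime_card[where 'a = 'p]] .

lemma card_powi_pos: "real CARD('p :: prime_card) powi k > 0"
  using card_gt_1[where 'p = 'p] by simp

lemma card_powi_less_iff: "real CARD('p :: prime_card) powi j < real CARD('p) powi k \<longleftrightarrow> j < k"
  using card_gt_1[where 'p = 'p] power_int_strict_increasing[of j k "real CARD('p)"]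
    power_int_increasing[of k j "real CARD('p)"] by (cases "j < k") auto

lemma card_powi_le_iff: "real CARD('p :: prime_card) powi j \<le> real CARD('p) powi k \<longleftrightarrow> j \<le> k"
  using card_powi_less_iff[where 'p = 'p, of k j] by linarith

lemma card_powi_add: "real CARD('p :: prime_card) powi (j + k) = real CARD('p) powi j * real CARD('p) powi k"
  using card_gt_1[where 'p = 'p] by (simp add: power_int_add)

lemma card_powi_small:
  assumes "e > 0"
  obtains k where "real CARD('p :: prime_card) powi k < e"
proof -
  obtain n where "inverse (real CARD('p)) ^ n < e"
    using real_arch_pow_inv[OF assms, of "inverse (real CARD('p))"] card_gt_1[where 'p = 'p]
    by (auto simp: inverse_less_1_iff)
  then have "real CARD('p) powi (- int n) < e"
    by (simp add: power_int_minus power_inverse)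
  then show thesis
    by (rule that)
qed

lemma card_powi_large:
  obtains k where "c < real CARD('p :: prime_card) powi int k"
  using real_arch_pow[OF card_gt_1[where 'p = 'p], of c] by auto

lemma card_powi_floor:
  assumes "r > 0"
  shows "real CARD('p :: prime_card) powi \<lfloor>log CARD('p) r\<rfloor> \<le> r"
    and "r < real CARD('p) powi (\<lfloor>log CARD('p) r\<rfloor> + 1)"
proof -
  have "real CARD('p) powi k = real CARD('p) powr k" for k
    using card_gt_1[where 'p = 'p] by (simp add: powr_real_of_int')
  moreover have "real CARD('p) powr \<lfloor>log CARD('p) r\<rfloor> \<le> r"
    using assms card_gt_1[where 'p = 'p] by (subst powr_le_iff) auto
  moreover have "r < real CARD('p) powr (\<lfloor>log CARD('p) r\<rfloor> + 1)"
    using assms card_gt_1[where 'p = 'p] by (subst less_powr_iff) auto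
  ultimately show "real CARD('p) powi \<lfloor>log CARD('p) r\<rfloor> \<le> r"
      "r < real CARD('p) powi (\<lfloor>log CARD('p) r\<rfloor> + 1)"
    by auto
qed

lemma padic_norm_0 [simp]: "padic_norm (0 :: 'p :: prime_card padic) = 0"
  by (simp add: padic_norm_eq_0_iff)

lemma padic_norm_1 [simp]: "padic_norm (1 :: 'p :: prime_card padic) = 1"
  using padic_norm_of_rat[where 'p = 'p, of 1] by (simp add: padic_abs_1[OF prime_card])

lemma padic_norm_inverse: "padic_norm (inverse x) = inverse (padic_norm (x :: 'p :: prime_card padic))"
proof (cases "x = 0")
  case False
  then have "padic_norm x * padic_norm (inverse x) = 1"
    by (simp flip: padic_norm_mult)
  then show ?thesis
    by (metis inverse_unique)
qed simp

lemma padic_norm_card_powi: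
  "padic_norm (of_nat CARD('p) powi k :: 'p :: prime_card padic) = real CARD('p) powi (- k)"
proof -
  have "padic_norm (of_nat CARD('p) :: 'p padic) = padic_abs CARD('p) (of_int (int CARD('p)))"
    using padic_norm_of_rat[where 'p = 'p, of "of_nat CARD('p)"] by simp
  also have "\<dots> = inverse (real CARD('p))"
    using prime_gt_1_nat[OF prime_card[where 'a = 'p]]
    by (subst padic_abs_of_int[OF prime_card]) (auto simp: power_int_minus multiplicity_self)
  finally have *: "padic_norm (of_nat CARD('p) :: 'p padic) = inverse (real CARD('p))" .
  have "padic_norm (of_nat CARD('p) ^ n :: 'p padic) = inverse (real CARD('p)) ^ n" for n
    by (induction n) (simp_all add: padic_norm_mult *)
  then show ?thesis
    by (cases k rule: int_cases2)
      (simp_all add: power_int_minus padic_norm_inverse power_inverse)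
qed

lemma padic_norm_diff: "padic_norm (x - y) \<le> max (padic_norm x) (padic_norm (y :: 'p :: prime_card padic))"
  using padic_norm_add[of x "- y"] by (simp add: padic_norm_minus)

lemma dist_padic_ultrametric:
  "dist x z \<le> max (dist x y) (dist y (z :: 'p :: prime_card padic))"
  using padic_norm_add[of "x - y" "y - z"] by (simp add: dist_padic_def)

lemma dist_padic_0 [simp]: "dist x (0 :: 'p :: prime_card padic) = padic_norm x"
    "dist 0 x = padic_norm x"
  by (simp_all add: dist_padic_def padic_norm_minus)

lemma dist_padic_translate [simp]: "dist (a + x) (a + y) = dist x (y :: 'p :: prime_card padic)"
  by (simp add: dist_padic_def)

text \<open>The isosceles property of an ultrametric, for the triangle 0, x, y.\<close>

lemma padic_norm_eq_of_dist_less: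
  assumes "dist x y < padic_norm (x :: 'p :: prime_card padic)"
  shows "padic_norm y = padic_norm x"
  using dist_padic_ultrametric[of 0 y x] dist_padic_ultrametric[of 0 x y] assms
  by (auto simp: dist_commute)

text \<open>A rational close enough to \<open>x\<close> has the same norm by the isosceles property,
  and norms of nonzero rationals are powers of p by definition.\<close>

lemma padic_norm_powi:
  assumes "x \<noteq> (0 :: 'p :: prime_card padic)"
  obtains k where "padic_norm x = real CARD('p) powi k"
proof -
  have pos: "padic_norm x > 0"
    using assms padic_norm_nonneg[of x] padic_norm_eq_0_iff[of x] by linarith
  then obtain q where "dist x (of_rat q) < padic_norm x"
    by (rule padic_rat_dense)
  then have q: "padic_abs CARD('p) q = padic_norm x"
    using padic_norm_eq_of_dist_less padic_norm_of_rat by metis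
  then have "q \<noteq> 0"
    using pos by auto
  then have "\<exists>k. padic_abs CARD('p) q = real CARD('p) powi k"
    by (auto simp: padic_abs_def Let_def case_prod_unfold)
  then show thesis
    using that q by auto
qed

lemma padic_norm_less_powi_iff:
  "padic_norm (x :: 'p :: prime_card padic) < real CARD('p) powi (k + 1) \<longleftrightarrow> padic_norm x \<le> real CARD('p) powi k"
proof (cases "x = 0")
  case False
  then obtain j where "padic_norm x = real CARD('p) powi j"
    by (rule padic_norm_powi)
  then show ?thesis
    by (auto simp: card_powi_less_iff card_powi_le_iff)
qed (simp add: card_powi_pos less_imp_le)

text \<open>The norm takes no values strictly between consecutive powers of p. Balls thus depend on
  the radius only through an integer, to which the measure of radii can be pushed forward.\<close>

lemma cball_padic_floor:
  assumes "r > 0"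
  shows "cball x r = cball (x :: 'p :: prime_card padic) (real CARD('p) powi \<lfloor>log CARD('p) r\<rfloor>)"
proof -
  have "dist x y \<le> r \<longleftrightarrow> dist x y \<le> real CARD('p) powi \<lfloor>log CARD('p) r\<rfloor>" for y
    using card_powi_floor[where 'p = 'p, OF assms] padic_norm_less_powi_iff[of "x - y" "\<lfloor>log CARD('p) r\<rfloor>"]
    unfolding dist_padic_def by linarith
  then show ?thesis
    by auto
qed

lemma cball_padic_eq:
  assumes "y \<in> cball x r"
  shows "cball y r = cball (x :: 'p :: prime_card padic) r"
proof -
  have "dist x y \<le> r"
    using assms by simp
  then have "dist x z \<le> r \<longleftrightarrow> dist y z \<le> r" for z
    using dist_padic_ultrametric[of x z y] dist_padic_ultrametric[of y z x] by (auto simp: dist_commute)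
  then show ?thesis
    by auto
qed

text \<open>Two balls are nested or disjoint, because any common point is a centre of both.\<close>

lemma cball_padic_Int:
  assumes "r \<le> s" "cball x r \<inter> cball (y :: 'p :: prime_card padic) s \<noteq> {}"
  shows "cball x r \<subseteq> cball y s"
proof -
  obtain z where z: "z \<in> cball x r" "z \<in> cball y s"
    using assms by blast
  have "cball x r = cball z r"
    using z by (simp add: cball_padic_eq)
  also have "\<dots> \<subseteq> cball z s"
    using assms by auto
  finally show ?thesis
    using cball_padic_eq[OF z(2)] by simp
qed

lemma open_cball_padic:
  assumes "r > 0"
  shows "open (cball (x :: 'p :: prime_card padic) r)"
  unfolding open_contains_ball
proof (intro ballI exI conjI)
  fix y
  assume "y \<in> cball x r"
  then have "cball y r = cball x r"
    by (rule cball_padic_eq)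
  then show "ball y r \<subseteq> cball x r"
    using ball_subset_cball by blast
qed (rule assms)

lemma translate_cball_padic: "(+) a ` cball x r = cball (a + x :: 'p :: prime_card padic) r"
proof -
  have "y \<in> (+) a ` cball x r" if "y \<in> cball (a + x) r" for y
    using that dist_padic_translate[of a x "y - a"] by (intro image_eqI[of _ _ "y - a"]) auto
  then show ?thesis
    by auto
qed

text \<open>Rational centres and radii p^k keep the family countable; the empty set is added to make
  it closed under intersections.\<close>

definition padic_balls :: "'p :: prime_card padic set set" where
  "padic_balls = insert {} ((\<lambda>(q, k). cball (of_rat q) (real CARD('p) powi k)) ` UNIV)"

lemma countable_padic_balls: "countable padic_balls"
  by (simp add: padic_balls_def)

lemma topological_basis_padic_balls: "topological_basis (padic_balls :: 'p :: prime_card padic set set)"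
proof (rule topological_basisI)
  show "open B" if "B \<in> padic_balls" for B :: "'p padic set"
    using that by (auto simp: padic_balls_def intro: open_cball_padic card_powi_pos)
next
  fix U :: "'p padic set" and x
  assume "open U" "x \<in> U"
  then obtain e where e: "e > 0" "ball x e \<subseteq> U"
    by (auto simp: open_contains_ball)
  obtain k where k: "real CARD('p) powi k < e"
    using e(1) by (rule card_powi_small)
  obtain q where q: "dist x (of_rat q) < real CARD('p) powi k"
    using card_powi_pos by (rule padic_rat_dense)
  then have "cball (of_rat q) (real CARD('p) powi k) = cball x (real CARD('p) powi k)"
    by (intro cball_padic_eq) simp
  moreover have "cball x (real CARD('p) powi k) \<subseteq> U"
    using e(2) k by auto
  ultimately show "\<exists>B\<in>padic_balls. x \<in> B \<and> B \<subseteq> U"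
    using card_powi_pos[where 'p = 'p, of k]
    by (intro bexI[of _ "cball (of_rat q) (real CARD('p) powi k)"]) (auto simp: padic_balls_def)
qed

text \<open>Second countability makes the Borel sets of the product equal to the product
  sigma-algebra, so kernels such as those depending on \<open>dist x y\<close> are measurable for
  Fubini.\<close>

instance padic :: (prime_card) second_countable_topology
  by standard
    (use countable_padic_balls topological_basis_imp_subbasis[OF topological_basis_padic_balls] in blast)

text \<open>Provides the intersection-stable generator for the Dynkin argument that reduces Borel
  sets to balls.\<close>

lemma Int_stable_padic_balls: "Int_stable (padic_balls :: 'p :: prime_card padic set set)"
proof (rule Int_stableI)
  fix A B :: "'p padic set"
  assume AB: "A \<in> padic_balls" "B \<in> padic_balls"
  have "A \<inter> B \<in> {{}, A, B}"
  proof (cases "A = {} \<or> B = {}")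
    case False
    then obtain x y r s where "A = cball x r" "B = cball y s"
      using AB by (auto simp: padic_balls_def)
    then show ?thesis
      using cball_padic_Int[of r s x y] cball_padic_Int[of s r y x] by (cases "r \<le> s") auto
  qed auto
  then show "A \<inter> B \<in> padic_balls"
    using AB by (auto simp: padic_balls_def)
qed

lemma sigma_sets_padic_balls: "sigma_sets UNIV padic_balls = (sets borel :: 'p :: prime_card padic set set)"
  using borel_eq_countable_basis[OF countable_padic_balls topological_basis_padic_balls]
  by (metis sets_measure_of subset_UNIV Pow_UNIV)

section \<open>Additive characters\<close>

lemma padic_abs_of_int_le_1: "padic_abs CARD('p :: prime_card) (of_int a) \<le> 1"
  using padic_abs_of_int_le_iff[OF prime_card[where 'a = 'p], of a 0] by (cases "a = 0") auto

text \<open>If q p^n = m is an integer and |q| \<le> 1, then |m| \<le> p^-n, so p^n divides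
  m.\<close>

lemma padic_abs_le_1_imp_Ints:
  assumes "q * of_nat CARD('p :: prime_card) ^ n \<in> \<int>" "padic_abs CARD('p) q \<le> 1"
  shows "q \<in> \<int>"
proof -
  obtain m where m: "q * of_nat CARD('p) ^ n = of_int m"
    using assms(1) by (auto elim: Ints_cases)
  have "padic_abs CARD('p) (of_nat CARD('p)) = inverse (real CARD('p))"
    using padic_norm_card_powi[where 'p = 'p, of 1] padic_norm_of_rat[where 'p = 'p, of "of_nat CARD('p)"]
    by (simp add: power_int_minus)
  then have "padic_abs CARD('p) (of_nat CARD('p) ^ n) = inverse (real CARD('p)) ^ n"
    by (induction n) (simp_all add: padic_abs_mult[OF prime_card] padic_abs_1[OF prime_card])
  then have "padic_abs CARD('p) (of_int m) \<le> real CARD('p) powi (- int n)"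
    using assms(2) unfolding m[symmetric]
    by (simp add: padic_abs_mult[OF prime_card] power_int_minus power_inverse mult_left_le_one_le)
  then have "int CARD('p) ^ n dvd m"
    using padic_abs_of_int_le_iff[OF prime_card[where 'a = 'p], of m n] by (cases "m = 0") auto
  then obtain k where "m = int CARD('p) ^ n * k"
    by blast
  then have "q * of_nat CARD('p) ^ n = of_int k * of_nat CARD('p) ^ n"
    using m by simp
  then show ?thesis
    using card_pos[where 'p = 'p] by auto
qed

text \<open>A rational near \<open>x\<close> is split by partial fractions into one part with a
  power of p as denominator and one part whose denominator is prime to p. The latter is p-integral,
  and so is the integer removed when the former is reduced modulo 1.\<close>

lemma padic_frac_exists:
  "\<exists>q. 0 \<le> q \<and> q < 1 \<and> (\<exists>n. q * of_nat CARD('p) ^ n \<in> \<int>) \<and> padic_norm (x - of_rat q) \<le> 1"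
  for x :: "'p :: prime_card padic"
proof -
  obtain q where q: "dist x (of_rat q) < 1"
    by (rule padic_rat_dense) auto
  obtain a b where ab: "q = of_int a / of_int b" "b \<noteq> 0"
    by (rule rat_fraction_cases)
  let ?p = "int CARD('p)"
  have unit: "\<not> is_unit ?p"
    using prime_gt_1_nat[OF prime_card[where 'a = 'p]] by simp
  obtain c where c: "b = ?p ^ multiplicity ?p b * c" "\<not> ?p dvd c"
    using multiplicity_decompose'[OF ab(2) unit] by blast
  define n where "n = multiplicity ?p b"
  have "prime ?p"
    using prime_card[where 'a = 'p] by simp
  then have "coprime ?p c"
    using c(2) by (rule prime_imp_coprime)
  then have "gcd c (?p ^ n) = 1"
    by (simp add: coprime_iff_gcd_eq_1[symmetric] coprime_commute)
  \<comment> \<open>Dividing this identity by p^n c gives 1/(p^n c) = u/p^n + v/c, the partial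
    fraction decomposition.\<close>
  then obtain u v where uv: "u * c + v * ?p ^ n = 1"
    using bezout_int[of c "?p ^ n"] by auto
  define r :: rat where "r = of_int (a * u) / of_nat CARD('p) ^ n"
  have c0: "c \<noteq> 0" and p0: "(of_nat CARD('p) :: rat) ^ n \<noteq> 0"
    using c ab card_pos[where 'p = 'p] by auto
  have b: "(of_int b :: rat) = of_nat CARD('p) ^ n * of_int c"
    using c(1) unfolding n_def[symmetric] by (metis of_int_mult of_int_of_nat_eq of_int_power)
  have "q - r = of_int (a * v) / of_int c"
  proof -
    have "(of_int (u * c + v * ?p ^ n) :: rat) = 1"
      unfolding uv by simp
    then have uv': "of_int u * of_int c + of_int v * of_nat CARD('p) ^ n = (1 :: rat)"
      by simp
    have "q - r = of_int a * (1 - of_int u * of_int c) / (of_nat CARD('p) ^ n * of_int c)"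
      unfolding ab(1) b r_def using c0 p0 by (simp add: field_simps)
    also have "1 - of_int u * of_int c = (of_int v * of_nat CARD('p) ^ n :: rat)"
      using uv' by (simp add: algebra_simps)
    finally show ?thesis
      using c0 card_pos[where 'p = 'p] by simp
  qed
  moreover have "padic_abs CARD('p) (of_int c) = 1"
    using c(2) c0 padic_abs_of_int[OF prime_card[where 'a = 'p], of c] by (simp add: not_dvd_imp_multiplicity_0)
  ultimately have "padic_abs CARD('p) (q - r) \<le> 1"
    using padic_abs_of_int_le_1[where 'p = 'p, of "a * v"]
    by (simp add: divide_inverse padic_abs_mult[OF prime_card] padic_abs_inverse[OF prime_card])
  moreover have "padic_abs CARD('p) (of_int \<lfloor>r\<rfloor>) \<le> 1"
    by (rule padic_abs_of_int_le_1)
  ultimately have "padic_abs CARD('p) (q - r + of_int \<lfloor>r\<rfloor>) \<le> 1"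
    using padic_abs_add[OF prime_card[where 'a = 'p], of "q - r" "of_int \<lfloor>r\<rfloor>"] by linarith
  then have "padic_norm (of_rat (q - r + of_int \<lfloor>r\<rfloor>) :: 'p padic) \<le> 1"
    by (simp only: padic_norm_of_rat)
  then have "padic_norm (of_rat q - of_rat (frac r) :: 'p padic) \<le> 1"
    by (simp add: frac_def of_rat_diff of_rat_add algebra_simps)
  then have "padic_norm ((x - of_rat q) + (of_rat q - of_rat (frac r))) \<le> 1"
    using q padic_norm_add[of "x - of_rat q" "of_rat q - of_rat (frac r)"] by (simp add: dist_padic_def)
  moreover have "frac r * of_nat CARD('p) ^ n \<in> \<int>"
  proof -
    have "frac r * of_nat CARD('p) ^ n = of_int (a * u) - of_int \<lfloor>r\<rfloor> * of_nat CARD('p) ^ n"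
      using p0 by (simp add: frac_def r_def left_diff_distrib)
    then show ?thesis
      by simp
  qed
  ultimately show ?thesis
    by (intro exI[of _ "frac r"]) (auto simp: frac_lt_1)
qed

lemma padic_frac_unique_mod_Ints:
  assumes "q * of_nat CARD('p :: prime_card) ^ m \<in> \<int>" "padic_norm (x - of_rat q :: 'p padic) \<le> 1"
    and "r * of_nat CARD('p) ^ n \<in> \<int>" "padic_norm (x - of_rat r) \<le> 1"
  shows "q - r \<in> \<int>"
proof (rule padic_abs_le_1_imp_Ints)
  have "(q - r) * of_nat CARD('p) ^ (m + n)
      = (q * of_nat CARD('p) ^ m) * of_nat CARD('p) ^ n - (r * of_nat CARD('p) ^ n) * of_nat CARD('p) ^ m"
    by (simp add: power_add algebra_simps)
  then show "(q - r) * of_nat CARD('p) ^ (m + n) \<in> \<int>"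
    using assms(1,3) by (auto intro!: Ints_diff Ints_mult)
  have "padic_norm ((x - of_rat r) - (x - of_rat q)) \<le> 1"
    using padic_norm_diff[of "x - of_rat r" "x - of_rat q"] assms by linarith
  then have "padic_norm (of_rat (q - r) :: 'p padic) \<le> 1"
    by (simp add: of_rat_diff)
  then show "padic_abs CARD('p) (q - r) \<le> 1"
    by (simp only: padic_norm_of_rat)
qed

lemma padic_frac:
  fixes x :: "'p :: prime_card padic"
  shows padic_frac_nonneg: "padic_frac x \<ge> 0" and padic_frac_less_1: "padic_frac x < 1"
    and padic_frac_denominator: "\<exists>n. padic_frac x * of_nat CARD('p) ^ n \<in> \<int>"
    and padic_norm_diff_frac: "padic_norm (x - of_rat (padic_frac x)) \<le> 1"
proof -
  let ?Q = "\<lambda>q. 0 \<le> q \<and> q < 1 \<and> (\<exists>n. q * of_nat CARD('p) ^ n \<in> \<int>) \<and> padic_norm (x - of_rat q) \<le> 1"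
  have "\<exists>!q. ?Q q"
  proof (rule ex_ex1I[OF padic_frac_exists])
    fix q r
    assume "?Q q" "?Q r"
    then have "q - r \<in> \<int>" "\<bar>q - r\<bar> < 1"
      by (auto intro: padic_frac_unique_mod_Ints)
    then have "q - r = 0"
      using Ints_nonzero_abs_less1 by blast
    then show "q = r"
      by simp
  qed
  from theI'[OF this]
  show "padic_frac x \<ge> 0" "padic_frac x < 1" "\<exists>n. padic_frac x * of_nat CARD('p) ^ n \<in> \<int>"
    "padic_norm (x - of_rat (padic_frac x)) \<le> 1"
    unfolding padic_frac_def by blast+
qed

text \<open>The standard additive character of the p-adic field, trivial on the p-adic integers; the
  pairing depends only on the product of its arguments.\<close>

definition padic_char :: "'p :: prime_card padic \<Rightarrow> complex" where
  "padic_char x = exp (2 * of_real pi * \<i> * of_rat (padic_frac x))"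

lemma padic_pairing_char: "padic_pairing x \<theta> = padic_char (x * \<theta>)"
  by (simp add: padic_pairing_def padic_char_def)

text \<open>Frees the character from the normalization of the fractional part to [0, 1): two
  representatives differ by an integer, which the exponential does not see.\<close>

lemma padic_char_eq:
  fixes x :: "'p :: prime_card padic"
  assumes "q * of_nat CARD('p) ^ n \<in> \<int>" "padic_norm (x - of_rat q) \<le> 1"
  shows "padic_char x = exp (2 * of_real pi * \<i> * of_rat q)"
proof -
  obtain m where "padic_frac x * of_nat CARD('p) ^ m \<in> \<int>"
    using padic_frac_denominator by blast
  then have "q - padic_frac x \<in> \<int>"
    using assms padic_norm_diff_frac by (intro padic_frac_unique_mod_Ints)
  then obtain k where "q - padic_frac x = of_int k"
    by (auto elim: Ints_cases)
  then have q: "q = padic_frac x + of_int k"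
    by simp
  have "exp (2 * of_real pi * \<i> * of_rat q)
      = exp (2 * of_real pi * \<i> * of_rat (padic_frac x) + \<i> * (of_int k * (of_real pi * 2)))"
    unfolding q by (simp add: of_rat_add algebra_simps)
  then show ?thesis
    unfolding padic_char_def exp_plus_2pin by simp
qed

text \<open>The sum of two fractional parts may exceed 1, but it is still an admissible
  representative for the sum.\<close>

lemma padic_char_add: "padic_char (x + y) = padic_char x * padic_char (y :: 'p :: prime_card padic)"
proof -
  obtain m n where mn: "padic_frac x * of_nat CARD('p) ^ m \<in> \<int>" "padic_frac y * of_nat CARD('p) ^ n \<in> \<int>"
    using padic_frac_denominator by meson
  have "(padic_frac x + padic_frac y) * of_nat CARD('p) ^ (m + n)
      = (padic_frac x * of_nat CARD('p) ^ m) * of_nat CARD('p) ^ n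
        + (padic_frac y * of_nat CARD('p) ^ n) * of_nat CARD('p) ^ m"
    by (simp add: power_add algebra_simps)
  then have "(padic_frac x + padic_frac y) * of_nat CARD('p) ^ (m + n) \<in> \<int>"
    using mn by (auto intro!: Ints_add Ints_mult)
  moreover have "padic_norm (x + y - of_rat (padic_frac x + padic_frac y)) \<le> 1"
    using padic_norm_add[of "x - of_rat (padic_frac x)" "y - of_rat (padic_frac y)"]
      padic_norm_diff_frac[of x] padic_norm_diff_frac[of y]
    by (simp add: of_rat_add algebra_simps)
  ultimately have "padic_char (x + y) = exp (2 * of_real pi * \<i> * of_rat (padic_frac x + padic_frac y))"
    by (rule padic_char_eq)
  then show ?thesis
    by (simp add: padic_char_def of_rat_add exp_add[symmetric] algebra_simps)
qed

lemma padic_char_eq_1: "padic_norm x \<le> 1 \<Longrightarrow> padic_char x = 1"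
  using padic_char_eq[of 0 0 x] by simp

lemma norm_padic_char [simp]: "cmod (padic_char x) = 1"
proof -
  have "of_rat q = complex_of_real (of_rat q)" for q
    by (cases q rule: Rat_cases) (simp add: Fract_of_int_quotient of_rat_divide)
  then show ?thesis
    using norm_exp_i_times[of "2 * pi * of_rat (padic_frac x)"]
    by (simp add: padic_char_def mult_ac)
qed

text \<open>The value is exp(2 pi i / p). Nontriviality just outside the p-adic integers makes
  averages of characters vanish outside the dual ball.\<close>

lemma padic_char_inverse_card: "padic_char (inverse (of_nat CARD('p)) :: 'p :: prime_card padic) \<noteq> 1"
proof -
  let ?q = "inverse (of_nat CARD('p)) :: rat"
  have "padic_char (inverse (of_nat CARD('p)) :: 'p padic) = exp (2 * of_real pi * \<i> * of_rat ?q)"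
    using card_pos[where 'p = 'p] by (intro padic_char_eq[of _ 1]) (simp_all add: of_rat_inverse)
  also have "\<dots> = exp (\<i> * of_real (2 * pi / CARD('p)))"
    unfolding of_rat_inverse of_rat_of_nat_eq by (simp add: divide_inverse mult_ac)
  also have "\<dots> \<noteq> 1"
  proof
    assume "exp (\<i> * of_real (2 * pi / CARD('p))) = 1"
    then obtain n :: int where "2 * pi / CARD('p) = of_int (2 * n) * pi"
      unfolding exp_eq_1 by auto
    then have "real_of_int n * CARD('p) = 1"
      using card_pos[where 'p = 'p] by (simp add: field_simps)
    then have "n * int CARD('p) = 1"
      by (metis of_int_1 of_int_eq_iff of_int_mult of_int_of_nat_eq)
    then show False
      using prime_gt_1_nat[OF prime_card[where 'a = 'p]] by (simp add: zmult_eq_1_iff)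
  qed
  finally show ?thesis .
qed

lemma continuous_on_locally_constant:
  assumes "r > 0" "\<And>x y. dist x y \<le> r \<Longrightarrow> f x = f y"
  shows "continuous_on UNIV (f :: 'a :: metric_space \<Rightarrow> 'b :: metric_space)"
  unfolding continuous_on_iff using assms by (metis dist_self less_imp_le)

lemma padic_char_locally_constant: "dist x y \<le> 1 \<Longrightarrow> padic_char x = padic_char y"
  using padic_char_add[of y "x - y"] padic_char_eq_1[of "x - y"] by (simp add: dist_padic_def)

section \<open>Averages over balls\<close>

text \<open>Integrating over the set where Re(c w) is positive shows that this set is null.\<close>

lemma AE_zero_of_set_integrals:
  fixes w :: "'a \<Rightarrow> complex"
  assumes w: "integrable M w" and zero: "\<And>A. A \<in> sets M \<Longrightarrow> (LINT x:A|M. w x) = 0"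
  shows "AE x in M. w x = 0"
proof -
  have "AE x in M. Re (c * w x) \<le> 0" for c
  proof -
    define A where "A = {x \<in> space M. Re (c * w x) > 0}"
    have [measurable]: "w \<in> borel_measurable M"
      using w by (rule borel_measurable_integrable)
    have A: "A \<in> sets M"
      unfolding A_def by measurable
    have int: "integrable M (\<lambda>x. indicator A x *\<^sub>R (c * w x))"
      using w A by (intro integrable_mult_indicator integrable_mult_right)
    have "(LINT x|M. Re (indicator A x *\<^sub>R (c * w x))) = Re (LINT x|M. indicator A x *\<^sub>R (c * w x))"
      using int by (rule integral_Re)
    also have "(LINT x|M. indicator A x *\<^sub>R (c * w x)) = c * (LINT x:A|M. w x)"
      unfolding set_lebesgue_integral_def mult_scaleR_right[symmetric] by (rule integral_mult_right_zero)
    also have "\<dots> = 0"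
      using A by (simp add: zero)
    finally have "(LINT x|M. Re (indicator A x *\<^sub>R (c * w x))) = 0"
      by simp
    moreover have "AE x in M. Re (indicator A x *\<^sub>R (c * w x)) \<ge> 0"
      by (intro AE_I2) (auto simp: A_def indicator_def)
    ultimately have "AE x in M. Re (indicator A x *\<^sub>R (c * w x)) = 0"
      using integral_nonneg_eq_0_iff_AE[OF integrable_Re[OF int]] by blast
    then show ?thesis
      by (rule AE_mp) (auto intro!: AE_I2 simp: A_def indicator_def)
  qed
  \<comment> \<open>These four factors bound the real and the imaginary part of \<open>w\<close>
    from both sides.\<close>
  from this[of 1] this[of "-1"] this[of \<i>] this[of "-\<i>"] show ?thesis
    by eventually_elim (auto simp: complex_eq_iff)
qed

locale padic_haar_measure =
  fixes \<mu> :: "'p :: prime_card padic measure"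
  assumes haar: "padic_haar \<mu>"
begin

section \<open>The Haar measure of balls\<close>

lemma sets_haar [simp, measurable_cong]: "sets \<mu> = sets borel"
  using haar by (simp add: padic_haar_def)

lemma space_haar [simp]: "space \<mu> = UNIV"
  using sets_eq_imp_space_eq[OF sets_haar] by simp

lemma emeasure_translate: "A \<in> sets borel \<Longrightarrow> emeasure \<mu> ((+) a ` A) = emeasure \<mu> A"
  using haar by (simp add: padic_haar_def)

lemma emeasure_cball_translate: "emeasure \<mu> (cball x r) = emeasure \<mu> (cball 0 r)"
  using emeasure_translate[of "cball 0 r" x] by (simp add: translate_cball_padic)

text \<open>The p smaller balls are the cosets of one ball inside the next larger one, indexed by
  the leading digit. The exponent of p in the centres is negated because p has norm 1/p.\<close>

lemma padic_coset_decomposition: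
  fixes k :: int
  defines "c \<equiv> \<lambda>i. of_nat i * of_nat CARD('p) powi (- (k + 1)) :: 'p padic"
  shows "cball 0 (real CARD('p) powi (k + 1)) = (\<Union>i<CARD('p). cball (c i) (real CARD('p) powi k))"
    and "disjoint_family_on (\<lambda>i. cball (c i) (real CARD('p) powi k)) {..<CARD('p)}"
proof -
  let ?P = "of_nat CARD('p) :: 'p padic"
  have P: "?P \<noteq> 0"
    using card_pos[where 'p = 'p] by simp
  have of_int: "padic_norm (of_int m :: 'p padic) \<le> 1" for m
    using padic_abs_of_int_le_1[where 'p = 'p, of m] padic_norm_of_rat[where 'p = 'p, of "of_int m"] by simp
  have norm_P: "padic_norm (x * ?P powi j) = padic_norm x * real CARD('p) powi (- j)" for x j
    by (simp add: padic_norm_mult padic_norm_card_powi)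
  have c: "padic_norm (c i) \<le> real CARD('p) powi (k + 1)" for i
    using mult_right_mono[OF of_int[of "int i"], of "real CARD('p) powi (k + 1)"] card_powi_pos[where 'p = 'p, of "k + 1"]
    by (simp add: c_def norm_P add.commute)
  show "cball 0 (real CARD('p) powi (k + 1)) = (\<Union>i<CARD('p). cball (c i) (real CARD('p) powi k))"
  proof (intro equalityI subsetI)
    fix y :: "'p padic"
    assume "y \<in> cball 0 (real CARD('p) powi (k + 1))"
    then have y: "padic_norm y \<le> real CARD('p) powi (k + 1)"
      by simp
    \<comment> \<open>Multiplying by p^k brings the norm down to at most p. The fractional part is
      then m/p for a single digit m, and m selects the coset.\<close>
    define z where "z = y * ?P powi k"
    define q where "q = padic_frac z"
    have "padic_norm z \<le> real CARD('p) powi (k + 1) * real CARD('p) powi (- k)"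
      unfolding z_def norm_P using y by (intro mult_right_mono) simp_all
    also have "\<dots> = real CARD('p)"
      by (simp flip: card_powi_add)
    finally have z: "padic_norm z \<le> real CARD('p)" .
    obtain n where "q * of_nat CARD('p) ^ n \<in> \<int>"
      unfolding q_def using padic_frac_denominator by blast
    then have "(q * of_nat CARD('p)) * of_nat CARD('p) ^ n \<in> \<int>"
      by (metis Ints_mult Ints_of_nat mult.assoc mult.commute)
    moreover have "padic_norm (of_rat (q * of_nat CARD('p)) :: 'p padic) \<le> 1"
    proof -
      have "padic_norm (z - (z - of_rat q)) \<le> real CARD('p)"
        using padic_norm_diff[of z "z - of_rat q"] z padic_norm_diff_frac[of z] card_gt_1[where 'p = 'p]
        unfolding q_def by linarith
      then have "padic_norm (of_rat q * ?P powi 1) \<le> 1"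
        unfolding norm_P using card_pos[where 'p = 'p] by (simp add: power_int_minus field_simps)
      then show ?thesis
        by (simp add: of_rat_mult)
    qed
    ultimately have "q * of_nat CARD('p) \<in> \<int>"
      unfolding padic_norm_of_rat by (rule padic_abs_le_1_imp_Ints)
    then obtain m where m: "q * of_nat CARD('p) = of_int m"
      by (auto elim: Ints_cases)
    have "0 \<le> q * of_nat CARD('p)" "q * of_nat CARD('p) < of_nat CARD('p)"
      using padic_frac_nonneg[of z] padic_frac_less_1[of z] card_pos[where 'p = 'p] by (simp_all add: q_def)
    then have m': "0 \<le> m" "m < int CARD('p)"
      unfolding m by (simp_all flip: of_int_less_iff[where 'a = rat])
    then have q: "q = of_nat (nat m) / of_nat CARD('p)"
      using m card_pos[where 'p = 'p] by (simp add: field_simps)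
    have "c (nat m) = of_rat q * ?P powi (- k)"
      unfolding c_def q using P by (simp add: of_rat_mult of_rat_inverse power_int_diff divide_inverse power_int_minus)
    moreover have "y = z * ?P powi (- k)"
      unfolding z_def using P by (simp add: power_int_minus)
    ultimately have "dist y (c (nat m)) = padic_norm ((z - of_rat q) * ?P powi (- k))"
      by (simp add: dist_padic_def left_diff_distrib)
    also have "\<dots> \<le> real CARD('p) powi k"
      unfolding norm_P q_def using padic_norm_diff_frac[of z] card_powi_pos[where 'p = 'p, of k] padic_norm_nonneg
      by (simp add: mult_left_le_one_le)
    finally show "y \<in> (\<Union>i<CARD('p). cball (c i) (real CARD('p) powi k))"
      using m' by (intro UN_I[of "nat m"]) (auto simp: dist_commute)
  next
    fix y
    assume "y \<in> (\<Union>i<CARD('p). cball (c i) (real CARD('p) powi k))"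
    then obtain i where "dist (c i) y \<le> real CARD('p) powi k"
      by auto
    also have "\<dots> \<le> real CARD('p) powi (k + 1)"
      by (subst card_powi_le_iff) simp
    finally have "padic_norm y \<le> real CARD('p) powi (k + 1)"
      using dist_padic_ultrametric[of 0 y "c i"] c[of i] by simp
    then show "y \<in> cball 0 (real CARD('p) powi (k + 1))"
      by simp
  qed
  have dist: "dist (c i) (c j) > real CARD('p) powi k" if "i < CARD('p)" "j < CARD('p)" "i \<noteq> j" for i j
  proof -
    have "\<not> int CARD('p) dvd int i - int j"
      using that zdvd_imp_le[of "int CARD('p)" "\<bar>int i - int j\<bar>"] by (auto simp: dvd_abs_iff)
    then have "padic_abs CARD('p) (of_int (int i - int j)) = 1"
      using that padic_abs_of_int[OF prime_card[where 'a = 'p], of "int i - int j"]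
      by (simp add: not_dvd_imp_multiplicity_0)
    then have "padic_norm (of_int (int i - int j) :: 'p padic) = 1"
      using padic_norm_of_rat[where 'p = 'p, of "of_int (int i - int j)"]
      by (simp add: of_rat_diff)
    then have "padic_norm (of_int (int i - int j) * ?P powi (- (k + 1))) = real CARD('p) powi (k + 1)"
      unfolding norm_P by (simp add: add.commute)
    then have "dist (c i) (c j) = real CARD('p) powi (k + 1)"
      by (simp add: c_def dist_padic_def left_diff_distrib)
    then show ?thesis
      by (simp add: card_powi_less_iff)
  qed
  show "disjoint_family_on (\<lambda>i. cball (c i) (real CARD('p) powi k)) {..<CARD('p)}"
    unfolding disjoint_family_on_def
  proof (intro ballI impI)
    fix i j
    assume ij: "i \<in> {..<CARD('p)}" "j \<in> {..<CARD('p)}" "i \<noteq> j"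
    have "\<not> (dist (c i) y \<le> real CARD('p) powi k \<and> dist (c j) y \<le> real CARD('p) powi k)" for y
      using dist[of i j] dist_padic_ultrametric[of "c i" "c j" y] ij by (auto simp: dist_commute)
    then show "cball (c i) (real CARD('p) powi k) \<inter> cball (c j) (real CARD('p) powi k) = {}"
      by auto
  qed
qed

text \<open>Translation invariance makes p cosets of equal measure, so one step in the radius
  multiplies the measure by p; the normalization at radius 1 starts an induction in both
  directions.\<close>

lemma emeasure_cball: "emeasure \<mu> (cball x (real CARD('p) powi k)) = ennreal (real CARD('p) powi k)"
proof -
  let ?e = "\<lambda>k. emeasure \<mu> (cball 0 (real CARD('p) powi k))"
  have step: "?e (k + 1) = ennreal (real CARD('p)) * ?e k" for k
  proof -
    have "?e (k + 1) = (\<Sum>i<CARD('p). emeasure \<mu> (cball (of_nat i * of_nat CARD('p) powi (- (k + 1))) (real CARD('p) powi k)))"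
      unfolding padic_coset_decomposition(1)[of k]
      by (intro sum_emeasure[symmetric] padic_coset_decomposition(2)) auto
    also have "\<dots> = (\<Sum>i<CARD('p). ?e k)"
      by (intro sum.cong refl) (rule emeasure_cball_translate)
    finally show ?thesis
      by (simp add: ennreal_of_nat_eq_real_of_nat)
  qed
  have "?e k = ennreal (real CARD('p) powi k)"
  proof (induction k rule: int_induct[of _ 0])
    case base
    have "cball 0 1 = {x :: 'p padic. padic_norm x \<le> 1}"
      by auto
    then show ?case
      using haar by (simp add: padic_haar_def)
  next
    case (step1 k)
    then show ?case
      unfolding step using card_powi_pos[where 'p = 'p, of k]
      by (simp add: card_powi_add ennreal_mult' mult.commute)
  next
    case (step2 k)
    have "ennreal (real CARD('p)) * ?e (k - 1) = ennreal (real CARD('p)) * ennreal (real CARD('p) powi (k - 1))"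
      using step[of "k - 1"] step2 card_powi_add[where 'p = 'p, of "k - 1" 1]
      by (simp add: ennreal_mult'[symmetric] mult.commute)
    then show ?case
      using card_pos[where 'p = 'p] by (simp add: ennreal_mult_cancel_left)
  qed
  then show ?thesis
    by (subst emeasure_cball_translate)
qed

lemma measure_cball: "measure \<mu> (cball x (real CARD('p) powi k)) = real CARD('p) powi k"
  using emeasure_cball[of x k] card_powi_pos[where 'p = 'p, of k] by (simp add: measure_def)

lemma UN_cball: "(\<Union>n. cball x (real CARD('p) powi int n)) = (UNIV :: 'p padic set)"
proof -
  have "\<exists>n. y \<in> cball x (real CARD('p) powi int n)" for y
    using card_powi_large[where 'p = 'p, of "dist x y"] by (auto intro: less_imp_le)
  then show ?thesis
    by auto
qed

sublocale sigma_finite_measure \<mu>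
proof
  show "\<exists>A. countable A \<and> A \<subseteq> sets \<mu> \<and> \<Union> A = space \<mu> \<and> (\<forall>a\<in>A. emeasure \<mu> a \<noteq> \<infinity>)"
    using UN_cball[of 0] emeasure_cball[of 0 "int n" for n]
    by (intro exI[of _ "range (\<lambda>n. cball 0 (real CARD('p) powi int n))"]) auto
qed

sublocale pair: pair_sigma_finite \<mu> \<mu> ..

lemma continuous_on_translate: "continuous_on UNIV ((+) a :: 'p padic \<Rightarrow> _)"
  unfolding continuous_on_iff by (metis dist_padic_translate)

lemma measurable_translate [measurable]: "(+) a \<in> borel \<rightarrow>\<^sub>M (borel :: 'p padic measure)"
  by (intro borel_measurable_continuous_onI continuous_on_translate)

lemma distr_translate: "distr \<mu> \<mu> ((+) a) = \<mu>"
proof (rule measure_eqI)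
  fix A
  assume "A \<in> sets (distr \<mu> \<mu> ((+) a))"
  then have A: "A \<in> sets borel"
    by simp
  have "(+) a -` A = (+) (- a) ` A"
    by (auto intro!: image_eqI[of _ _ "a + x" for x])
  then show "emeasure (distr \<mu> \<mu> ((+) a)) A = emeasure \<mu> A"
    using A emeasure_translate[OF A, of "- a"] by (subst emeasure_distr) auto
qed simp

lemma integral_translate:
  fixes f :: "'p padic \<Rightarrow> complex"
  assumes "f \<in> borel_measurable borel"
  shows "(LINT x|\<mu>. f (a + x)) = (LINT x|\<mu>. f x)"
  using assms by (subst (2) distr_translate[of a, symmetric]) (subst integral_distr, auto)

section \<open>The averaging operators on L^2\<close>

definition Q :: "int \<Rightarrow> ('p padic \<Rightarrow> complex) \<Rightarrow> 'p padic \<Rightarrow> complex" where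
  "Q k f x = (LINT y|\<mu>. (if dist x y \<le> real CARD('p) powi k then f y else 0)) / of_real (real CARD('p) powi k)"

lemma Q_eq_ball_average: "ball_average \<mu> (real CARD('p) powi k) f x = Q k f x"
  unfolding ball_average_def Q_def set_lebesgue_integral_def measure_cball
  by (intro arg_cong2[where f = "(/)"] Bochner_Integration.integral_cong) (auto simp: indicator_def)

lemma Q_cong_dist:
  assumes "dist x y \<le> real CARD('p) powi k"
  shows "Q k f x = Q k f y"
proof -
  have "cball x (real CARD('p) powi k) = cball y (real CARD('p) powi k)"
    using assms by (intro cball_padic_eq[symmetric]) simp
  then have "dist x z \<le> real CARD('p) powi k \<longleftrightarrow> dist y z \<le> real CARD('p) powi k" for z
    by (metis mem_cball)
  then show ?thesis
    by (simp add: Q_def)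
qed

lemma continuous_on_Q: "continuous_on UNIV (Q k f)"
  by (rule continuous_on_locally_constant[OF card_powi_pos]) (rule Q_cong_dist)

lemma borel_measurable_Q [measurable]: "Q k f \<in> borel_measurable borel"
  by (intro borel_measurable_continuous_onI continuous_on_Q)

text \<open>Tonelli: for fixed \<open>y\<close> the points \<open>x\<close> within the given
  distance form a ball of known measure. After normalization this is the source of the contraction
  properties.\<close>

lemma nn_integral_ball_swap:
  assumes [measurable]: "u \<in> borel_measurable borel"
  shows "(\<integral>\<^sup>+ x. \<integral>\<^sup>+ y. (if dist x y \<le> real CARD('p) powi k then u y else 0) \<partial>\<mu> \<partial>\<mu>)
    = ennreal (real CARD('p) powi k) * (\<integral>\<^sup>+ y. u y \<partial>\<mu>)"
proof -
  have [measurable]: "u \<in> borel_measurable \<mu>"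
    using assms by simp
  have "(\<integral>\<^sup>+ x. \<integral>\<^sup>+ y. (if dist x y \<le> real CARD('p) powi k then u y else 0) \<partial>\<mu> \<partial>\<mu>)
      = (\<integral>\<^sup>+ y. \<integral>\<^sup>+ x. (if dist x y \<le> real CARD('p) powi k then u y else 0) \<partial>\<mu> \<partial>\<mu>)"
    by (rule pair.Fubini'[symmetric]) measurable
  also have "\<dots> = (\<integral>\<^sup>+ y. ennreal (real CARD('p) powi k) * u y \<partial>\<mu>)"
  proof (intro nn_integral_cong)
    fix y
    have "(\<integral>\<^sup>+ x. (if dist x y \<le> real CARD('p) powi k then u y else 0) \<partial>\<mu>)
        = (\<integral>\<^sup>+ x. u y * indicator (cball y (real CARD('p) powi k)) x \<partial>\<mu>)"
      by (intro nn_integral_cong) (auto simp: dist_commute)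
    also have "\<dots> = u y * ennreal (real CARD('p) powi k)"
      by (subst nn_integral_cmult_indicator) (auto simp: emeasure_cball)
    finally show "(\<integral>\<^sup>+ x. (if dist x y \<le> real CARD('p) powi k then u y else 0) \<partial>\<mu>)
        = ennreal (real CARD('p) powi k) * u y"
      by (simp add: mult.commute)
  qed
  also have "\<dots> = ennreal (real CARD('p) powi k) * (\<integral>\<^sup>+ y. u y \<partial>\<mu>)"
    by (rule nn_integral_cmult) simp
  finally show ?thesis .
qed

text \<open>The kernel is symmetric. The pairing has no conjugate and finiteness is a hypothesis, so
  that the lemma serves both for two functions in L^2 and for an integrable function against a
  character.\<close>

lemma Q_swap:
  assumes [measurable]: "f \<in> borel_measurable borel" "g \<in> borel_measurable borel"
    and fin: "(\<integral>\<^sup>+ x. \<integral>\<^sup>+ y. (if dist x y \<le> real CARD('p) powi k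
      then ennreal (cmod (f y * g x)) else 0) \<partial>\<mu> \<partial>\<mu>) < \<infinity>"
  shows "(LINT x|\<mu>. Q k f x * g x) = (LINT x|\<mu>. f x * Q k g x)"
proof -
  have [measurable]: "f \<in> borel_measurable \<mu>" "g \<in> borel_measurable \<mu>"
    using assms by simp_all
  let ?K = "\<lambda>x y. if dist x y \<le> real CARD('p) powi k then f y * g x else 0"
  let ?r = "complex_of_real (real CARD('p) powi k)"
  have "integrable (\<mu> \<Otimes>\<^sub>M \<mu>) (\<lambda>(x, y). ?K x y)"
  proof (rule integrableI_bounded)
    have "(\<integral>\<^sup>+ z. ennreal (norm (case z of (x, y) \<Rightarrow> ?K x y)) \<partial>(\<mu> \<Otimes>\<^sub>M \<mu>))
        = (\<integral>\<^sup>+ x. \<integral>\<^sup>+ y. (\<lambda>z. ennreal (norm (case z of (x, y) \<Rightarrow> ?K x y))) (x, y) \<partial>\<mu> \<partial>\<mu>)"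
      by (rule nn_integral_fst[of "\<lambda>z. ennreal (norm (case z of (x, y) \<Rightarrow> ?K x y))" \<mu>, symmetric]) measurable
    also have "\<dots> = (\<integral>\<^sup>+ x. \<integral>\<^sup>+ y. (if dist x y \<le> real CARD('p) powi k
      then ennreal (cmod (f y * g x)) else 0) \<partial>\<mu> \<partial>\<mu>)"
      by (intro nn_integral_cong) auto
    finally show "(\<integral>\<^sup>+ z. ennreal (norm (case z of (x, y) \<Rightarrow> ?K x y)) \<partial>(\<mu> \<Otimes>\<^sub>M \<mu>)) < \<infinity>"
      using fin by simp
  qed measurable
  then have *: "(LINT y|\<mu>. (LINT x|\<mu>. ?K x y)) = (LINT x|\<mu>. (LINT y|\<mu>. ?K x y))"
    by (rule pair.Fubini_integral)
  have "(LINT x|\<mu>. Q k f x * g x) = (LINT x|\<mu>. (LINT y|\<mu>. ?K x y) / ?r)"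
  proof (intro Bochner_Integration.integral_cong refl)
    fix x
    have "(LINT y|\<mu>. ?K x y) = (LINT y|\<mu>. (if dist x y \<le> real CARD('p) powi k then f y else 0) * g x)"
      by (intro Bochner_Integration.integral_cong) auto
    then show "Q k f x * g x = (LINT y|\<mu>. ?K x y) / ?r"
      by (simp add: Q_def)
  qed
  also have "\<dots> = (LINT x|\<mu>. (LINT y|\<mu>. ?K x y)) / ?r"
    by simp
  also have "\<dots> = (LINT y|\<mu>. (LINT x|\<mu>. ?K x y) / ?r)"
    unfolding *[symmetric] by simp
  also have "\<dots> = (LINT y|\<mu>. f y * Q k g y)"
  proof (intro Bochner_Integration.integral_cong refl)
    fix y
    have "(LINT x|\<mu>. ?K x y) = (LINT x|\<mu>. f y * (if dist y x \<le> real CARD('p) powi k then g x else 0))"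
      by (intro Bochner_Integration.integral_cong) (auto simp: dist_commute)
    then show "(LINT x|\<mu>. ?K x y) / ?r = f y * Q k g y"
      by (simp add: Q_def)
  qed
  finally show ?thesis .
qed

lemma L2_borel: "f \<in> L2 \<mu> \<Longrightarrow> f \<in> borel_measurable borel"
  using L2_measurable[of f \<mu>] by simp

lemma L2_ball:
  assumes "f \<in> L2 \<mu>"
  shows "(\<lambda>y. if dist x y \<le> r then f y else 0) \<in> L2 \<mu>"
proof (rule L2_I)
  have [measurable]: "f \<in> borel_measurable \<mu>"
    using assms by (rule L2_measurable)
  show "(\<lambda>y. if dist x y \<le> r then f y else 0) \<in> borel_measurable \<mu>"
    by measurable
  show "integrable \<mu> (\<lambda>x. (cmod (f x))\<^sup>2)"
    using assms by (rule L2_integrable)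
qed auto

lemma L2_indicator_ball: "(\<lambda>y. if dist x y \<le> real CARD('p) powi k then 1 else 0) \<in> L2 \<mu>"
  and norm_sq_indicator_ball:
    "norm_sq_L2 \<mu> (\<lambda>y. if dist x y \<le> real CARD('p) powi k then 1 else 0) = real CARD('p) powi k"
proof -
  have eq: "(cmod (if dist x y \<le> real CARD('p) powi k then 1 else 0))\<^sup>2
      = indicator (cball x (real CARD('p) powi k)) y" for y
    by simp
  have "integrable \<mu> (indicator (cball x (real CARD('p) powi k)) :: _ \<Rightarrow> real)"
    by (intro integrable_real_indicator) (auto simp: emeasure_cball)
  then show "(\<lambda>y. if dist x y \<le> real CARD('p) powi k then 1 else 0) \<in> L2 \<mu>"
    unfolding L2_def mem_Collect_eq eq by (simp, measurable)
  show "norm_sq_L2 \<mu> (\<lambda>y. if dist x y \<le> real CARD('p) powi k then 1 else 0) = real CARD('p) powi k"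
    unfolding norm_sq_L2_def eq by (simp add: measure_cball)
qed

text \<open>Pointwise values of averages become inner products, to which linearity, Cauchy-Schwarz
  and self-adjointness apply.\<close>

lemma Q_eq_inner:
  "Q k f x = inner_L2 \<mu> f (\<lambda>y. if dist x y \<le> real CARD('p) powi k then 1 else 0)
    / of_real (real CARD('p) powi k)"
  unfolding Q_def inner_L2_def
  by (intro arg_cong2[where f = "(/)"] Bochner_Integration.integral_cong) auto

lemma Q_linear:
  assumes "f \<in> L2 \<mu>" "g \<in> L2 \<mu>"
  shows "Q k (\<lambda>x. f x + c * g x) x = Q k f x + c * Q k g x"
  using assms
  by (simp add: Q_eq_inner inner_L2_add_left L2_scale inner_L2_scale_left L2_indicator_ball add_divide_distrib)

lemma Q_diff:
  assumes "f \<in> L2 \<mu>" "g \<in> L2 \<mu>"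
  shows "Q k (\<lambda>x. f x - g x) x = Q k f x - Q k g x"
  using Q_linear[OF assms, of k "-1"] by simp

lemma Q_ball: "Q k (\<lambda>y. if dist x y \<le> real CARD('p) powi k then f y else 0) x = Q k f x"
  unfolding Q_def by (intro arg_cong2[where f = "(/)"] Bochner_Integration.integral_cong) auto

text \<open>Cauchy-Schwarz against the indicator of the ball. The bound gives decay for large balls
  and limits the growth for small ones.\<close>

lemma norm_Q_le:
  assumes "f \<in> L2 \<mu>"
  shows "(cmod (Q k f x))\<^sup>2 \<le> norm_sq_L2 \<mu> f / real CARD('p) powi k"
proof -
  let ?B = "\<lambda>y. if dist x y \<le> real CARD('p) powi k then 1 else 0" and ?r = "real CARD('p) powi k"
  have r: "?r > 0"
    by (rule card_powi_pos)
  have "cmod (Q k f x) = cmod (inner_L2 \<mu> f ?B) / ?r"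
    using r by (simp only: Q_eq_inner norm_divide norm_of_real abs_of_pos)
  then have "(cmod (Q k f x))\<^sup>2 = (cmod (inner_L2 \<mu> f ?B))\<^sup>2 / ?r\<^sup>2"
    by (simp only: power_divide)
  also have "\<dots> \<le> (norm_sq_L2 \<mu> f * ?r) / ?r\<^sup>2"
    using Cauchy_Schwarz_L2[OF assms L2_indicator_ball[of x k]] unfolding norm_sq_indicator_ball
    by (intro divide_right_mono) simp_all
  also have "\<dots> = norm_sq_L2 \<mu> f / ?r"
    using r by (simp add: power2_eq_square del: power_int_eq_0_iff mult_eq_0_iff)
  finally show ?thesis .
qed

text \<open>The average sees \<open>f\<close> only inside the ball, so the pointwise bound may be
  applied to the restriction of \<open>f\<close>; integrating over the centre gives back the full
  norm.\<close>

lemma nn_integral_Q_le: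
  assumes f: "f \<in> L2 \<mu>"
  shows "(\<integral>\<^sup>+ x. ennreal ((cmod (Q k f x))\<^sup>2) \<partial>\<mu>) \<le> ennreal (norm_sq_L2 \<mu> f)"
proof -
  let ?r = "real CARD('p) powi k"
  note r = card_powi_pos[where 'p = 'p, of k]
  have [measurable]: "f \<in> borel_measurable borel"
    using f by (rule L2_borel)
  have "ennreal ((cmod (Q k f x))\<^sup>2)
      \<le> ennreal (1 / ?r) * (\<integral>\<^sup>+ y. (if dist x y \<le> ?r then ennreal ((cmod (f y))\<^sup>2) else 0) \<partial>\<mu>)" for x
  proof -
    let ?f = "\<lambda>y. if dist x y \<le> ?r then f y else 0"
    have "(cmod (Q k f x))\<^sup>2 \<le> norm_sq_L2 \<mu> ?f / ?r"
      using norm_Q_le[OF L2_ball[OF f, of x ?r], of k x] by (simp add: Q_ball)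
    then have "ennreal ((cmod (Q k f x))\<^sup>2) \<le> ennreal (1 / ?r * norm_sq_L2 \<mu> ?f)"
      by (intro ennreal_leI) simp
    also have "\<dots> = ennreal (1 / ?r) * (\<integral>\<^sup>+ y. ennreal ((cmod (?f y))\<^sup>2) \<partial>\<mu>)"
      unfolding nn_integral_L2[OF L2_ball[OF f]] using r by (intro ennreal_mult) (simp_all add: norm_sq_L2_nonneg)
    also have "(\<integral>\<^sup>+ y. ennreal ((cmod (?f y))\<^sup>2) \<partial>\<mu>)
        = (\<integral>\<^sup>+ y. (if dist x y \<le> ?r then ennreal ((cmod (f y))\<^sup>2) else 0) \<partial>\<mu>)"
      by (intro nn_integral_cong) auto
    finally show ?thesis .
  qed
  then have "(\<integral>\<^sup>+ x. ennreal ((cmod (Q k f x))\<^sup>2) \<partial>\<mu>)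
      \<le> (\<integral>\<^sup>+ x. ennreal (1 / ?r) * (\<integral>\<^sup>+ y. (if dist x y \<le> ?r then ennreal ((cmod (f y))\<^sup>2) else 0) \<partial>\<mu>) \<partial>\<mu>)"
    by (intro nn_integral_mono)
  also have "\<dots> = ennreal (1 / ?r) * (\<integral>\<^sup>+ x. (\<integral>\<^sup>+ y. (if dist x y \<le> ?r then ennreal ((cmod (f y))\<^sup>2) else 0) \<partial>\<mu>) \<partial>\<mu>)"
    by (intro nn_integral_cmult) measurable
  also have "\<dots> = ennreal (1 / ?r) * (ennreal ?r * ennreal (norm_sq_L2 \<mu> f))"
    by (subst nn_integral_ball_swap) (simp_all add: nn_integral_L2[OF f])
  also have "\<dots> = ennreal (norm_sq_L2 \<mu> f)"
    using r card_pos[where 'p = 'p] by (simp add: ennreal_mult'[symmetric] norm_sq_L2_nonneg)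
  finally show ?thesis .
qed

lemma Q_L2: "f \<in> L2 \<mu> \<Longrightarrow> Q k f \<in> L2 \<mu>"
  using nn_integral_Q_le[of f k] by (intro L2_I_nn_integral) (auto intro: order_le_less_trans)

lemma Q_cnj: "Q k (\<lambda>x. cnj (f x)) x = cnj (Q k f x)"
proof -
  have "(LINT y|\<mu>. (if dist x y \<le> real CARD('p) powi k then cnj (f y) else 0))
      = (LINT y|\<mu>. cnj (if dist x y \<le> real CARD('p) powi k then f y else 0))"
    by (intro Bochner_Integration.integral_cong) auto
  then show ?thesis
    by (simp add: Q_def)
qed

lemma Q_self_adjoint:
  assumes f: "f \<in> L2 \<mu>" and g: "g \<in> L2 \<mu>"
  shows "inner_L2 \<mu> (Q k f) g = inner_L2 \<mu> f (Q k g)"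
proof -
  let ?r = "real CARD('p) powi k"
  have [measurable]: "f \<in> borel_measurable borel" "g \<in> borel_measurable borel"
    using f g by (auto intro: L2_borel)
  have cnj_g [measurable]: "(\<lambda>x. cnj (g x)) \<in> borel_measurable borel"
    using g by (intro L2_borel L2_cnj)
  have swap: "(\<integral>\<^sup>+ y. (if dist x y \<le> ?r then ennreal c else 0) \<partial>\<mu>) = ennreal ?r * ennreal c" for x :: "'p padic" and c
  proof -
    have "(\<integral>\<^sup>+ y. (if dist x y \<le> ?r then ennreal c else 0) \<partial>\<mu>)
        = (\<integral>\<^sup>+ y. ennreal c * indicator (cball x ?r) y \<partial>\<mu>)"
      by (intro nn_integral_cong) auto
    also have "\<dots> = ennreal c * ennreal ?r"
      by (subst nn_integral_cmult_indicator) (auto simp: emeasure_cball)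
    finally show ?thesis
      by (simp add: mult.commute)
  qed
  \<comment> \<open>Bounding the product by a sum of squares separates the variables, and each half
    is a norm times the measure of the ball.\<close>
  have "(\<integral>\<^sup>+ x. \<integral>\<^sup>+ y. (if dist x y \<le> ?r then ennreal (cmod (f y * cnj (g x))) else 0) \<partial>\<mu> \<partial>\<mu>)
      \<le> (\<integral>\<^sup>+ x. \<integral>\<^sup>+ y. (if dist x y \<le> ?r then ennreal ((cmod (f y))\<^sup>2) else 0)
          + (if dist x y \<le> ?r then ennreal ((cmod (g x))\<^sup>2) else 0) \<partial>\<mu> \<partial>\<mu>)"
    using mult_le_sum_squares[of "cmod (f y)" "cmod (g x)" for x y]
    by (intro nn_integral_mono) (auto simp: norm_mult simp flip: ennreal_plus intro!: ennreal_leI)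
  also have "\<dots> = (\<integral>\<^sup>+ x. (\<integral>\<^sup>+ y. (if dist x y \<le> ?r then ennreal ((cmod (f y))\<^sup>2) else 0) \<partial>\<mu>)
          + ennreal ?r * ennreal ((cmod (g x))\<^sup>2) \<partial>\<mu>)"
    by (intro nn_integral_cong) (subst nn_integral_add, measurable, simp only: swap)
  also have "\<dots> = (\<integral>\<^sup>+ x. (\<integral>\<^sup>+ y. (if dist x y \<le> ?r then ennreal ((cmod (f y))\<^sup>2) else 0) \<partial>\<mu>) \<partial>\<mu>)
          + (\<integral>\<^sup>+ x. ennreal ?r * ennreal ((cmod (g x))\<^sup>2) \<partial>\<mu>)"
    by (intro nn_integral_add) measurable
  also have "\<dots> = ennreal ?r * ennreal (norm_sq_L2 \<mu> f) + ennreal ?r * ennreal (norm_sq_L2 \<mu> g)"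
    by (subst nn_integral_ball_swap, measurable, subst nn_integral_cmult, measurable)
      (simp only: nn_integral_L2 f g)
  also have "\<dots> < \<infinity>"
    by (simp add: ennreal_mult_less_top)
  finally have "(LINT x|\<mu>. Q k f x * cnj (g x)) = (LINT x|\<mu>. f x * Q k (\<lambda>x. cnj (g x)) x)"
    by (intro Q_swap) auto
  then show ?thesis
    by (simp add: inner_L2_def Q_cnj)
qed

lemma Q_const:
  assumes "\<And>y. dist x y \<le> real CARD('p) powi k \<Longrightarrow> h y = h x"
  shows "Q k h x = h x"
proof -
  let ?r = "real CARD('p) powi k"
  have "(LINT y|\<mu>. (if dist x y \<le> ?r then h y else 0)) = (LINT y|\<mu>. indicator (cball x ?r) y *\<^sub>R h x)"
  proof (intro Bochner_Integration.integral_cong refl)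
    fix y
    show "(if dist x y \<le> ?r then h y else 0) = indicator (cball x ?r) y *\<^sub>R h x"
      using assms[of y] by (cases "dist x y \<le> ?r") simp_all
  qed
  also have "\<dots> = ?r *\<^sub>R h x"
    by (subst integral_scaleR_left) (auto simp: measure_cball emeasure_cball)
  finally show ?thesis
    using card_pos[where 'p = 'p] by (simp add: Q_def scaleR_conv_of_real)
qed

text \<open>If the inner ball is at least as large, its average is already constant on the outer
  one. Otherwise self-adjointness moves the inner average to the indicator of the larger ball, which
  it fixes.\<close>

lemma Q_Q:
  assumes f: "f \<in> L2 \<mu>"
  shows "Q j (Q k f) x = Q (max j k) f x"
proof (cases "j \<le> k")
  case True
  have "Q j (Q k f) x = Q k f x"
  proof (rule Q_const)
    fix y
    assume "dist x y \<le> real CARD('p) powi j"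
    then have "dist x y \<le> real CARD('p) powi k"
      using True card_powi_le_iff[where 'p = 'p, of j k] by simp
    then show "Q k f y = Q k f x"
      by (rule Q_cong_dist[symmetric])
  qed
  then show ?thesis
    using True by (simp add: max_absorb2)
next
  case False
  let ?B = "\<lambda>y. if dist x y \<le> real CARD('p) powi j then 1 else (0 :: complex)"
  have "Q k ?B y = ?B y" for y
  proof (rule Q_const)
    fix z
    assume "dist y z \<le> real CARD('p) powi k"
    then have "dist y z \<le> real CARD('p) powi j"
      using False card_powi_le_iff[where 'p = 'p, of k j] by simp
    then have "dist x z \<le> real CARD('p) powi j \<longleftrightarrow> dist x y \<le> real CARD('p) powi j"
      using dist_padic_ultrametric[of x z y] dist_padic_ultrametric[of x y z] dist_commute[of y z]
      by (smt (verit))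
    then show "?B z = ?B y"
      by simp
  qed
  then have "Q k ?B = ?B"
    by (rule ext)
  then have "inner_L2 \<mu> (Q k f) ?B = inner_L2 \<mu> f ?B"
    using Q_self_adjoint[OF f L2_indicator_ball[of x j], of k] by simp
  moreover have "max j k = j"
    using False by simp
  ultimately show ?thesis
    by (simp only: Q_eq_inner[of j])
qed

section \<open>Differences of consecutive averages: orthogonality and totality\<close>

definition D :: "int \<Rightarrow> ('p padic \<Rightarrow> complex) \<Rightarrow> 'p padic \<Rightarrow> complex" where
  "D k f x = Q k f x - Q (k + 1) f x"

lemma D_abs_def: "D k f = (\<lambda>x. Q k f x - Q (k + 1) f x)"
  by (simp add: D_def fun_eq_iff)

lemma D_in_L2: "f \<in> L2 \<mu> \<Longrightarrow> D k f \<in> L2 \<mu>"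
  unfolding D_abs_def by (intro L2_diff Q_L2)

text \<open>Functions in the range of \<open>D k\<close> are constant on balls of radius p^k and
  have mean 0 on balls of radius p^(k+1).\<close>

lemma Q_D:
  assumes "f \<in> L2 \<mu>"
  shows "Q j (D k f) x = (if j \<le> k then D k f x else 0)"
proof -
  have "Q j (D k f) x = Q (max j k) f x - Q (max j (k + 1)) f x"
    unfolding D_abs_def using assms by (simp add: Q_diff Q_L2 Q_Q)
  then show ?thesis
    by (cases "j \<le> k") (simp_all add: D_def max_absorb1 max_absorb2)
qed

lemma D_D: "f \<in> L2 \<mu> \<Longrightarrow> D j (D k f) x = (if j = k then D k f x else 0)"
  unfolding D_def[of j] by (auto simp: Q_D)

lemma D_self_adjoint:
  assumes "f \<in> L2 \<mu>" "g \<in> L2 \<mu>"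
  shows "inner_L2 \<mu> (D k f) g = inner_L2 \<mu> f (D k g)"
  unfolding D_abs_def using assms by (simp add: inner_L2_diff_left inner_L2_diff_right Q_L2 Q_self_adjoint)

lemma D_is_linear:
  assumes "f \<in> L2 \<mu>" "g \<in> L2 \<mu>"
  shows "D k (\<lambda>x. f x + c * g x) x = D k f x + c * D k g x"
  unfolding D_def using assms by (simp add: Q_linear algebra_simps)

text \<open>A Dynkin argument from balls to Borel sets. An element of L^2 need not be integrable, so
  it is first cut off to a large ball; a ball meets the cut-off ball in the empty set or in one of
  the two.\<close>

lemma AE_zero_of_Q_zero:
  assumes w: "w \<in> L2 \<mu>" and Q: "\<And>k x. Q k w x = 0"
  shows "AE x in \<mu>. w x = 0"
proof -
  have "AE x in \<mu>. (if dist 0 x \<le> real CARD('p) powi int n then w x else 0) = 0" for n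
  proof (rule AE_zero_of_set_integrals)
    let ?w = "\<lambda>x. if dist 0 x \<le> real CARD('p) powi int n then w x else 0"
    let ?B = "cball 0 (real CARD('p) powi int n) :: 'p padic set"
    have ball: "(LINT x:cball a (real CARD('p) powi k)|\<mu>. w x) = 0" for a k
    proof -
      have "(LINT x:cball a (real CARD('p) powi k)|\<mu>. w x)
          = (LINT x|\<mu>. (if dist a x \<le> real CARD('p) powi k then w x else 0))"
        unfolding set_lebesgue_integral_def by (intro Bochner_Integration.integral_cong) auto
      then show ?thesis
        using Q[of k a] card_pos[where 'p = 'p] by (simp add: Q_def)
    qed
    have "integrable \<mu> (\<lambda>x. w x * cnj (if dist 0 x \<le> real CARD('p) powi int n then 1 else 0))"
      using w L2_indicator_ball by (rule L2_integrable_inner)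
    also have "(\<lambda>x. w x * cnj (if dist 0 x \<le> real CARD('p) powi int n then 1 else 0)) = ?w"
      by auto
    finally show int: "integrable \<mu> ?w" .
    then have set_int: "set_integrable \<mu> A ?w" if "A \<in> sets borel" for A
      using that unfolding set_integrable_def by (intro integrable_mult_indicator) auto
    fix A
    assume "A \<in> sets \<mu>"
    then have A: "A \<in> sigma_sets UNIV padic_balls"
      by (simp add: sigma_sets_padic_balls)
    have "padic_balls \<subseteq> Pow (UNIV :: 'p padic set)"
      by simp
    with Int_stable_padic_balls show "(LINT x:A|\<mu>. ?w x) = 0"
      using A
    proof (induction rule: sigma_sets_induct_disjoint)
      case (basic A)
      have eq: "(LINT x:A|\<mu>. ?w x) = (LINT x:A \<inter> ?B|\<mu>. w x)"
        unfolding set_lebesgue_integral_def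
        by (intro Bochner_Integration.integral_cong) (auto simp: indicator_def)
      consider "A = {}" | a k where "A = cball a (real CARD('p) powi k)"
        using basic by (auto simp: padic_balls_def)
      then show ?case
      proof cases
        case (2 a k)
        have "A \<inter> ?B = {} \<or> A \<inter> ?B = A \<or> A \<inter> ?B = ?B"
          using cball_padic_Int[of "real CARD('p) powi k" "real CARD('p) powi int n" a 0]
            cball_padic_Int[of "real CARD('p) powi int n" "real CARD('p) powi k" 0 a]
          unfolding 2 by (metis Int_absorb1 Int_absorb2 Int_commute linorder_linear)
        then show ?thesis
          unfolding eq using ball[of a k] ball[of 0 "int n"] 2
          by (elim disjE) (simp_all add: set_lebesgue_integral_def)
      qed (simp add: set_lebesgue_integral_def)
    next
      case empty
      show ?case
        by (simp add: set_lebesgue_integral_def)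
    next
      case (compl A)
      then have A: "A \<in> sets borel"
        by (simp add: sigma_sets_padic_balls)
      have "(LINT x:UNIV - A|\<mu>. ?w x) = (LINT x|\<mu>. ?w x - indicator A x *\<^sub>R ?w x)"
        unfolding set_lebesgue_integral_def
        by (intro Bochner_Integration.integral_cong) (auto simp: indicator_def)
      also have "\<dots> = (LINT x|\<mu>. ?w x) - (LINT x:A|\<mu>. ?w x)"
        unfolding set_lebesgue_integral_def using int set_int[OF A]
        by (intro Bochner_Integration.integral_diff) (simp_all add: set_integrable_def)
      also have "(LINT x|\<mu>. ?w x) = (LINT x:?B|\<mu>. w x)"
        unfolding set_lebesgue_integral_def
        by (intro Bochner_Integration.integral_cong) (auto simp: indicator_def)
      finally show ?case
        using compl ball[of 0 "int n"] by simp
    next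
      case (union A)
      then have "A i \<in> sets borel" for i
        unfolding sigma_sets_padic_balls by blast
      moreover have "A i \<inter> A j = {}" if "i \<noteq> j" for i j
        using union(1) that by (simp add: disjoint_family_on_def)
      ultimately have "(LINT x:(\<Union>i. A i)|\<mu>. ?w x) = (\<Sum>i. (LINT x:A i|\<mu>. ?w x))"
        by (intro lebesgue_integral_countable_add set_int sets.countable_UN) auto
      then show ?case
        unfolding union(3) by simp
    qed
  qed
  then have "AE x in \<mu>. \<forall>n. (if dist 0 x \<le> real CARD('p) powi int n then w x else 0) = 0"
    by (simp add: AE_all_countable)
  then show ?thesis
  proof eventually_elim
    case (elim x)
    obtain n where "dist 0 x < real CARD('p) powi int n"
      using card_powi_large by blast
    then show ?case
      using elim by (metis less_imp_le)
  qed
qed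

lemma D_is_total:
  assumes w: "w \<in> L2 \<mu>" and D: "\<And>k. AE x in \<mu>. D k w x = 0"
  shows "AE x in \<mu>. w x = 0"
proof (rule AE_zero_of_Q_zero[OF w])
  \<comment> \<open>\<open>D k w\<close> is constant on balls of positive measure, so vanishing
    almost everywhere is vanishing everywhere.\<close>
  have D0: "D k w x = 0" for k x
  proof (rule ccontr)
    let ?B = "cball x (real CARD('p) powi k)"
    assume nz: "D k w x \<noteq> 0"
    have const: "D k w y = D k w x" if "y \<in> ?B" for y
    proof -
      have "dist y x \<le> real CARD('p) powi k" "dist y x \<le> real CARD('p) powi (k + 1)"
        using that card_powi_le_iff[where 'p = 'p, of k "k + 1"] by (auto simp: dist_commute)
      then show ?thesis
        unfolding D_def by (simp only: Q_cong_dist[of y x])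
    qed
    have "AE y in \<mu>. y \<notin> ?B"
      using D[of k]
    proof eventually_elim
      case (elim y)
      then show ?case
        using nz const[of y] by metis
    qed
    then have "emeasure \<mu> ?B = 0"
      using AE_iff_measurable[of ?B \<mu> "\<lambda>y. y \<notin> ?B"] by (simp add: cball_def)
    then show False
      using card_powi_pos[where 'p = 'p, of k] by (simp add: emeasure_cball)
  qed
  fix k x
  have const: "Q (k + int n) w x = Q k w x" for n
  proof (induction n)
    case (Suc n)
    then show ?case
      using D0[of "k + int n" x] by (simp add: D_def algebra_simps)
  qed simp
  have "(cmod (Q k w x))\<^sup>2 \<le> norm_sq_L2 \<mu> w / real CARD('p) powi (k + int n)" for n
    using norm_Q_le[OF w, of "k + int n" x] by (simp add: const)
  then have le: "(cmod (Q k w x))\<^sup>2 \<le> norm_sq_L2 \<mu> w / real CARD('p) powi k * inverse (real CARD('p)) ^ n" for n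
    by (simp add: card_powi_add divide_inverse power_inverse mult.assoc)
  have "(\<lambda>n. norm_sq_L2 \<mu> w / real CARD('p) powi k * inverse (real CARD('p)) ^ n) \<longlonglongrightarrow> 0"
    using card_gt_1[where 'p = 'p] by (intro tendsto_mult_right_zero LIMSEQ_power_zero) (simp add: inverse_less_1_iff)
  then have "(cmod (Q k w x))\<^sup>2 \<le> 0"
    by (rule LIMSEQ_le_const) (use le in blast)
  then show "Q k w x = 0"
    by simp
qed

text \<open>The levels run over all integers; the bijection \<open>int_decode\<close> enumerates
  them.\<close>

sublocale L2_projections \<mu> "\<lambda>n. D (int_decode n)"
proof
  fix f
  assume f: "f \<in> L2 \<mu>" and "\<And>n. AE x in \<mu>. D (int_decode n) f x = 0"
  then have "AE x in \<mu>. D k f x = 0" for k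
    by (metis int_encode_inverse)
  with f show "AE x in \<mu>. f x = 0"
    by (rule D_is_total)
qed (simp_all add: D_in_L2 D_is_linear D_self_adjoint D_D inj_int_decode[THEN inj_eq])

end

section \<open>The Markov operator of an isotropic Laplacian\<close>

lemma sigma_alpha_mono:
  assumes "p > 0" "\<alpha> > 0" "x \<le> y"
  shows "sigma_alpha p \<alpha> x \<le> sigma_alpha p \<alpha> y"
proof (cases "x > 0")
  case True
  then have "(real p / y) powr \<alpha> \<le> (real p / x) powr \<alpha>"
    using assms by (intro powr_mono2 divide_left_mono) auto
  then show ?thesis
    using True assms by (simp add: sigma_alpha_def)
qed (simp add: sigma_alpha_def)

text \<open>Continuity is what excludes atoms in the law of the radius. Only the point 0 is
  delicate, where exp(-t) \<le> 1/t with t = (p/r)^alpha gives the bound (r/p)^alpha.\<close>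

lemma continuous_on_sigma_alpha:
  assumes p: "p > 0" and \<alpha>: "\<alpha> > 0"
  shows "continuous_on UNIV (sigma_alpha p \<alpha>)"
proof (intro continuous_at_imp_continuous_on ballI)
  fix x :: real
  consider "x < 0" | "x = 0" | "x > 0"
    by linarith
  then show "isCont (sigma_alpha p \<alpha>) x"
  proof cases
    case 1
    then have "\<forall>\<^sub>F r in nhds x. sigma_alpha p \<alpha> r = 0"
      using eventually_nhds_in_open[of "{..<0}" x] by (auto elim!: eventually_mono simp: sigma_alpha_def)
    then show ?thesis
      by (subst isCont_cong[of _ "\<lambda>_. 0"]) auto
  next
    case 3
    then have "\<forall>\<^sub>F r in nhds x. sigma_alpha p \<alpha> r = exp (- ((real p / r) powr \<alpha>))"
      using eventually_nhds_in_open[of "{0<..}" x] by (auto elim!: eventually_mono simp: sigma_alpha_def)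
    moreover have "isCont (\<lambda>r. exp (- ((real p / r) powr \<alpha>))) x"
      using 3 p by (intro continuous_intros) auto
    ultimately show ?thesis
      by (subst isCont_cong) auto
  next
    case 2
    have le: "sigma_alpha p \<alpha> r \<le> (\<bar>r\<bar> / p) powr \<alpha>" for r
    proof (cases "r > 0")
      case True
      let ?t = "(real p / r) powr \<alpha>"
      have t: "?t > 0"
        using True p by simp
      have "exp (- ?t) \<le> inverse ?t"
        unfolding exp_minus using exp_ge_add_one_self[of ?t] t by (intro le_imp_inverse_le) linarith+
      also have "\<dots> = (r / p) powr \<alpha>"
        using True p by (simp add: powr_divide)
      finally show ?thesis
        using True by (simp add: sigma_alpha_def)
    qed (simp add: sigma_alpha_def)
    have lim: "((\<lambda>r. (\<bar>r\<bar> / p) powr \<alpha>) \<longlongrightarrow> 0) (at 0)"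
    proof (rule tendsto_zero_powrI[OF _ tendsto_const])
      have "((\<lambda>r. \<bar>r\<bar> / p) \<longlongrightarrow> \<bar>0\<bar> / p) (at 0)"
        using p by (intro tendsto_intros) auto
      then show "((\<lambda>r. \<bar>r\<bar> / p) \<longlongrightarrow> 0) (at 0)"
        by simp
    qed (use \<alpha> in auto)
    have "(sigma_alpha p \<alpha> \<longlongrightarrow> 0) (at 0)"
      by (rule tendsto_sandwich[OF _ _ tendsto_const lim])
        (simp add: sigma_alpha_def, intro always_eventually allI le)
    then show ?thesis
      using 2 by (simp add: isCont_def sigma_alpha_def)
  qed
qed

text \<open>The law of the exponent of the ball. Radius 0 is left out here; it has measure
  0.\<close>

definition radius_law :: "nat \<Rightarrow> real \<Rightarrow> int measure" where
  "radius_law p \<alpha> = distr (restrict_space (interval_measure (sigma_alpha p \<alpha>)) {0<..})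
     (count_space UNIV) (\<lambda>r. \<lfloor>log p r\<rfloor>)"

lemma sets_radius_law [simp, measurable_cong]: "sets (radius_law p \<alpha>) = sets (count_space UNIV)"
  by (simp add: radius_law_def)

lemma space_radius_law [simp]: "space (radius_law p \<alpha>) = UNIV"
  by (simp add: radius_law_def)

context
  fixes p :: nat and \<alpha> :: real
  assumes p: "p > 1" and \<alpha>: "\<alpha> > 0"
begin

lemma emeasure_sigma_alpha_Ioc:
  assumes "0 \<le> b"
  shows "emeasure (interval_measure (sigma_alpha p \<alpha>)) {0<..b} = ennreal (sigma_alpha p \<alpha> b)"
proof -
  have cont: "continuous (at_right a) (sigma_alpha p \<alpha>)" for a
  proof (rule continuous_within_subset[OF _ subset_UNIV])
    show "continuous (at a) (sigma_alpha p \<alpha>)"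
      using continuous_on_sigma_alpha[of p \<alpha>] p \<alpha> by (simp add: continuous_on_eq_continuous_within)
  qed
  have mono: "sigma_alpha p \<alpha> x \<le> sigma_alpha p \<alpha> y" if "x \<le> y" for x y
    using p \<alpha> that by (intro sigma_alpha_mono) auto
  have "emeasure (interval_measure (sigma_alpha p \<alpha>)) {0<..b} = ennreal (sigma_alpha p \<alpha> b - sigma_alpha p \<alpha> 0)"
    by (rule emeasure_interval_measure_Ioc[OF assms mono cont])
  also have "sigma_alpha p \<alpha> 0 = 0"
    by (simp add: sigma_alpha_def)
  finally show ?thesis
    by simp
qed

lemma emeasure_sigma_alpha_singleton: "emeasure (interval_measure (sigma_alpha p \<alpha>)) {b} = 0"
proof -
  have mono: "sigma_alpha p \<alpha> x \<le> sigma_alpha p \<alpha> y" if "x \<le> y" for x y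
    using p \<alpha> that by (intro sigma_alpha_mono) auto
  have "continuous_on UNIV (sigma_alpha p \<alpha>)"
    using p \<alpha> by (intro continuous_on_sigma_alpha) auto
  from emeasure_interval_measure_Icc[OF order_refl mono this, of b] show ?thesis
    by simp
qed

lemma measurable_floor_log:
  "(\<lambda>r. \<lfloor>log p r\<rfloor>) \<in> restrict_space (interval_measure (sigma_alpha p \<alpha>)) {0<..} \<rightarrow>\<^sub>M count_space UNIV"
  by (intro measurable_restrict_space1) measurable

text \<open>Exponent at most \<open>k\<close> means r < p^(k+1), and the endpoint has no mass. The
  factor p inside \<open>sigma_alpha\<close> absorbs the shift: p / p^(k+1) = p^-k.\<close>

lemma emeasure_radius_law_atMost:
  "emeasure (radius_law p \<alpha>) {..k} = ennreal (exp (- ((real p powi (- k)) powr \<alpha>)))"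
proof -
  let ?\<nu> = "interval_measure (sigma_alpha p \<alpha>)"
  have pos: "real p powi (k + 1) > 0"
    using p by simp
  have "(\<lambda>r. \<lfloor>log p r\<rfloor>) -` {..k} \<inter> {0<..} = {0<..<real p powi (k + 1)}"
  proof -
    have "\<lfloor>log p r\<rfloor> \<le> k \<longleftrightarrow> r < real p powi (k + 1)" if "r > 0" for r
    proof -
      have "\<lfloor>log p r\<rfloor> \<le> k \<longleftrightarrow> log p r < real_of_int (k + 1)"
        by (simp add: floor_le_iff)
      also have "\<dots> \<longleftrightarrow> r < real p powr real_of_int (k + 1)"
        using p that by (subst log_less_iff) auto
      also have "real p powr real_of_int (k + 1) = real p powi (k + 1)"
        using p by (subst powr_real_of_int') auto
      finally show ?thesis .
    qed
    then show ?thesis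
      by auto
  qed
  then have "emeasure (radius_law p \<alpha>) {..k} = emeasure ?\<nu> {0<..<real p powi (k + 1)}"
    unfolding radius_law_def
    by (subst emeasure_distr[OF measurable_floor_log]) (simp_all add: space_restrict_space emeasure_restrict_space subset_eq)
  also have "\<dots> = emeasure ?\<nu> ({0<..<real p powi (k + 1)} \<union> {real p powi (k + 1)})"
    by (rule emeasure_Un_null_set[symmetric]) (auto simp: null_sets_def emeasure_sigma_alpha_singleton)
  also have "{0<..<real p powi (k + 1)} \<union> {real p powi (k + 1)} = {0<..real p powi (k + 1)}"
    using pos by auto
  also have "emeasure ?\<nu> \<dots> = ennreal (sigma_alpha p \<alpha> (real p powi (k + 1)))"
    using pos by (intro emeasure_sigma_alpha_Ioc) simp
  also have "real p / real p powi (k + 1) = real p powi (- k)"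
    using p by (simp add: power_int_add power_int_minus divide_simps)
  then have "sigma_alpha p \<alpha> (real p powi (k + 1)) = exp (- ((real p powi (- k)) powr \<alpha>))"
    using pos by (simp add: sigma_alpha_def)
  finally show ?thesis .
qed

lemma emeasure_radius_law_le: "emeasure (radius_law p \<alpha>) UNIV \<le> 1"
proof -
  have "x \<in> (\<Union>n. {..int n})" for x
    by (rule UN_I[of "nat x"]) auto
  then have "(\<Union>n. {..int n}) = UNIV"
    by blast
  moreover have "(SUP n. emeasure (radius_law p \<alpha>) {..int n}) = emeasure (radius_law p \<alpha>) (\<Union>n. {..int n})"
    by (rule SUP_emeasure_incseq) (auto intro!: incseq_SucI)
  moreover have "(SUP n. emeasure (radius_law p \<alpha>) {..int n}) \<le> 1"
    unfolding emeasure_radius_law_atMost by (intro SUP_least) (simp only: ennreal_le_1 exp_le_one_iff, simp)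
  ultimately show ?thesis
    by simp
qed

interpretation finite_measure "radius_law p \<alpha>"
proof (rule finite_measureI)
  have "emeasure (radius_law p \<alpha>) UNIV < \<infinity>"
    using emeasure_radius_law_le by (rule order_le_less_trans) simp
  then show "emeasure (radius_law p \<alpha>) (space (radius_law p \<alpha>)) \<noteq> \<infinity>"
    unfolding space_radius_law by simp
qed

lemma finite_measure_radius_law: "finite_measure (radius_law p \<alpha>)"
  by (rule finite_measure_axioms)

text \<open>The exponential beats every power of p^n.\<close>

lemma summable_radius_weights: "summable (\<lambda>n. real p ^ n * exp (- ((real p ^ n) powr \<alpha>)))"
proof -
  \<comment> \<open>With alpha m \<ge> 2 the \<open>m\<close>-th power of t = (p^n)^alpha is at
    least p^(2n). Once t^m < exp t, the term is at most p^-n.\<close>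
  obtain m :: nat where m: "2 / \<alpha> < real m"
    using reals_Archimedean2 by blast
  then have m': "2 \<le> \<alpha> * real m"
    using \<alpha> by (simp add: field_simps)
  let ?t = "\<lambda>n. (real p ^ n) powr \<alpha>"
  have t: "?t n = (real p powr \<alpha>) ^ n" for n
  proof -
    have "?t n = (real p powr real n) powr \<alpha>"
      using p by (subst powr_realpow) auto
    also have "\<dots> = (real p powr \<alpha>) powr real n"
      by (simp only: powr_powr mult.commute)
    also have "\<dots> = (real p powr \<alpha>) ^ n"
      using p by (subst powr_realpow) auto
    finally show ?thesis .
  qed
  have "real p powr \<alpha> > 1"
    using p \<alpha> by (intro gr_one_powr) auto
  then have "filterlim ?t at_top sequentially"
    unfolding t
    by (intro filterlim_at_infinity_imp_filterlim_at_top filterlim_realpow_sequentially_gt1)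
      (use p in \<open>auto intro!: always_eventually zero_less_power\<close>)
  then have "(\<lambda>n. ?t n ^ m / exp (?t n)) \<longlonglongrightarrow> 0"
    by (rule filterlim_compose[OF tendsto_power_div_exp_0])
  then have "\<forall>\<^sub>F n in sequentially. ?t n ^ m / exp (?t n) < 1"
    by (rule order_tendstoD) simp
  then have "\<forall>\<^sub>F n in sequentially. norm (real p ^ n * exp (- ?t n)) \<le> inverse (real p) ^ n"
  proof eventually_elim
    case (elim n)
    have "real p ^ n \<ge> 1"
      using p by simp
    have "(real p ^ n)\<^sup>2 = (real p ^ n) powr 2"
      using p by simp
    also have "\<dots> \<le> (real p ^ n) powr (\<alpha> * real m)"
      using m' p by (intro powr_mono) auto
    also have "\<dots> = ?t n ^ m"
      using p by (subst powr_realpow[symmetric]) (simp_all add: powr_powr)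
    also have "\<dots> < exp (?t n)"
      using elim by simp
    finally have "real p ^ n * (real p ^ n * exp (- ?t n)) \<le> 1"
      by (simp add: exp_minus divide_simps power2_eq_square)
    then show ?case
      using p by (simp add: power_inverse divide_simps mult.commute)
  qed
  moreover have "summable (\<lambda>n. inverse (real p) ^ n)"
    using p by (intro summable_geometric) (simp add: inverse_eq_divide)
  ultimately show ?thesis
    by (rule summable_comparison_test_ev)
qed

text \<open>Pays for the growth of the pointwise bound on averages over small balls: the law of the
  radius gives them doubly exponentially small mass.\<close>

lemma integrable_radius_law: "integrable (radius_law p \<alpha>) (\<lambda>j. real p powi (- j))"
proof (rule integrableI_bounded)
  let ?\<rho> = "radius_law p \<alpha>"
  \<comment> \<open>For negative \<open>j\<close> the single term n = -j already equals the left
    side; for the other \<open>j\<close> the summand 1 suffices.\<close>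
  have "ennreal (norm (real p powi (- j))) \<le> 1 + (\<Sum>n. ennreal (real p ^ n) * indicator {..- int n} j)" for j
  proof (cases "j \<ge> 0")
    case True
    then have "real p powi (- j) \<le> real p powi 0"
      using p by (intro power_int_increasing) auto
    then have "ennreal (norm (real p powi (- j))) \<le> 1"
      by (simp add: ennreal_le_1)
    also have "1 \<le> 1 + (\<Sum>n. ennreal (real p ^ n) * indicator {..- int n} j)"
      by simp
    finally show ?thesis .
  next
    case False
    define a where "a n = ennreal (real p ^ n) * indicator {..- int n} j" for n
    have "a (nat (- j)) = ennreal (norm (real p powi (- j)))"
      using False by (simp add: a_def power_int_def)
    moreover have "a (nat (- j)) \<le> suminf a"
      using sum_le_suminf[of a "{nat (- j)}"] by simp
    ultimately have "ennreal (norm (real p powi (- j))) \<le> 0 + suminf a"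
      by (metis add_0)
    also have "\<dots> \<le> 1 + suminf a"
      by (intro add_right_mono) simp
    finally show ?thesis
      unfolding a_def .
  qed
  then have "(\<integral>\<^sup>+ j. ennreal (norm (real p powi (- j))) \<partial>?\<rho>)
      \<le> (\<integral>\<^sup>+ j. 1 + (\<Sum>n. ennreal (real p ^ n) * indicator {..- int n} j) \<partial>?\<rho>)"
    by (intro nn_integral_mono)
  also have "\<dots> = (\<integral>\<^sup>+ j. 1 \<partial>?\<rho>) + (\<integral>\<^sup>+ j. (\<Sum>n. ennreal (real p ^ n) * indicator {..- int n} j) \<partial>?\<rho>)"
    by (rule nn_integral_add) simp_all
  also have "(\<integral>\<^sup>+ j. (\<Sum>n. ennreal (real p ^ n) * indicator {..- int n} j) \<partial>?\<rho>)
      = (\<Sum>n. \<integral>\<^sup>+ j. ennreal (real p ^ n) * indicator {..- int n} j \<partial>?\<rho>)"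
    by (rule nn_integral_suminf) simp
  also have "\<dots> = (\<Sum>n. ennreal (real p ^ n * exp (- ((real p ^ n) powr \<alpha>))))"
  proof (intro suminf_cong)
    fix n
    have "(\<integral>\<^sup>+ j. ennreal (real p ^ n) * indicator {..- int n} j \<partial>?\<rho>)
        = ennreal (real p ^ n) * emeasure ?\<rho> {..- int n}"
      by (rule nn_integral_cmult_indicator) simp
    also have "\<dots> = ennreal (real p ^ n * exp (- ((real p ^ n) powr \<alpha>)))"
      unfolding emeasure_radius_law_atMost by (simp add: ennreal_mult del: ennreal_power)
    finally show "(\<integral>\<^sup>+ j. ennreal (real p ^ n) * indicator {..- int n} j \<partial>?\<rho>)
        = ennreal (real p ^ n * exp (- ((real p ^ n) powr \<alpha>)))" .
  qed
  also have "(\<integral>\<^sup>+ j. 1 \<partial>?\<rho>) + \<dots> < \<infinity>"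
    unfolding infinity_ennreal_def ennreal_add_less_top
  proof
    show "(\<integral>\<^sup>+ j. 1 \<partial>?\<rho>) < top"
      using emeasure_radius_law_le by (simp add: order_le_less_trans[OF _ ennreal_one_less_top])
    show "(\<Sum>n. ennreal (real p ^ n * exp (- ((real p ^ n) powr \<alpha>)))) < top"
      unfolding less_top[symmetric] by (rule ennreal_suminf_neq_top[OF summable_radius_weights]) simp
  qed
  finally show "(\<integral>\<^sup>+ j. ennreal (norm (real p powi (- j))) \<partial>?\<rho>) < \<infinity>" .
qed simp

end

section \<open>Action of the Markov operator on L^2\<close>

locale padic_radius_law = padic_haar_measure \<mu> for \<mu> :: "'p :: prime_card padic measure" +
  fixes \<alpha> :: real
  assumes \<alpha>: "\<alpha> > 0"
begin

abbreviation "P \<equiv> isotropic_markov \<mu> (sigma_alpha CARD('p) \<alpha>)"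

lemma card_Suc: "CARD('p) > 1"
  using card_gt_1[where 'p = 'p] by simp

sublocale rho: finite_measure "radius_law CARD('p) \<alpha>"
  by (rule finite_measure_radius_law[OF card_Suc \<alpha>])

lemma emeasure_radius_law_less_top: "emeasure (radius_law CARD('p) \<alpha>) A < top"
  using rho.emeasure_finite[of A] unfolding infinity_ennreal_def less_top .

sublocale pair_rho: pair_sigma_finite \<mu> "radius_law CARD('p) \<alpha>" ..

lemma isotropic_markov_eq: "P f x = (LINT j|radius_law CARD('p) \<alpha>. Q j f x)"
proof -
  let ?\<nu> = "interval_measure (sigma_alpha CARD('p) \<alpha>)"
  have "P f x = (LINT r|?\<nu>. indicator {0<..} r *\<^sub>R Q \<lfloor>log CARD('p) r\<rfloor> f x)"
    unfolding isotropic_markov_def set_lebesgue_integral_def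
  proof (rule integral_cong_AE)
    have [measurable]: "(\<lambda>r. Q \<lfloor>log CARD('p) r\<rfloor> f x) \<in> borel_measurable borel"
      by (rule measurable_compose[of _ _ "count_space UNIV"]) measurable
    show meas: "(\<lambda>r. indicator {0<..} r *\<^sub>R Q \<lfloor>log CARD('p) r\<rfloor> f x) \<in> borel_measurable ?\<nu>"
      by measurable
    \<comment> \<open>The contribution of r = 0, where the ball is a point, is split off as a
      separate term and never evaluated, since {0} is a null set.\<close>
    have eq: "indicator {0..} r *\<^sub>R ball_average \<mu> r f x
        = indicator {0<..} r *\<^sub>R Q \<lfloor>log CARD('p) r\<rfloor> f x + indicator {0} r *\<^sub>R ball_average \<mu> 0 f x" for r
    proof -
      consider "r < 0" | "r = 0" | "r > 0"
        by linarith
      then show ?thesis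
      proof cases
        case 3
        have "ball_average \<mu> r f x = ball_average \<mu> (real CARD('p) powi \<lfloor>log CARD('p) r\<rfloor>) f x"
          unfolding ball_average_def cball_padic_floor[OF 3] ..
        then show ?thesis
          using 3 by (simp add: Q_eq_ball_average)
      qed simp_all
    qed
    show "(\<lambda>r. indicator {0..} r *\<^sub>R ball_average \<mu> r f x) \<in> borel_measurable ?\<nu>"
      unfolding eq using meas by measurable
    have "AE r in ?\<nu>. r \<noteq> 0"
      using emeasure_sigma_alpha_singleton[OF card_Suc \<alpha>, of 0] by (intro AE_I[of _ _ "{0}"]) auto
    then show "AE r in ?\<nu>. indicator {0..} r *\<^sub>R ball_average \<mu> r f x
        = indicator {0<..} r *\<^sub>R Q \<lfloor>log CARD('p) r\<rfloor> f x"
      by eventually_elim (simp add: eq)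
  qed
  also have "\<dots> = (LINT r|restrict_space ?\<nu> {0<..}. Q \<lfloor>log CARD('p) r\<rfloor> f x)"
    by (rule integral_restrict_space[symmetric]) simp
  also have "\<dots> = (LINT j|radius_law CARD('p) \<alpha>. Q j f x)"
    unfolding radius_law_def
    by (rule integral_distr[symmetric, OF measurable_floor_log[OF card_Suc \<alpha>]]) simp
  finally show ?thesis .
qed

text \<open>Viewed as a function of the level, the averages at a fixed point are square integrable.
  Cauchy-Schwarz over the radii then bounds \<open>P\<close> pointwise.\<close>

lemma Q_L2_radius: "f \<in> L2 \<mu> \<Longrightarrow> (\<lambda>j. Q j f x) \<in> L2 (radius_law CARD('p) \<alpha>)"
  using norm_Q_le[of f _ x] integrable_radius_law[OF card_Suc \<alpha>]
  by (intro L2_I[of _ _ "\<lambda>j. norm_sq_L2 \<mu> f * real CARD('p) powi (- j)"])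
    (simp_all add: power_int_minus divide_inverse)

lemma one_L2_radius: "(\<lambda>j. 1) \<in> L2 (radius_law CARD('p) \<alpha>)"
  by (simp add: L2_def)

lemma integrable_Q_radius:
  assumes "f \<in> L2 \<mu>"
  shows "integrable (radius_law CARD('p) \<alpha>) (\<lambda>j. Q j f x)"
  using L2_integrable_mult[OF Q_L2_radius[OF assms] one_L2_radius] by simp

text \<open>There are countably many levels, so measurability at each fixed level is enough.\<close>

lemma measurable_Q_pair [measurable]:
  "(\<lambda>z. Q (snd z) f (fst z)) \<in> borel_measurable (\<mu> \<Otimes>\<^sub>M (radius_law CARD('p) \<alpha>))"
proof (rule measurable_compose_countable[of "\<lambda>j z. Q j f (fst z)"])
  have "Q j f \<in> borel_measurable \<mu>" for j
    using borel_measurable_Q by simp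
  then show "(\<lambda>z. Q j f (fst z)) \<in> borel_measurable (\<mu> \<Otimes>\<^sub>M (radius_law CARD('p) \<alpha>))" for j
    by (rule measurable_compose[OF measurable_fst])
qed measurable

lemma borel_measurable_P: "P f \<in> borel_measurable \<mu>"
proof -
  have "(\<lambda>x. LINT j|radius_law CARD('p) \<alpha>. Q j f x) \<in> borel_measurable \<mu>"
    by (intro rho.borel_measurable_lebesgue_integral) (use measurable_Q_pair in \<open>simp add: case_prod_unfold\<close>)
  then show ?thesis
    by (simp add: isotropic_markov_eq[abs_def])
qed

text \<open>Cauchy-Schwarz over the radii, then Tonelli, then the contraction property at each
  radius.\<close>

lemma P_L2:
  assumes f: "f \<in> L2 \<mu>"
  shows "P f \<in> L2 \<mu>"
proof (rule L2_I_nn_integral[OF borel_measurable_P])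
  let ?c = "norm_sq_L2 (radius_law CARD('p) \<alpha>) (\<lambda>j. 1)"
  have [measurable]: "(\<lambda>z. ennreal ((cmod (Q (snd z) f (fst z)))\<^sup>2)) \<in> borel_measurable (\<mu> \<Otimes>\<^sub>M (radius_law CARD('p) \<alpha>))"
    by measurable
  have "ennreal ((cmod (P f x))\<^sup>2) \<le> ennreal ?c * (\<integral>\<^sup>+ j. ennreal ((cmod (Q j f x))\<^sup>2) \<partial>radius_law CARD('p) \<alpha>)" for x
  proof -
    have "P f x = inner_L2 (radius_law CARD('p) \<alpha>) (\<lambda>j. Q j f x) (\<lambda>j. 1)"
      by (simp add: isotropic_markov_eq inner_L2_def)
    then have "(cmod (P f x))\<^sup>2 \<le> ?c * norm_sq_L2 (radius_law CARD('p) \<alpha>) (\<lambda>j. Q j f x)"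
      using Cauchy_Schwarz_L2[OF Q_L2_radius[OF f] one_L2_radius, of x] by (simp add: mult.commute)
    then have "ennreal ((cmod (P f x))\<^sup>2) \<le> ennreal (?c * norm_sq_L2 (radius_law CARD('p) \<alpha>) (\<lambda>j. Q j f x))"
      by (rule ennreal_leI)
    also have "\<dots> = ennreal ?c * ennreal (norm_sq_L2 (radius_law CARD('p) \<alpha>) (\<lambda>j. Q j f x))"
      by (intro ennreal_mult norm_sq_L2_nonneg)
    finally show ?thesis
      unfolding nn_integral_L2[OF Q_L2_radius[OF f, of x]] .
  qed
  then have "(\<integral>\<^sup>+ x. ennreal ((cmod (P f x))\<^sup>2) \<partial>\<mu>)
      \<le> (\<integral>\<^sup>+ x. ennreal ?c * (\<integral>\<^sup>+ j. ennreal ((cmod (Q j f x))\<^sup>2) \<partial>radius_law CARD('p) \<alpha>) \<partial>\<mu>)"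
    by (intro nn_integral_mono)
  also have "\<dots> = ennreal ?c * (\<integral>\<^sup>+ x. \<integral>\<^sup>+ j. ennreal ((cmod (Q j f x))\<^sup>2) \<partial>radius_law CARD('p) \<alpha> \<partial>\<mu>)"
    by (intro nn_integral_cmult rho.borel_measurable_nn_integral) (simp add: case_prod_unfold)
  also have "(\<integral>\<^sup>+ x. \<integral>\<^sup>+ j. ennreal ((cmod (Q j f x))\<^sup>2) \<partial>radius_law CARD('p) \<alpha> \<partial>\<mu>)
      = (\<integral>\<^sup>+ j. \<integral>\<^sup>+ x. ennreal ((cmod (Q j f x))\<^sup>2) \<partial>\<mu> \<partial>radius_law CARD('p) \<alpha>)"
    by (rule pair_rho.Fubini'[symmetric]) (simp add: case_prod_unfold)
  also have "\<dots> \<le> (\<integral>\<^sup>+ j. ennreal (norm_sq_L2 \<mu> f) \<partial>radius_law CARD('p) \<alpha>)"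
    using f by (intro nn_integral_mono nn_integral_Q_le)
  also have "\<dots> = ennreal (norm_sq_L2 \<mu> f) * emeasure (radius_law CARD('p) \<alpha>) UNIV"
    by simp
  finally have "(\<integral>\<^sup>+ x. ennreal ((cmod (P f x))\<^sup>2) \<partial>\<mu>)
      \<le> ennreal ?c * (ennreal (norm_sq_L2 \<mu> f) * emeasure (radius_law CARD('p) \<alpha>) UNIV)"
    by (simp add: mult_left_mono)
  also have "\<dots> < \<infinity>"
    by (simp add: ennreal_mult_less_top emeasure_radius_law_less_top)
  finally show "(\<integral>\<^sup>+ x. ennreal ((cmod (P f x))\<^sup>2) \<partial>\<mu>) < \<infinity>" .
qed

text \<open>Fubini over a ball of finite measure and the radii, dominated by
  \<open>norm_Q_le\<close> in the form |t| \<le> t^2 + 1; afterwards the two averages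
  commute.\<close>

lemma Q_P:
  assumes f: "f \<in> L2 \<mu>"
  shows "Q k (P f) x = (LINT j|radius_law CARD('p) \<alpha>. Q j (Q k f) x)"
proof -
  let ?r = "real CARD('p) powi k"
  let ?K = "\<lambda>y j. if dist x y \<le> ?r then Q j f y else 0"
  have [measurable]: "(\<lambda>z. ?K (fst z) (snd z)) \<in> borel_measurable (\<mu> \<Otimes>\<^sub>M (radius_law CARD('p) \<alpha>))"
    by measurable
  have "integrable (\<mu> \<Otimes>\<^sub>M (radius_law CARD('p) \<alpha>)) (\<lambda>(y, j). ?K y j)"
  proof (rule integrableI_bounded)
    define C where "C = (LINT j|radius_law CARD('p) \<alpha>. norm_sq_L2 \<mu> f * real CARD('p) powi (- j) + 1)"
    have "integrable (radius_law CARD('p) \<alpha>) (\<lambda>j. norm_sq_L2 \<mu> f * real CARD('p) powi (- j) + 1)"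
      using integrable_radius_law[OF card_Suc \<alpha>] by simp
    then have C: "(\<integral>\<^sup>+ j. ennreal (norm_sq_L2 \<mu> f * real CARD('p) powi (- j) + 1) \<partial>radius_law CARD('p) \<alpha>) = ennreal C"
      unfolding C_def by (rule nn_integral_eq_integral) (simp add: norm_sq_L2_nonneg)
    have le: "cmod (Q j f y) \<le> norm_sq_L2 \<mu> f * real CARD('p) powi (- j) + 1" for j y
      using norm_Q_le[OF f, of j y] mult_le_sum_squares[of "cmod (Q j f y)" 1]
      by (simp add: power_int_minus divide_inverse)
    have "(\<integral>\<^sup>+ z. ennreal (norm (case z of (y, j) \<Rightarrow> ?K y j)) \<partial>(\<mu> \<Otimes>\<^sub>M (radius_law CARD('p) \<alpha>)))
        = (\<integral>\<^sup>+ y. \<integral>\<^sup>+ j. ennreal (norm (?K y j)) \<partial>radius_law CARD('p) \<alpha> \<partial>\<mu>)"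
      by (subst rho.nn_integral_fst[symmetric]) (simp_all add: case_prod_unfold cong: if_cong)
    also have "\<dots> \<le> (\<integral>\<^sup>+ y. ennreal C * indicator (cball x ?r) y \<partial>\<mu>)"
    proof (intro nn_integral_mono)
      fix y
      have "(\<integral>\<^sup>+ j. ennreal (norm (?K y j)) \<partial>radius_law CARD('p) \<alpha>)
          \<le> (\<integral>\<^sup>+ j. ennreal (norm_sq_L2 \<mu> f * real CARD('p) powi (- j) + 1) * indicator (cball x ?r) y \<partial>radius_law CARD('p) \<alpha>)"
        using le by (intro nn_integral_mono) (auto simp: indicator_def intro!: ennreal_leI)
      also have "\<dots> = ennreal C * indicator (cball x ?r) y"
        by (subst nn_integral_multc) (simp_all add: C)
      finally show "(\<integral>\<^sup>+ j. ennreal (norm (?K y j)) \<partial>radius_law CARD('p) \<alpha>) \<le> ennreal C * indicator (cball x ?r) y" .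
    qed
    also have "\<dots> = ennreal C * ennreal ?r"
      by (subst nn_integral_cmult_indicator) (simp_all only: emeasure_cball sets_haar borel_closed closed_cball)
    also have "\<dots> < \<infinity>"
      by (simp add: ennreal_mult_less_top)
    finally show "(\<integral>\<^sup>+ z. ennreal (norm (case z of (y, j) \<Rightarrow> ?K y j)) \<partial>(\<mu> \<Otimes>\<^sub>M (radius_law CARD('p) \<alpha>))) < \<infinity>" .
  qed (simp add: case_prod_unfold)
  then have "(LINT j|radius_law CARD('p) \<alpha>. (LINT y|\<mu>. ?K y j)) = (LINT y|\<mu>. (LINT j|radius_law CARD('p) \<alpha>. ?K y j))"
    by (rule pair_rho.Fubini_integral)
  moreover have "(LINT j|radius_law CARD('p) \<alpha>. ?K y j) = (if dist x y \<le> ?r then P f y else 0)" for y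
    by (simp add: isotropic_markov_eq)
  ultimately have "Q k (P f) x = (LINT j|radius_law CARD('p) \<alpha>. (LINT y|\<mu>. ?K y j)) / of_real ?r"
    by (simp add: Q_def[of k "P f"])
  also have "\<dots> = (LINT j|radius_law CARD('p) \<alpha>. Q k (Q j f) x)"
    unfolding Q_def[of k "Q _ f"] by (rule integral_divide_zero[symmetric])
  also have "\<dots> = (LINT j|radius_law CARD('p) \<alpha>. Q j (Q k f) x)"
    using f by (simp add: Q_Q max.commute)
  finally show ?thesis .
qed

text \<open>An average of level \<open>j\<close> fixes the range of \<open>D k\<close> when j \<le>
  k and kills it otherwise, so the eigenvalue is the mass that the law of the exponent gives to
  {..k}.\<close>

lemma D_P:
  assumes f: "f \<in> L2 \<mu>"
  shows "D k (P f) x = of_real (exp (- ((real CARD('p) powi (- k)) powr \<alpha>))) * D k f x"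
proof -
  have "D k (P f) x = (LINT j|radius_law CARD('p) \<alpha>. Q j (Q k f) x - Q j (Q (k + 1) f) x)"
    unfolding D_def Q_P[OF f] using f
    by (intro Bochner_Integration.integral_diff[symmetric] integrable_Q_radius Q_L2)
  also have "\<dots> = (LINT j|radius_law CARD('p) \<alpha>. indicator {..k} j *\<^sub>R D k f x)"
  proof (intro Bochner_Integration.integral_cong refl)
    fix j
    have "Q j (Q k f) x - Q j (Q (k + 1) f) x = Q j (D k f) x"
      unfolding D_abs_def using f by (simp add: Q_diff Q_L2)
    then show "Q j (Q k f) x - Q j (Q (k + 1) f) x = indicator {..k} j *\<^sub>R D k f x"
      using f by (simp add: Q_D)
  qed
  also have "\<dots> = measure (radius_law CARD('p) \<alpha>) {..k} *\<^sub>R D k f x"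
    by (subst integral_scaleR_left)
      (auto intro!: integrable_real_indicator simp: emeasure_radius_law_less_top)
  also have "measure (radius_law CARD('p) \<alpha>) {..k} = exp (- ((real CARD('p) powi (- k)) powr \<alpha>))"
    unfolding measure_def emeasure_radius_law_atMost[OF card_Suc \<alpha>] by simp
  finally show ?thesis
    by (simp add: scaleR_conv_of_real)
qed

theorem isotropic_laplacianI:
  assumes f: "f \<in> L2 \<mu>" and h: "h \<in> L2 \<mu>"
    and D_h: "\<And>k x. D k h x = of_real ((real CARD('p) powi (- k)) powr \<alpha>) * D k f x"
  shows "(f, h) \<in> isotropic_laplacian \<mu> (sigma_alpha CARD('p) \<alpha>)"
  unfolding isotropic_laplacian_def
  by (rule log_inverse_operatorI
      [where \<Lambda> = "\<lambda>n. exp (- ((real CARD('p) powi (- int_decode n)) powr \<alpha>))", OF P_L2 _ _ f h])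
    (auto simp: D_P D_h ln_div)

end

section \<open>Test functions\<close>

text \<open>A Lebesgue number of a cover of the compact support by open sets of constancy. If
  neither point lies in the support both values are 0; if one does, the roles are symmetric.\<close>

lemma test_functions_uniformly_locally_constant:
  fixes f :: "'p :: prime_card padic \<Rightarrow> complex"
  assumes "f \<in> test_functions"
  shows "\<exists>m. \<forall>x y. dist x y \<le> real CARD('p) powi m \<longrightarrow> f x = f y"
proof -
  let ?K = "closure {x. f x \<noteq> 0}"
  let ?\<G> = "{U. open U \<and> (\<forall>x\<in>U. \<forall>y\<in>U. f x = f y)}"
  have K: "compact ?K" and lc: "locally_constant f"
    using assms by (auto simp: test_functions_def)
  have cover: "?K \<subseteq> \<Union> ?\<G>"
  proof
    fix x
    obtain U where "open U" "x \<in> U" and U: "\<forall>y\<in>U. f y = f x"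
      using lc unfolding locally_constant_def by blast
    have "\<forall>y\<in>U. \<forall>z\<in>U. f y = f z"
      by (intro ballI) (simp only: bspec[OF U])
    with \<open>open U\<close> have "U \<in> ?\<G>"
      by (intro CollectI conjI)
    with \<open>x \<in> U\<close> show "x \<in> \<Union> ?\<G>"
      by blast
  qed
  have "\<exists>e>0. \<forall>x\<in>?K. \<exists>U\<in>?\<G>. ball x e \<subseteq> U"
  proof (rule Heine_Borel_lemma[OF K cover])
    show "open U" if "U \<in> ?\<G>" for U
      using that unfolding mem_Collect_eq by (rule conjunct1)
  next
    fix e :: real
    assume "0 < e" "\<And>x. x \<in> ?K \<Longrightarrow> \<exists>U\<in>?\<G>. ball x e \<subseteq> U"
    then show "\<exists>e>0. \<forall>x\<in>?K. \<exists>U\<in>?\<G>. ball x e \<subseteq> U"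
      by (intro exI[of _ e] conjI ballI)
  qed
  then obtain e where e: "e > 0" and ball: "\<forall>x\<in>?K. \<exists>U\<in>?\<G>. ball x e \<subseteq> U"
    by (elim exE conjE)
  obtain m where m: "real CARD('p) powi m < e"
    using e by (rule card_powi_small)
  have K_const: "f x = f y" if x: "x \<in> ?K" and xy: "dist x y \<le> real CARD('p) powi m" for x y
  proof -
    obtain U where U: "U \<in> ?\<G>" "ball x e \<subseteq> U"
      using bspec[OF ball x] by (elim bexE)
    have xU: "x \<in> U" and yU: "y \<in> U"
      using subsetD[OF U(2), of x] subsetD[OF U(2), of y] xy m e by simp_all
    have "\<forall>x\<in>U. \<forall>y\<in>U. f x = f y"
      using U(1) unfolding mem_Collect_eq by (rule conjunct2)
    from bspec[OF bspec[OF this xU] yU] show ?thesis .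
  qed
  have "f x = f y" if xy: "dist x y \<le> real CARD('p) powi m" for x y
  proof -
    have out: "f z = 0" if "z \<notin> ?K" for z
      using subsetD[OF closure_subset, of z "{x. f x \<noteq> 0}"] that by auto
    consider "x \<in> ?K" | "y \<in> ?K" | "x \<notin> ?K" "y \<notin> ?K"
      by blast
    then show ?thesis
    proof cases
      case 1
      then show ?thesis
        using xy by (rule K_const)
    next
      case 2
      then have "f y = f x"
        using xy by (intro K_const) (simp_all add: dist_commute)
      then show ?thesis
        by simp
    next
      case 3
      then show ?thesis
        using out[of x] out[of y] by simp
    qed
  qed
  then show ?thesis
    by (intro exI[of _ m] allI impI)
qed

lemma test_functions_continuous:
  fixes f :: "'p :: prime_card padic \<Rightarrow> complex"
  assumes "f \<in> test_functions"
  shows "continuous_on UNIV f"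
proof -
  obtain m where m: "\<forall>x y. dist x y \<le> real CARD('p) powi m \<longrightarrow> f x = f y"
    using test_functions_uniformly_locally_constant[OF assms] by (elim exE)
  show ?thesis
    by (rule continuous_on_locally_constant[OF card_powi_pos]) (rule m[rule_format])
qed

lemma test_functions_bounded_support:
  fixes f :: "'p :: prime_card padic \<Rightarrow> complex"
  assumes "f \<in> test_functions"
  shows "\<exists>N. \<forall>x. \<not> dist 0 x \<le> real CARD('p) powi int N \<longrightarrow> f x = 0"
proof -
  have "bounded (closure {x. f x \<noteq> 0})"
    using assms by (intro compact_imp_bounded) (simp add: test_functions_def)
  then obtain r where r: "\<And>x. x \<in> closure {x. f x \<noteq> 0} \<Longrightarrow> dist 0 x \<le> r"
    unfolding bounded_any_center[of _ 0] by blast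
  obtain N where "r < real CARD('p) powi int N"
    by (rule card_powi_large)
  then have "f x = 0" if "\<not> dist 0 x \<le> real CARD('p) powi int N" for x
    using r[of x] closure_subset[of "{x. f x \<noteq> 0}"] that by fastforce
  then show ?thesis
    by (intro exI[of _ N] allI impI)
qed

lemma test_functions_bounded:
  fixes f :: "'p :: prime_card padic \<Rightarrow> complex"
  assumes "f \<in> test_functions"
  shows "\<exists>B. \<forall>x. cmod (f x) \<le> B"
proof -
  let ?K = "closure {x. f x \<noteq> 0}"
  have "compact (f ` ?K)"
    using assms test_functions_continuous[OF assms]
    by (intro compact_continuous_image) (auto simp: test_functions_def intro: continuous_on_subset)
  then obtain B where B: "\<And>y. y \<in> f ` ?K \<Longrightarrow> cmod y \<le> B"
    using compact_imp_bounded bounded_iff by metis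
  have "cmod (f x) \<le> max B 0" for x
  proof (cases "f x = 0")
    case False
    then have "x \<in> ?K"
      using closure_subset[of "{x. f x \<noteq> 0}"] by blast
    then show ?thesis
      using B[of "f x"] by simp
  qed simp
  then show ?thesis
    by (intro exI[of _ "max B 0"] allI)
qed

context padic_haar_measure
begin

lemma integrable_bounded_support:
  fixes f :: "'p padic \<Rightarrow> 'b :: {banach, second_countable_topology}"
  assumes [measurable]: "f \<in> borel_measurable borel"
    and "\<And>x. norm (f x) \<le> B" "\<And>x. \<not> dist 0 x \<le> real CARD('p) powi k \<Longrightarrow> f x = 0"
  shows "integrable \<mu> f"
proof (rule Bochner_Integration.integrable_bound)
  let ?A = "cball 0 (real CARD('p) powi k) :: 'p padic set"
  show "integrable \<mu> (\<lambda>x. B * indicator ?A x)"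
    by (intro integrable_mult_right integrable_real_indicator) (auto simp: emeasure_cball)
  show "AE x in \<mu>. norm (f x) \<le> norm (B * indicator ?A x)"
  proof (intro AE_I2)
    fix x
    show "norm (f x) \<le> norm (B * indicator ?A x)"
      using assms(2)[of x] assms(3)[of x] by (cases "dist 0 x \<le> real CARD('p) powi k") auto
  qed
qed simp

lemma test_functions_borel: "f \<in> test_functions \<Longrightarrow> f \<in> borel_measurable borel" for f :: "'p padic \<Rightarrow> complex"
  by (intro borel_measurable_continuous_onI test_functions_continuous)

lemma test_functions_integrable:
  fixes f :: "'p padic \<Rightarrow> complex"
  assumes f: "f \<in> test_functions"
  shows "integrable \<mu> f"
proof -
  obtain N where N: "\<forall>x. \<not> dist 0 x \<le> real CARD('p) powi int N \<longrightarrow> f x = 0"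
    using test_functions_bounded_support[OF f] by (elim exE)
  obtain B where B: "\<forall>x. cmod (f x) \<le> B"
    using test_functions_bounded[OF f] by (elim exE)
  show ?thesis
    by (rule integrable_bounded_support[OF test_functions_borel[OF f] B[rule_format] N[rule_format]])
qed

lemma L2_of_bounded_integrable:
  assumes "integrable \<mu> f" "\<And>x. cmod (f x) \<le> B"
  shows "f \<in> L2 \<mu>"
proof (rule L2_I)
  show "f \<in> borel_measurable \<mu>" "integrable \<mu> (\<lambda>x. B * cmod (f x))"
    using assms by auto
  show "(cmod (f x))\<^sup>2 \<le> B * cmod (f x)" for x
    unfolding power2_eq_square using assms(2)[of x] by (intro mult_right_mono) auto
qed

lemma test_functions_L2: "f \<in> test_functions \<Longrightarrow> f \<in> L2 \<mu>"
  using test_functions_bounded[of f] by (auto intro: L2_of_bounded_integrable test_functions_integrable)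

section \<open>The Fourier transform\<close>

lemma norm_Q_le_nn_integral:
  assumes [measurable]: "f \<in> borel_measurable borel"
  shows "ennreal (cmod (Q k f x)) \<le> ennreal (1 / real CARD('p) powi k)
    * (\<integral>\<^sup>+ y. (if dist x y \<le> real CARD('p) powi k then ennreal (cmod (f y)) else 0) \<partial>\<mu>)"
proof -
  let ?r = "real CARD('p) powi k" and ?f = "\<lambda>y. if dist x y \<le> real CARD('p) powi k then f y else 0"
  have r: "?r > 0"
    by (rule card_powi_pos)
  have "cmod (Q k f x) = cmod (LINT y|\<mu>. ?f y) / ?r"
    using r by (simp only: Q_def norm_divide norm_of_real abs_of_pos)
  then have "ennreal (cmod (Q k f x)) = ennreal (1 / ?r) * ennreal (cmod (LINT y|\<mu>. ?f y))"
    using r by (simp only: ennreal_mult[symmetric] zero_le_divide_1_iff less_imp_le norm_ge_zero) simp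
  also have "\<dots> \<le> ennreal (1 / ?r) * (\<integral>\<^sup>+ y. ennreal (cmod (?f y)) \<partial>\<mu>)"
  proof (cases "integrable \<mu> ?f")
    case True
    then show ?thesis
      by (intro mult_left_mono integral_norm_bound_ennreal) auto
  next
    \<comment> \<open>The Bochner integral of a non-integrable function is 0, so the bound
      persists.\<close>
    case False
    then show ?thesis
      by (subst not_integrable_integral_eq) simp_all
  qed
  also have "(\<integral>\<^sup>+ y. ennreal (cmod (?f y)) \<partial>\<mu>)
      = (\<integral>\<^sup>+ y. (if dist x y \<le> ?r then ennreal (cmod (f y)) else 0) \<partial>\<mu>)"
    by (intro nn_integral_cong) auto
  finally show ?thesis .
qed

lemma nn_integral_norm_Q_le:
  assumes [measurable]: "f \<in> borel_measurable borel"
  shows "(\<integral>\<^sup>+ x. ennreal (cmod (Q k f x)) \<partial>\<mu>) \<le> (\<integral>\<^sup>+ x. ennreal (cmod (f x)) \<partial>\<mu>)"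
proof -
  let ?r = "real CARD('p) powi k"
  let ?g = "\<lambda>x. \<integral>\<^sup>+ y. (if dist x y \<le> ?r then ennreal (cmod (f y)) else 0) \<partial>\<mu>"
  have "(\<integral>\<^sup>+ x. ennreal (cmod (Q k f x)) \<partial>\<mu>) \<le> (\<integral>\<^sup>+ x. ennreal (1 / ?r) * ?g x \<partial>\<mu>)"
    by (intro nn_integral_mono norm_Q_le_nn_integral assms)
  also have "\<dots> = ennreal (1 / ?r) * (\<integral>\<^sup>+ x. ?g x \<partial>\<mu>)"
    by (intro nn_integral_cmult) measurable
  also have "\<dots> = ennreal (1 / ?r) * (ennreal ?r * (\<integral>\<^sup>+ x. ennreal (cmod (f x)) \<partial>\<mu>))"
    by (subst nn_integral_ball_swap) simp_all
  also have "\<dots> = ennreal (1 / ?r * ?r) * (\<integral>\<^sup>+ x. ennreal (cmod (f x)) \<partial>\<mu>)"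
    by (subst ennreal_mult) (simp_all add: mult.assoc)
  also have "1 / ?r * ?r = 1"
    using card_pos[where 'p = 'p] by simp
  finally show ?thesis
    by simp
qed

lemma integrable_Q:
  assumes f: "integrable \<mu> f"
  shows "integrable \<mu> (Q k f)" "(LINT x|\<mu>. cmod (Q k f x)) \<le> (LINT x|\<mu>. cmod (f x))"
proof -
  have [measurable]: "f \<in> borel_measurable borel"
    using borel_measurable_integrable[OF f] by simp
  have f': "(\<integral>\<^sup>+ x. ennreal (cmod (f x)) \<partial>\<mu>) = ennreal (LINT x|\<mu>. cmod (f x))"
    using f by (intro nn_integral_eq_integral) auto
  have "(\<integral>\<^sup>+ x. ennreal (cmod (Q k f x)) \<partial>\<mu>) < \<infinity>"
    by (rule order_le_less_trans[OF nn_integral_norm_Q_le]) (simp_all add: f')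
  then show Q: "integrable \<mu> (Q k f)"
    by (intro integrableI_bounded) simp_all
  have "ennreal (LINT x|\<mu>. cmod (Q k f x)) = (\<integral>\<^sup>+ x. ennreal (cmod (Q k f x)) \<partial>\<mu>)"
    using Q by (intro nn_integral_eq_integral[symmetric]) auto
  also have "\<dots> \<le> ennreal (LINT x|\<mu>. cmod (f x))"
    unfolding f'[symmetric] by (rule nn_integral_norm_Q_le) simp
  finally show "(LINT x|\<mu>. cmod (Q k f x)) \<le> (LINT x|\<mu>. cmod (f x))"
    by (subst (asm) ennreal_le_iff) simp_all
qed

lemma norm_Q_le_bound:
  assumes [measurable]: "f \<in> borel_measurable borel" and B: "\<And>x. cmod (f x) \<le> B"
  shows "cmod (Q k f x) \<le> B"
proof -
  let ?r = "real CARD('p) powi k"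
  have B0: "B \<ge> 0"
    using B[of x] norm_ge_zero order_trans by blast
  have "ennreal (cmod (Q k f x)) \<le> ennreal (1 / ?r)
      * (\<integral>\<^sup>+ y. (if dist x y \<le> ?r then ennreal (cmod (f y)) else 0) \<partial>\<mu>)"
    by (rule norm_Q_le_nn_integral) simp
  also have "\<dots> \<le> ennreal (1 / ?r) * (\<integral>\<^sup>+ y. ennreal B * indicator (cball x ?r) y \<partial>\<mu>)"
    by (intro mult_left_mono nn_integral_mono) (auto intro!: ennreal_leI B)
  also have "(\<integral>\<^sup>+ y. ennreal B * indicator (cball x ?r) y \<partial>\<mu>) = ennreal B * ennreal ?r"
    by (subst nn_integral_cmult_indicator) (simp_all only: emeasure_cball sets_haar borel_closed closed_cball)
  also have "ennreal (1 / ?r) * (ennreal B * ennreal ?r) = ennreal (1 / ?r * (B * ?r))"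
    using B0 card_powi_pos[where 'p = 'p, of k]
    by (simp only: ennreal_mult zero_le_divide_1_iff less_imp_le mult_nonneg_nonneg)
  also have "1 / ?r * (B * ?r) = B"
    using card_pos[where 'p = 'p] by simp
  finally show ?thesis
    using B0 by (subst (asm) ennreal_le_iff)
qed

section \<open>Fourier transforms of averages and injectivity\<close>

lemma measurable_padic_char_mult [measurable]: "(\<lambda>x :: 'p padic. padic_char (x * \<xi>)) \<in> borel_measurable borel"
proof (rule borel_measurable_continuous_onI, rule continuous_on_locally_constant)
  let ?d = "1 / (padic_norm \<xi> + 1)"
  show "?d > 0"
    using padic_norm_nonneg[of \<xi>] by simp
  fix x y :: "'p padic"
  assume "dist x y \<le> ?d"
  then have "dist x y * (padic_norm \<xi> + 1) \<le> 1"
    using padic_norm_nonneg[of \<xi>] by (simp add: field_simps)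
  moreover have "dist (x * \<xi>) (y * \<xi>) = dist x y * padic_norm \<xi>"
    by (simp add: dist_padic_def padic_norm_mult flip: left_diff_distrib)
  ultimately have "dist (x * \<xi>) (y * \<xi>) \<le> 1"
    using zero_le_dist[of x y] unfolding distrib_left mult_1_right by linarith
  then show "padic_char (x * \<xi>) = padic_char (y * \<xi>)"
    by (rule padic_char_locally_constant)
qed

text \<open>On the dual ball the character is constant on the ball of averaging. Otherwise a
  translation preserving that ball multiplies the integral by a factor different from 1, which
  forces it to be 0.\<close>

lemma Q_char:
  "Q k (\<lambda>x. padic_char (x * \<xi>)) x = (if padic_norm \<xi> \<le> real CARD('p) powi (- k) then padic_char (x * \<xi>) else 0)"
proof (cases "padic_norm \<xi> \<le> real CARD('p) powi (- k)")
  case True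
  have "padic_char (y * \<xi>) = padic_char (x * \<xi>)" if "dist x y \<le> real CARD('p) powi k" for y
  proof (rule padic_char_locally_constant)
    have "dist (y * \<xi>) (x * \<xi>) = dist y x * padic_norm \<xi>"
      by (simp add: dist_padic_def padic_norm_mult flip: left_diff_distrib)
    also have "\<dots> \<le> real CARD('p) powi k * real CARD('p) powi (- k)"
      using that True padic_norm_nonneg by (intro mult_mono) (auto simp: dist_commute)
    also have "\<dots> = 1"
      by (simp flip: card_powi_add)
    finally show "dist (y * \<xi>) (x * \<xi>) \<le> 1" .
  qed
  then have "Q k (\<lambda>x. padic_char (x * \<xi>)) x = padic_char (x * \<xi>)"
    by (rule Q_const)
  then show ?thesis
    using True by simp
next
  case False
  let ?r = "real CARD('p) powi k" and ?P = "of_nat CARD('p) :: 'p padic"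
  let ?g = "\<lambda>y. if dist x y \<le> ?r then padic_char (y * \<xi>) else 0"
  \<comment> \<open>Discreteness of the norm gains the factor p that keeps the translation z = 1/(p
    \<xi>) inside the ball.\<close>
  have "\<not> padic_norm \<xi> < real CARD('p) powi (- k + 1)"
    using False by (simp only: padic_norm_less_powi_iff) simp
  then have \<xi>: "real CARD('p) powi (- k + 1) \<le> padic_norm \<xi>"
    by simp
  have \<xi>0: "\<xi> \<noteq> 0"
    using \<xi> card_powi_pos[where 'p = 'p, of "- k + 1"] by auto
  define z where "z = inverse ?P * inverse \<xi>"
  have "padic_norm z = real CARD('p) * inverse (padic_norm \<xi>)"
    using padic_norm_card_powi[where 'p = 'p, of "-1"]
    by (simp add: z_def padic_norm_mult padic_norm_inverse power_int_minus)
  also have "\<dots> \<le> real CARD('p) * inverse (real CARD('p) powi (- k + 1))"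
    using \<xi> card_powi_pos[where 'p = 'p, of "- k + 1"] by (intro mult_left_mono le_imp_inverse_le) auto
  also have "\<dots> = ?r"
    using card_powi_add[where 'p = 'p, of 1 "k - 1"] by (simp flip: power_int_minus)
  finally have z: "padic_norm z \<le> ?r" .
  have "z * \<xi> = inverse ?P"
    using \<xi>0 by (simp add: z_def)
  then have char_z: "padic_char (z * \<xi>) \<noteq> 1"
    using padic_char_inverse_card[where 'p = 'p] by simp
  have [measurable]: "?g \<in> borel_measurable borel"
    by measurable
  have "?g (z + y) = padic_char (z * \<xi>) * ?g y" for y
  proof -
    have "dist y (z + y) = padic_norm z"
      by (simp add: dist_padic_def padic_norm_minus)
    then have "dist x (z + y) \<le> ?r \<longleftrightarrow> dist x y \<le> ?r"
      using z dist_padic_ultrametric[of x "z + y" y] dist_padic_ultrametric[of x y "z + y"]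
      by (auto simp: dist_commute)
    then show ?thesis
      by (simp add: distrib_right padic_char_add)
  qed
  then have "(LINT y|\<mu>. ?g (z + y)) = padic_char (z * \<xi>) * (LINT y|\<mu>. ?g y)"
    by (simp only: integral_mult_right_zero)
  moreover have "(LINT y|\<mu>. ?g (z + y)) = (LINT y|\<mu>. ?g y)"
    by (rule integral_translate) simp
  ultimately have "(1 - padic_char (z * \<xi>)) * (LINT y|\<mu>. ?g y) = 0"
    by (simp only: left_diff_distrib mult_1_left diff_self)
  then have "(LINT y|\<mu>. ?g y) = 0"
    using char_z by (simp only: mult_eq_0_iff) (simp add: eq_commute[of 1])
  then show ?thesis
    using False by (simp add: Q_def)
qed

text \<open>Symmetry of the kernel moves the average from \<open>f\<close> to the character, where
  it is an indicator in the frequency.\<close>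

lemma fourier_Q:
  assumes f: "integrable \<mu> f"
  shows "padic_fourier \<mu> (Q k f) \<xi>
    = (if padic_norm \<xi> \<le> real CARD('p) powi (- k) then padic_fourier \<mu> f \<xi> else 0)"
proof -
  have [measurable]: "f \<in> borel_measurable borel"
    using borel_measurable_integrable[OF f] by simp
  have "(\<integral>\<^sup>+ x. \<integral>\<^sup>+ y. (if dist x y \<le> real CARD('p) powi k
      then ennreal (cmod (f y * padic_char (x * \<xi>))) else 0) \<partial>\<mu> \<partial>\<mu>)
      = ennreal (real CARD('p) powi k) * (\<integral>\<^sup>+ y. ennreal (cmod (f y)) \<partial>\<mu>)"
    by (simp only: norm_mult norm_padic_char mult_1_right) (rule nn_integral_ball_swap, simp)
  also have "\<dots> = ennreal (real CARD('p) powi k) * ennreal (LINT x|\<mu>. cmod (f x))"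
    using f by (subst nn_integral_eq_integral) auto
  also have "\<dots> < \<infinity>"
    by (simp add: ennreal_mult_less_top)
  finally have "(LINT x|\<mu>. Q k f x * padic_char (x * \<xi>))
      = (LINT x|\<mu>. f x * Q k (\<lambda>x. padic_char (x * \<xi>)) x)"
    by (intro Q_swap) simp_all
  then show ?thesis
    unfolding padic_fourier_def padic_pairing_char Q_char by (simp add: mult.commute)
qed

lemma measurable_padic_char_pair [measurable]:
  "(\<lambda>z. padic_char (fst z * (snd z - a))) \<in> borel_measurable (borel \<Otimes>\<^sub>M (borel :: 'p padic measure))"
proof -
  have "continuous_on UNIV (\<lambda>z :: 'p padic \<times> 'p padic. padic_char (fst z * (snd z - a)))"
    unfolding continuous_on_iff
  proof (intro ballI allI impI)
    fix z :: "'p padic \<times> 'p padic" and e :: real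
    assume e: "e > 0"
    obtain x y where z: "z = (x, y)"
      by (cases z)
    \<comment> \<open>The summand 1 makes 1/C at most 1, so that moving \<open>y\<close> by less
      than 1/C keeps the norm of y - a below C; the product then changes by a p-adic
      integer.\<close>
    define C where "C = padic_norm x + padic_norm (y - a) + 1"
    have C: "C \<ge> 1" "padic_norm x \<le> C" "padic_norm (y - a) \<le> C"
      using padic_norm_nonneg[of x] padic_norm_nonneg[of "y - a"] by (auto simp: C_def)
    have const: "padic_char (x' * (y' - a)) = padic_char (x * (y - a))"
      if d: "dist x' x < 1 / C" "dist y' y < 1 / C" for x' y'
    proof (rule padic_char_locally_constant)
      have le1: "1 / C \<le> 1"
        using C by simp
      have "padic_norm (y' - a) \<le> C"
      proof -
        have "padic_norm (y' - a) \<le> max (padic_norm (y' - y)) (padic_norm (y - a))"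
          using padic_norm_add[of "y' - y" "y - a"] by simp
        then show ?thesis
          using d(2) le1 C unfolding dist_padic_def by linarith
      qed
      then have "padic_norm (x' - x) * padic_norm (y' - a) \<le> 1 / C * C"
        using d(1) padic_norm_nonneg C by (intro mult_mono) (auto simp: dist_padic_def)
      moreover have "padic_norm x * padic_norm (y' - y) \<le> C * (1 / C)"
        using d(2) padic_norm_nonneg C by (intro mult_mono) (auto simp: dist_padic_def)
      moreover have "x' * (y' - a) - x * (y - a) = (x' - x) * (y' - a) + x * (y' - y)"
        by (simp add: algebra_simps)
      ultimately show "dist (x' * (y' - a)) (x * (y - a)) \<le> 1"
        unfolding dist_padic_def
        using padic_norm_add[of "(x' - x) * (y' - a)" "x * (y' - y)"] C
        by (simp add: padic_norm_mult)
    qed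
    show "\<exists>d>0. \<forall>z'\<in>UNIV. dist z' z < d
        \<longrightarrow> dist (padic_char (fst z' * (snd z' - a))) (padic_char (fst z * (snd z - a))) < e"
    proof (intro exI[of _ "1 / C"] conjI ballI impI)
      show "1 / C > 0"
        using C by simp
      fix z'
      assume "dist z' z < 1 / C"
      then have "dist (fst z') x < 1 / C" "dist (snd z') y < 1 / C"
        using dist_fst_le[of z' z] dist_snd_le[of z' z] unfolding z fst_conv snd_conv by linarith+
      from const[OF this] show "dist (padic_char (fst z' * (snd z' - a))) (padic_char (fst z * (snd z - a))) < e"
        using e unfolding z fst_conv snd_conv by (simp only: dist_self)
    qed
  qed
  then show ?thesis
    unfolding borel_prod by (rule borel_measurable_continuous_onI)
qed

text \<open>The indicator of a ball around \<open>x\<close> is the Fourier transform of a character restricted to the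
  dual ball around \<open>0\<close>, so \<open>Q k g x\<close> is an average of values of the Fourier transform of \<open>g\<close>.\<close>

lemma Q_eq_0_of_fourier_eq_0:
  assumes g: "integrable \<mu> g" and fourier: "\<And>\<xi>. padic_fourier \<mu> g \<xi> = 0"
  shows "Q k g x = 0"
proof -
  let ?r = "real CARD('p) powi (- k)"
  let ?K = "\<lambda>\<xi> y. if dist 0 \<xi> \<le> ?r then padic_char (\<xi> * (y - x)) * g y else 0"
  have [measurable]: "g \<in> borel_measurable borel" "g \<in> borel_measurable \<mu>"
    using borel_measurable_integrable[OF g] by simp_all
  have meas [measurable]: "(\<lambda>z. ?K (fst z) (snd z)) \<in> borel_measurable (\<mu> \<Otimes>\<^sub>M \<mu>)"
    by measurable
  have "integrable (\<mu> \<Otimes>\<^sub>M \<mu>) (\<lambda>(\<xi>, y). ?K \<xi> y)"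
  proof (rule integrableI_bounded)
    let ?A = "LINT y|\<mu>. cmod (g y)"
    have A: "(\<integral>\<^sup>+ y. ennreal (cmod (g y)) \<partial>\<mu>) = ennreal ?A"
      using g by (intro nn_integral_eq_integral) auto
    have "(\<integral>\<^sup>+ z. ennreal (norm (case z of (\<xi>, y) \<Rightarrow> ?K \<xi> y)) \<partial>(\<mu> \<Otimes>\<^sub>M \<mu>))
        = (\<integral>\<^sup>+ \<xi>. \<integral>\<^sup>+ y. ennreal (norm (?K \<xi> y)) \<partial>\<mu> \<partial>\<mu>)"
      by (subst nn_integral_fst[symmetric]) (simp_all add: case_prod_unfold cong: if_cong del: dist_padic_0)
    also have "\<dots> = (\<integral>\<^sup>+ \<xi>. ennreal ?A * indicator (cball 0 ?r) \<xi> \<partial>\<mu>)"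
    proof (intro nn_integral_cong)
      fix \<xi>
      show "(\<integral>\<^sup>+ y. ennreal (norm (?K \<xi> y)) \<partial>\<mu>) = ennreal ?A * indicator (cball 0 ?r) \<xi>"
        by (cases "dist 0 \<xi> \<le> ?r") (simp_all add: norm_mult A)
    qed
    also have "\<dots> = ennreal ?A * ennreal ?r"
      by (subst nn_integral_cmult_indicator) (simp_all only: emeasure_cball sets_haar borel_closed closed_cball)
    also have "\<dots> < \<infinity>"
      by (simp add: ennreal_mult_less_top)
    finally show "(\<integral>\<^sup>+ z. ennreal (norm (case z of (\<xi>, y) \<Rightarrow> ?K \<xi> y)) \<partial>(\<mu> \<Otimes>\<^sub>M \<mu>)) < \<infinity>" .
  qed (use meas in \<open>simp add: case_prod_unfold del: dist_padic_0\<close>)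
  then have Fubini: "(LINT y|\<mu>. (LINT \<xi>|\<mu>. ?K \<xi> y)) = (LINT \<xi>|\<mu>. (LINT y|\<mu>. ?K \<xi> y))"
    by (rule pair.Fubini_integral)
  have "(LINT y|\<mu>. ?K \<xi> y) = 0" for \<xi>
  proof (cases "dist 0 \<xi> \<le> ?r")
    case True
    have "(LINT y|\<mu>. ?K \<xi> y) = (LINT y|\<mu>. padic_char (- (\<xi> * x)) * (padic_char (y * \<xi>) * g y))"
    proof (intro Bochner_Integration.integral_cong refl)
      fix y
      have "padic_char (\<xi> * (y - x)) = padic_char (- (\<xi> * x)) * padic_char (y * \<xi>)"
        unfolding padic_char_add[symmetric] by (simp add: algebra_simps)
      then show "?K \<xi> y = padic_char (- (\<xi> * x)) * (padic_char (y * \<xi>) * g y)"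
        using True by simp
    qed
    also have "\<dots> = padic_char (- (\<xi> * x)) * padic_fourier \<mu> g \<xi>"
      unfolding padic_fourier_def padic_pairing_char by (rule integral_mult_right_zero)
    finally show ?thesis
      by (simp add: fourier)
  qed simp
  then have zero: "(LINT y|\<mu>. (LINT \<xi>|\<mu>. ?K \<xi> y)) = 0"
    unfolding Fubini by simp
  \<comment> \<open>This is the average of a character over the dual ball, with y - x as its
    frequency; it vanishes exactly when y leaves the ball of radius p^k around x.\<close>
  have "(LINT \<xi>|\<mu>. ?K \<xi> y) = of_real ?r * (if dist x y \<le> real CARD('p) powi k then g y else 0)" for y
  proof -
    have "(LINT \<xi>|\<mu>. ?K \<xi> y) = (LINT \<xi>|\<mu>. (if dist 0 \<xi> \<le> ?r then padic_char (\<xi> * (y - x)) else 0) * g y)"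
      by (intro Bochner_Integration.integral_cong) auto
    also have "\<dots> = (LINT \<xi>|\<mu>. (if dist 0 \<xi> \<le> ?r then padic_char (\<xi> * (y - x)) else 0)) * g y"
      by (rule integral_mult_left_zero)
    also have "(LINT \<xi>|\<mu>. (if dist 0 \<xi> \<le> ?r then padic_char (\<xi> * (y - x)) else 0))
        = of_real ?r * Q (- k) (\<lambda>\<xi>. padic_char (\<xi> * (y - x))) 0"
      using card_pos[where 'p = 'p] by (simp add: Q_def)
    also have "Q (- k) (\<lambda>\<xi>. padic_char (\<xi> * (y - x))) 0 = (if dist x y \<le> real CARD('p) powi k then 1 else 0)"
      unfolding Q_char dist_commute[of x y] unfolding dist_padic_def by (simp add: padic_char_eq_1)
    finally show ?thesis
      by simp
  qed
  then have "of_real ?r * (LINT y|\<mu>. (if dist x y \<le> real CARD('p) powi k then g y else 0)) = 0"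
    using zero by (simp only: integral_mult_right_zero)
  then have "(LINT y|\<mu>. (if dist x y \<le> real CARD('p) powi k then g y else 0)) = 0"
    using card_pos[where 'p = 'p] by simp
  then show ?thesis
    by (simp add: Q_def)
qed

text \<open>On a small ball around \<open>x\<close> the function stays within half of |g x| of its
  value at \<open>x\<close>, so its average there cannot be 0.\<close>

lemma continuous_eq_0_of_Q_eq_0:
  assumes g: "integrable \<mu> g" "continuous_on UNIV g" and Q: "\<And>k x. Q k g x = 0"
  shows "g x = 0"
proof (rule ccontr)
  assume nz: "g x \<noteq> 0"
  define e where "e = cmod (g x) / 2"
  have e: "e > 0"
    using nz by (simp add: e_def)
  obtain d where d: "d > 0" "\<And>y. dist y x < d \<Longrightarrow> dist (g y) (g x) < e"
    using g(2) e unfolding continuous_on_iff by (metis UNIV_I)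
  obtain k where k: "real CARD('p) powi k < d"
    using d(1) by (rule card_powi_small)
  let ?r = "real CARD('p) powi k"
  let ?B = "\<lambda>y. if dist x y \<le> ?r then 1 else (0 :: real)"
  have r: "?r > 0"
    by (rule card_powi_pos)
  have B_eq: "?B = indicator (cball x ?r)"
    by auto
  have intB: "integrable \<mu> ?B" "(LINT y|\<mu>. ?B y) = ?r"
    unfolding B_eq by (auto simp: emeasure_cball measure_cball)
  have int_g: "integrable \<mu> (\<lambda>y. if dist x y \<le> ?r then g y else 0)"
  proof -
    have "integrable \<mu> (\<lambda>y. indicator (cball x ?r) y *\<^sub>R g y)"
      using g(1) by (intro integrable_mult_indicator) auto
    moreover have "(\<lambda>y. indicator (cball x ?r) y *\<^sub>R g y) = (\<lambda>y. if dist x y \<le> ?r then g y else 0)"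
      by auto
    ultimately show ?thesis
      by simp
  qed
  have "(LINT y|\<mu>. (if dist x y \<le> ?r then g y else 0)) = 0"
    using Q[of k x] card_pos[where 'p = 'p] by (simp add: Q_def)
  moreover have "(LINT y|\<mu>. ?B y *\<^sub>R g x) = ?r *\<^sub>R g x"
    using intB by (subst integral_scaleR_left) auto
  ultimately have "(LINT y|\<mu>. ?B y *\<^sub>R g x - (if dist x y \<le> ?r then g y else 0)) = ?r *\<^sub>R g x"
    using int_g intB by (subst Bochner_Integration.integral_diff) auto
  then have "?r * cmod (g x) = cmod (LINT y|\<mu>. ?B y *\<^sub>R g x - (if dist x y \<le> ?r then g y else 0))"
    using r by (simp only: norm_scaleR abs_of_pos)
  also have "\<dots> \<le> (LINT y|\<mu>. cmod (?B y *\<^sub>R g x - (if dist x y \<le> ?r then g y else 0)))"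
    by (rule integral_norm_bound)
  also have "\<dots> \<le> (LINT y|\<mu>. ?B y * e)"
  proof (rule integral_mono)
    show "integrable \<mu> (\<lambda>y. cmod (?B y *\<^sub>R g x - (if dist x y \<le> ?r then g y else 0)))"
      using int_g intB by (intro integrable_norm Bochner_Integration.integrable_diff integrable_scaleR_left)
    show "integrable \<mu> (\<lambda>y. ?B y * e)"
      using intB by (intro integrable_mult_left)
    fix y
    have "cmod (g x - g y) \<le> e" if "dist x y \<le> ?r"
      using d(2)[of y] that k by (simp add: dist_commute dist_norm norm_minus_commute)
    then show "cmod (?B y *\<^sub>R g x - (if dist x y \<le> ?r then g y else 0)) \<le> ?B y * e"
      by simp
  qed
  also have "\<dots> = ?r * e"
    using intB(2) by (simp only: integral_mult_left_zero)
  finally have "cmod (g x) \<le> e"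
    using r by (simp only: mult_le_cancel_left_pos)
  then show False
    using nz by (simp add: e_def)
qed

lemma integrable_fourier:
  assumes f: "integrable \<mu> f"
  shows "integrable \<mu> (\<lambda>x. padic_char (x * \<xi>) * f x)"
proof (rule Bochner_Integration.integrable_bound[OF f])
  have [measurable]: "f \<in> borel_measurable borel"
    using borel_measurable_integrable[OF f] by simp
  have "(\<lambda>x. padic_char (x * \<xi>) * f x) \<in> borel_measurable borel"
    by measurable
  then show "(\<lambda>x. padic_char (x * \<xi>) * f x) \<in> borel_measurable \<mu>"
    by simp
qed (simp add: norm_mult)

text \<open>Gives the uniqueness demanded by the definite description in
  \<open>padic_frac_deriv\<close>.\<close>

lemma fourier_inj:
  assumes "integrable \<mu> f" "continuous_on UNIV f" "integrable \<mu> g" "continuous_on UNIV g"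
    and "\<And>\<xi>. padic_fourier \<mu> f \<xi> = padic_fourier \<mu> g \<xi>"
  shows "f = g"
proof
  fix x
  have int: "integrable \<mu> (\<lambda>x. f x - g x)"
    by (intro Bochner_Integration.integrable_diff assms)
  have "padic_fourier \<mu> (\<lambda>x. f x - g x) \<xi> = padic_fourier \<mu> f \<xi> - padic_fourier \<mu> g \<xi>" for \<xi>
    unfolding padic_fourier_def padic_pairing_char right_diff_distrib
    by (intro Bochner_Integration.integral_diff integrable_fourier assms)
  then have "padic_fourier \<mu> (\<lambda>x. f x - g x) \<xi> = 0" for \<xi>
    by (simp only: assms(5) diff_self)
  then have "Q k (\<lambda>x. f x - g x) y = 0" for k y
    by (rule Q_eq_0_of_fourier_eq_0[OF int])
  then have "f x - g x = 0"
    by (rule continuous_eq_0_of_Q_eq_0[OF int continuous_on_diff[OF assms(2,4)]])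
  then show "f x = g x"
    by simp
qed

end

section \<open>The fractional derivative of a test function\<close>

text \<open>Fixes the data that compactness of the support provides: a level \<open>m\<close> of
  uniform local constancy and a bound \<open>B\<close>.\<close>

locale padic_test_function = padic_radius_law \<mu> \<alpha>
  for \<mu> :: "'p :: prime_card padic measure" and \<alpha> :: real +
  fixes f :: "'p padic \<Rightarrow> complex" and m :: int and B :: real
  assumes f: "f \<in> test_functions"
    and f_const: "\<And>x y. dist x y \<le> real CARD('p) powi m \<Longrightarrow> f x = f y"
    and f_bound: "\<And>x. cmod (f x) \<le> B"
begin

definition c :: "nat \<Rightarrow> real" where
  "c n = (real CARD('p) powi (- (m + int n))) powr \<alpha>"

text \<open>The candidate for the fractional derivative. The series starts at level \<open>m\<close>
  because \<open>f\<close> equals its averages up to that level, so the components below it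
  vanish.\<close>

definition g :: "'p padic \<Rightarrow> complex" where
  "g x = (\<Sum>n. of_real (c n) * D (m + int n) f x)"

lemma f_L2: "f \<in> L2 \<mu>"
  using f by (rule test_functions_L2)

lemma f_borel [measurable]: "f \<in> borel_measurable borel"
  using f by (rule test_functions_borel)

lemma f_integrable: "integrable \<mu> f"
  using f by (rule test_functions_integrable)

lemma c_nonneg: "c n \<ge> 0"
  by (simp add: c_def)

text \<open>A geometric series with ratio p^-alpha, which is below 1 because alpha is
  positive.\<close>

lemma summable_c: "summable c"
proof -
  have pos: "1 / real CARD('p) > 0"
    using card_pos[where 'p = 'p] by simp
  have eq: "c n = (real CARD('p) powi (- m)) powr \<alpha> * ((1 / real CARD('p)) powr \<alpha>) ^ n" for n
  proof -
    have "real CARD('p) powi (- (m + int n)) = real CARD('p) powi (- m) * (1 / real CARD('p)) ^ n"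
      using card_powi_add[where 'p = 'p, of "- m" "- int n"]
      by (simp add: power_int_minus power_one_over divide_inverse power_inverse)
    also have "(1 / real CARD('p)) ^ n = (1 / real CARD('p)) powr real n"
      by (rule powr_realpow[OF pos, symmetric])
    finally have "c n = (real CARD('p) powi (- m) * (1 / real CARD('p)) powr real n) powr \<alpha>"
      unfolding c_def by (simp only:)
    also have "\<dots> = (real CARD('p) powi (- m)) powr \<alpha> * ((1 / real CARD('p)) powr real n) powr \<alpha>"
      by (rule powr_mult)
    also have "((1 / real CARD('p)) powr real n) powr \<alpha> = ((1 / real CARD('p)) powr \<alpha>) powr real n"
      by (simp only: powr_powr mult.commute)
    also have "\<dots> = ((1 / real CARD('p)) powr \<alpha>) ^ n"
      using pos by (intro powr_realpow) simp
    finally show ?thesis .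
  qed
  have "(1 / real CARD('p)) powr \<alpha> < 1 powr \<alpha>"
    using \<alpha> card_gt_1[where 'p = 'p] by (intro powr_less_mono2) auto
  then have "summable (\<lambda>n. (real CARD('p) powi (- m)) powr \<alpha> * ((1 / real CARD('p)) powr \<alpha>) ^ n)"
    by (intro summable_mult summable_geometric) simp
  then show ?thesis
    unfolding eq[abs_def] .
qed

lemma D_bound: "cmod (D k f x) \<le> 2 * B"
  unfolding D_def using norm_Q_le_bound[OF f_borel f_bound, of k x]
    norm_Q_le_bound[OF f_borel f_bound, of "k + 1" x] norm_triangle_ineq4[of "Q k f x" "Q (k + 1) f x"]
  by linarith

lemma D_borel [measurable]: "D k f \<in> borel_measurable borel"
  unfolding D_abs_def by measurable

lemma D_integrable: "integrable \<mu> (D k f)"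
  unfolding D_abs_def by (intro Bochner_Integration.integrable_diff integrable_Q f_integrable)

lemma D_integral_bound: "(LINT x|\<mu>. cmod (D k f x)) \<le> 2 * (LINT x|\<mu>. cmod (f x))"
proof -
  have Q: "integrable \<mu> (\<lambda>x. cmod (Q k f x))" for k
    by (intro integrable_norm integrable_Q f_integrable)
  have "(LINT x|\<mu>. cmod (D k f x)) \<le> (LINT x|\<mu>. cmod (Q k f x) + cmod (Q (k + 1) f x))"
    by (rule integral_mono)
      (auto simp: D_def norm_triangle_ineq4 intro!: integrable_norm D_integrable[unfolded D_abs_def] Q
        Bochner_Integration.integrable_add)
  also have "\<dots> = (LINT x|\<mu>. cmod (Q k f x)) + (LINT x|\<mu>. cmod (Q (k + 1) f x))"
    by (intro Bochner_Integration.integral_add Q)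
  also have "\<dots> \<le> 2 * (LINT x|\<mu>. cmod (f x))"
    using integrable_Q(2)[OF f_integrable, of k] integrable_Q(2)[OF f_integrable, of "k + 1"] by linarith
  finally show ?thesis .
qed

lemma norm_term_le: "cmod (of_real (c n) * D k f x) \<le> c n * (2 * B)"
  using D_bound[of k x] c_nonneg[of n] by (simp add: norm_mult mult_left_mono)

lemma summable_norm_terms: "summable (\<lambda>n. cmod (of_real (c n) * D (m + int n) f x))"
  by (rule summable_comparison_test'[OF summable_mult2[OF summable_c, of "2 * B"], where N = 0])
    (use norm_term_le in simp)

lemma g_sums: "(\<lambda>n. of_real (c n) * D (m + int n) f x) sums g x"
  unfolding g_def by (rule summable_sums[OF summable_norm_cancel[OF summable_norm_terms]])

lemma norm_g_le: "cmod (g x) \<le> suminf c * (2 * B)"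
proof -
  have "cmod (g x) \<le> (\<Sum>n. cmod (of_real (c n) * D (m + int n) f x))"
    unfolding g_def by (rule summable_norm[OF summable_norm_terms])
  also have "\<dots> \<le> (\<Sum>n. c n * (2 * B))"
    by (rule suminf_le[OF norm_term_le summable_norm_terms summable_mult2[OF summable_c]])
  also have "\<dots> = suminf c * (2 * B)"
    by (rule suminf_mult2[OF summable_c, symmetric])
  finally show ?thesis .
qed

lemma g_const:
  assumes "dist x y \<le> real CARD('p) powi m"
  shows "g x = g y"
proof -
  have "D (m + int n) f x = D (m + int n) f y" for n
  proof -
    have "dist x y \<le> real CARD('p) powi (m + int n)" "dist x y \<le> real CARD('p) powi (m + int n + 1)"
      using assms card_powi_le_iff[where 'p = 'p, of m "m + int n"]
        card_powi_le_iff[where 'p = 'p, of m "m + int n + 1"] by auto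
    then show ?thesis
      unfolding D_def by (simp only: Q_cong_dist[of x y])
  qed
  then show ?thesis
    by (simp add: g_def)
qed

lemma g_continuous: "continuous_on UNIV g"
  by (rule continuous_on_locally_constant[OF card_powi_pos g_const])

text \<open>Integration term by term against a bounded multiplier: the constant 1 yields
  integrability of \<open>g\<close>, the indicator of a ball its averages, a character its Fourier
  transform. The L^1 norms of the components are bounded uniformly, so summability of
  \<open>c\<close> suffices.\<close>

lemma integral_mult_g:
  assumes [measurable]: "\<phi> \<in> borel_measurable borel" and \<phi>: "\<And>x. cmod (\<phi> x) \<le> 1"
  shows "integrable \<mu> (\<lambda>x. \<phi> x * g x)"
    and "(\<lambda>n. of_real (c n) * (LINT x|\<mu>. \<phi> x * D (m + int n) f x)) sums (LINT x|\<mu>. \<phi> x * g x)"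
proof -
  let ?F = "\<lambda>n x. \<phi> x * (of_real (c n) * D (m + int n) f x)"
  have le: "cmod (?F n x) \<le> c n * cmod (D (m + int n) f x)" for n x
  proof -
    have "cmod (\<phi> x) * (c n * cmod (D (m + int n) f x)) \<le> 1 * (c n * cmod (D (m + int n) f x))"
      using c_nonneg by (intro mult_right_mono \<phi>) simp
    then show ?thesis
      using c_nonneg[of n] by (simp add: norm_mult)
  qed
  have meas: "?F n \<in> borel_measurable \<mu>" for n
    by (subst measurable_cong_sets[OF sets_haar refl]) measurable
  have int: "integrable \<mu> (?F n)" for n
  proof (rule Bochner_Integration.integrable_bound[OF _ meas])
    show "integrable \<mu> (\<lambda>x. c n * cmod (D (m + int n) f x))"
      by (intro integrable_mult_right integrable_norm D_integrable)
    show "AE x in \<mu>. norm (?F n x) \<le> norm (c n * cmod (D (m + int n) f x))"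
      using le c_nonneg[of n] by (intro AE_I2) simp
  qed
  have AE: "AE x in \<mu>. summable (\<lambda>n. norm (?F n x))"
  proof (intro AE_I2)
    fix x
    show "summable (\<lambda>n. norm (?F n x))"
    proof (rule summable_comparison_test'[OF summable_norm_terms[of x], where N = 0])
      fix n
      show "norm (norm (?F n x)) \<le> cmod (of_real (c n) * D (m + int n) f x)"
        using le[of x n] c_nonneg[of n] by (simp add: norm_mult)
    qed
  qed
  have sum: "summable (\<lambda>n. LINT x|\<mu>. norm (?F n x))"
  proof (rule summable_comparison_test'[OF summable_mult2[OF summable_c, of "2 * (LINT x|\<mu>. cmod (f x))"], where N = 0])
    fix n
    have "(LINT x|\<mu>. norm (?F n x)) \<le> (LINT x|\<mu>. c n * cmod (D (m + int n) f x))"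
      using le int by (intro integral_mono integrable_norm integrable_mult_right D_integrable)
    also have "\<dots> = c n * (LINT x|\<mu>. cmod (D (m + int n) f x))"
      by (rule integral_mult_right_zero)
    also have "\<dots> \<le> c n * (2 * (LINT x|\<mu>. cmod (f x)))"
      by (intro mult_left_mono D_integral_bound c_nonneg)
    finally show "norm (LINT x|\<mu>. norm (?F n x)) \<le> c n * (2 * (LINT x|\<mu>. cmod (f x)))"
      by simp
  qed
  have eq: "(\<Sum>n. ?F n x) = \<phi> x * g x" for x
    using sums_mult[OF g_sums[of x], of "\<phi> x"] by (rule sums_unique[symmetric])
  show "integrable \<mu> (\<lambda>x. \<phi> x * g x)"
    using integrable_suminf[OF int AE sum] unfolding eq .
  have "(\<lambda>n. LINT x|\<mu>. ?F n x) sums (LINT x|\<mu>. \<phi> x * g x)"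
    using sums_integral[OF int AE sum] unfolding eq .
  moreover have "(LINT x|\<mu>. ?F n x) = of_real (c n) * (LINT x|\<mu>. \<phi> x * D (m + int n) f x)" for n
    unfolding mult.left_commute[of "\<phi> _"] by (rule integral_mult_right_zero)
  ultimately show "(\<lambda>n. of_real (c n) * (LINT x|\<mu>. \<phi> x * D (m + int n) f x)) sums (LINT x|\<mu>. \<phi> x * g x)"
    by simp
qed

lemma g_integrable: "integrable \<mu> g"
  using integral_mult_g(1)[of "\<lambda>_. 1"] by simp

lemma g_L2: "g \<in> L2 \<mu>"
  by (rule L2_of_bounded_integrable[OF g_integrable norm_g_le])

section \<open>Averages and Fourier transform of the series\<close>

lemma Q_f: "k \<le> m \<Longrightarrow> Q k f x = f x"
proof (rule Q_const)
  fix y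
  assume "k \<le> m" "dist x y \<le> real CARD('p) powi k"
  then have "dist x y \<le> real CARD('p) powi m"
    using card_powi_le_iff[where 'p = 'p, of k m] by simp
  then show "f y = f x"
    by (rule f_const[symmetric])
qed

lemma Q_g_sums: "(\<lambda>n. of_real (c n) * (if k \<le> m + int n then D (m + int n) f x else 0)) sums Q k g x"
proof -
  let ?r = "complex_of_real (real CARD('p) powi k)"
  let ?\<phi> = "\<lambda>y. if dist x y \<le> real CARD('p) powi k then 1 else (0 :: complex)"
  have "(\<lambda>n. of_real (c n) * (LINT y|\<mu>. ?\<phi> y * D (m + int n) f y)) sums (LINT y|\<mu>. ?\<phi> y * g y)"
    by (rule integral_mult_g[OF L2_borel[OF L2_indicator_ball]]) simp
  then have "(\<lambda>n. of_real (c n) * (LINT y|\<mu>. ?\<phi> y * D (m + int n) f y) / ?r) sums ((LINT y|\<mu>. ?\<phi> y * g y) / ?r)"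
    by (rule sums_divide)
  moreover have "(LINT y|\<mu>. ?\<phi> y * u y) / ?r = Q k u x" for u
    unfolding Q_def by (intro arg_cong2[where f = "(/)"] Bochner_Integration.integral_cong) auto
  ultimately have "(\<lambda>n. of_real (c n) * Q k (D (m + int n) f) x) sums Q k g x"
    by (simp only: times_divide_eq_right[symmetric])
  then show ?thesis
    unfolding Q_D[OF f_L2] .
qed

text \<open>Averages of levels \<open>k\<close> and \<open>k + 1\<close> truncate the series at
  consecutive places, so their difference is the single term of level \<open>k\<close>. Below level
  \<open>m\<close> both sides are 0.\<close>

lemma D_g: "D k g x = of_real ((real CARD('p) powi (- k)) powr \<alpha>) * D k f x"
proof -
  have "(\<lambda>n. of_real (c n) * (if k \<le> m + int n then D (m + int n) f x else 0)
      - of_real (c n) * (if k + 1 \<le> m + int n then D (m + int n) f x else 0)) sums D k g x"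
    unfolding D_def[of k g] by (intro sums_diff Q_g_sums)
  moreover have "of_real (c n) * (if k \<le> m + int n then D (m + int n) f x else 0)
      - of_real (c n) * (if k + 1 \<le> m + int n then D (m + int n) f x else 0)
      = (if m + int n = k then of_real (c n) * D k f x else 0)" for n
    by auto
  ultimately have sums: "(\<lambda>n. if m + int n = k then of_real (c n) * D k f x else 0) sums D k g x"
    by (simp only:)
  show ?thesis
  proof (cases "m \<le> k")
    case True
    then have "(m + int n = k) = (n = nat (k - m))" for n
      by auto
    then have "(\<lambda>n. if n = nat (k - m) then of_real (c n) * D k f x else 0) sums D k g x"
      using sums by (simp only:)
    moreover have "(\<lambda>n. if n = nat (k - m) then of_real (c n) * D k f x else 0)
        sums (of_real (c (nat (k - m))) * D k f x)"
      by (rule sums_single)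
    ultimately have "D k g x = of_real (c (nat (k - m))) * D k f x"
      by (rule sums_unique2)
    then show ?thesis
      using True by (simp add: c_def)
  next
    case False
    then have D_f: "D k f x = 0"
      by (simp add: D_def Q_f)
    have "(\<lambda>n. 0) sums D k g x"
      using sums unfolding D_f mult_zero_right if_cancel .
    then have "D k g x = 0"
      using sums_zero by (rule sums_unique2)
    then show ?thesis
      by (simp add: D_f)
  qed
qed

text \<open>The difference of the indicators of two consecutive dual balls is the indicator of a
  sphere.\<close>

lemma fourier_D:
  "padic_fourier \<mu> (D k f) \<xi> = (if padic_norm \<xi> = real CARD('p) powi (- k) then padic_fourier \<mu> f \<xi> else 0)"
proof -
  have "padic_fourier \<mu> (D k f) \<xi> = padic_fourier \<mu> (Q k f) \<xi> - padic_fourier \<mu> (Q (k + 1) f) \<xi>"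
    unfolding padic_fourier_def padic_pairing_char D_abs_def right_diff_distrib
    by (intro Bochner_Integration.integral_diff integrable_fourier integrable_Q f_integrable)
  moreover have "padic_norm \<xi> \<le> real CARD('p) powi (- (k + 1)) \<longleftrightarrow> padic_norm \<xi> < real CARD('p) powi (- k)"
    using padic_norm_less_powi_iff[of \<xi> "- (k + 1)"] by simp
  ultimately show ?thesis
    unfolding fourier_Q[OF f_integrable] by auto
qed

lemma fourier_f_eq_0:
  assumes "\<not> padic_norm \<xi> \<le> real CARD('p) powi (- m)"
  shows "padic_fourier \<mu> f \<xi> = 0"
proof -
  have "Q m f = f"
    by (rule ext) (simp add: Q_f)
  then show ?thesis
    using fourier_Q[OF f_integrable, of m \<xi>] assms by simp
qed

lemma fourier_g: "padic_fourier \<mu> g \<xi> = of_real (padic_norm \<xi> powr \<alpha>) * padic_fourier \<mu> f \<xi>"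
proof -
  have "(\<lambda>n. of_real (c n) * padic_fourier \<mu> (D (m + int n) f) \<xi>) sums padic_fourier \<mu> g \<xi>"
    unfolding padic_fourier_def padic_pairing_char by (rule integral_mult_g) simp_all
  then have sums: "(\<lambda>n. of_real (c n) * (if padic_norm \<xi> = real CARD('p) powi (- (m + int n))
      then padic_fourier \<mu> f \<xi> else 0)) sums padic_fourier \<mu> g \<xi>"
    unfolding fourier_D .
  show ?thesis
  proof (cases "\<exists>n. padic_norm \<xi> = real CARD('p) powi (- (m + int n))")
    case True
    then obtain N where N: "padic_norm \<xi> = real CARD('p) powi (- (m + int N))"
      by (elim exE)
    have "(padic_norm \<xi> = real CARD('p) powi (- (m + int n))) = (n = N)" for n
      unfolding N using card_powi_less_iff[where 'p = 'p, of "- (m + int n)" "- (m + int N)"]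
        card_powi_less_iff[where 'p = 'p, of "- (m + int N)" "- (m + int n)"]
      by (cases n N rule: linorder_cases) auto
    then have "of_real (c n) * (if padic_norm \<xi> = real CARD('p) powi (- (m + int n))
        then padic_fourier \<mu> f \<xi> else 0) = (if n = N then of_real (c n) * padic_fourier \<mu> f \<xi> else 0)" for n
      by (simp only:) simp
    then have "(\<lambda>n. if n = N then of_real (c n) * padic_fourier \<mu> f \<xi> else 0) sums padic_fourier \<mu> g \<xi>"
      using sums by (simp only:)
    moreover have "(\<lambda>n. if n = N then of_real (c n) * padic_fourier \<mu> f \<xi> else 0)
        sums (of_real (c N) * padic_fourier \<mu> f \<xi>)"
      by (rule sums_single)
    ultimately have "padic_fourier \<mu> g \<xi> = of_real (c N) * padic_fourier \<mu> f \<xi>"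
      by (rule sums_unique2)
    then show ?thesis
      unfolding N c_def .
  next
    case False
    then have "of_real (c n) * (if padic_norm \<xi> = real CARD('p) powi (- (m + int n))
        then padic_fourier \<mu> f \<xi> else 0) = 0" for n
      by simp
    then have "(\<lambda>n. 0) sums padic_fourier \<mu> g \<xi>"
      using sums by (simp only:)
    then have "padic_fourier \<mu> g \<xi> = 0"
      using sums_zero by (rule sums_unique2)
    \<comment> \<open>Frequencies on none of the spheres of the series are 0, where the factor
      \<open>0 powr \<alpha>\<close> vanishes, and those of norm above p^-m, where the transform of
      \<open>f\<close> vanishes.\<close>
    moreover have "\<xi> = 0 \<or> padic_fourier \<mu> f \<xi> = 0"
    proof (rule disjCI)
      assume nz: "padic_fourier \<mu> f \<xi> \<noteq> 0"
      show "\<xi> = 0"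
      proof (rule ccontr)
        assume "\<xi> \<noteq> 0"
        then obtain j where j: "padic_norm \<xi> = real CARD('p) powi j"
          by (rule padic_norm_powi)
        have "padic_norm \<xi> \<le> real CARD('p) powi (- m)"
          using nz fourier_f_eq_0 by blast
        then have "j \<le> - m"
          unfolding j card_powi_le_iff .
        then have "j = - (m + int (nat (- j - m)))"
          by simp
        then show False
          using False j by metis
      qed
    qed
    ultimately show ?thesis
      using \<alpha> by auto
  qed
qed

lemma padic_frac_deriv_eq: "padic_frac_deriv \<mu> \<alpha> f = g"
  unfolding padic_frac_deriv_def
proof (rule the_equality)
  show "continuous_on UNIV g \<and> integrable \<mu> g
      \<and> (\<forall>\<xi>. padic_fourier \<mu> g \<xi> = of_real (padic_norm \<xi> powr \<alpha>) * padic_fourier \<mu> f \<xi>)"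
    by (intro conjI allI g_continuous g_integrable fourier_g)
  fix h
  assume h: "continuous_on UNIV h \<and> integrable \<mu> h
      \<and> (\<forall>\<xi>. padic_fourier \<mu> h \<xi> = of_real (padic_norm \<xi> powr \<alpha>) * padic_fourier \<mu> f \<xi>)"
  show "h = g"
  proof (rule fourier_inj)
    show "padic_fourier \<mu> h \<xi> = padic_fourier \<mu> g \<xi>" for \<xi>
      using h unfolding fourier_g by simp
  qed (use h g_continuous g_integrable in simp_all)
qed

lemma padic_frac_deriv_isotropic_laplacian:
  "(f, padic_frac_deriv \<mu> \<alpha> f) \<in> isotropic_laplacian \<mu> (sigma_alpha CARD('p) \<alpha>)"
  unfolding padic_frac_deriv_eq by (rule isotropic_laplacianI[OF f_L2 g_L2 D_g])

end

theorem theorem5p2: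
  fixes \<mu> :: "'p :: prime_card padic measure" and \<alpha> :: real
  assumes "padic_haar \<mu>" and "\<alpha> > 0"
  defines "L \<equiv> isotropic_laplacian \<mu> (sigma_alpha CARD('p) \<alpha>)"
  shows "test_functions \<subseteq> Domain L \<and> (\<forall>f\<in>test_functions. (f, padic_frac_deriv \<mu> \<alpha> f) \<in> L)"
proof -
  have "(f, padic_frac_deriv \<mu> \<alpha> f) \<in> L" if f: "f \<in> test_functions" for f
  proof -
    obtain m where m: "\<forall>x y. dist x y \<le> real CARD('p) powi m \<longrightarrow> f x = f y"
      using test_functions_uniformly_locally_constant[OF f] by (elim exE)
    obtain B where B: "\<forall>x. cmod (f x) \<le> B"
      using test_functions_bounded[OF f] by (elim exE)
    interpret padic_test_function \<mu> \<alpha> f m B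
      using assms(1,2) f m B by unfold_locales auto
    show ?thesis
      unfolding L_def by (rule padic_frac_deriv_isotropic_laplacian)
  qed
  then show ?thesis
    by blast
qed

end
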